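(* Let $f$ be a transcendental entire function, let $U$ be an expanding Baker domain of $f$, and let $r>0$ be the radius in the definition of expanding Baker domain. Then, for $\widetilde{\omega_U}$-almost every backward orbit $\{x_n\}_{n\ge0}\subset\partial U$ and every $r_0\in(0,r)$, there exist $n_0\in\mathbb{N}$ and $K>1$ such that, for all $n\ge n_0$, $$F_n(D(x_0,r_0))\subset D\big(x_n,K^{-\sqrt[3]{n}}\,r_0\big),$$ where $F_n$ is the branch of $f^{-n}$, defined on $D(x_0,r)$, sending $x_0$ to $x_n$.
   Context: Doubly parabolic Baker domains. A doubly parabolic Baker domain $U$ of a transcendental entire function $f$ is an invariant Fatou component (connected component of the Fatou set with $f(U)\subset U$; it is simply connected) on which the iterates $f^n$ converge locally uniformly to $\infty$ and such that for $z\in U$ the hyperbolic distance in $U$ between $f^n(z)$ and $f^{n+1}(z)$ tends to $0$. Let $\varphi\colon\mathbb{D}\to U$ be a Riemann map and $g=\varphi^{-1}\circ f\circ\varphi$ the associated inner function; its Denjoy-Wolff point is the point of $\partial\mathbb{D}$ to which all interior orbits converge, and $\varphi$ is chosen so that it is $1$. A singularity of $g$ is a point of $\partial\mathbb{D}$ near which $g$ has no analytic extension. $\omega_U$ is the push-forward under the radial extension $\varphi^*$ of normalized Lebesgue measure on $\partial\mathbb{D}$. Let $\psi\colon\mathbb{H}\to U$ be a conformal map from the upper half-plane onto $U$ such that points of $\mathbb{H}$ converge to $\infty$ under iteration of $\psi^{-1}\circ f\circ\psi$, and let $\psi^*$ be its boundary extension by non-tangential limits. The push-forward $\mu$ under $\psi^*$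 of Lebesgue measure on $\mathbb{R}$ is $\sigma$-finite, $f$-invariant and has the same null sets as $\omega_U$. Finite targets. A finite target is a set $\psi^*(I)\subset\partial U$, where $I\subset\mathbb{R}$ is a closed bounded interval with endpoints $x_1\neq x_2$ such that $\psi^*(x_1)=\psi^*(x_2)=\infty$. Expanding Baker domains. $U$ is an expanding Baker domain if there exists $r>0$ such that: (a) $U$ is a doubly parabolic Baker domain and the Denjoy-Wolff point of the associated inner function is not a singularity; (b) for every $x,y\in\partial U$ with $f(y)=x$ there exists a branch $F_y$ of $f^{-1}$ with $F_y(x)=y$, well defined in $D(x,r)$, and $F_y(D(x,r)\cap U)\subset U$; (c) $|f'(z)|>1$ for $z\in D(x,r)$, for all $x\in\partial U$; and for every finite target $E$ there is $K_E>1$ with $|f'(z)|\ge K_E$ for $z\in D(x,r)$, for all $x\in E$. Backward orbits. A backward orbit is a sequence $\{x_n\}_{n\ge0}\subset\partial U$ with $f(x_{n+1})=x_n$ for all $n\ge0$. For an expanding Baker domain, for each backward orbit the branch $F_n$ of $f^{-n}$ sending $x_0$ to $x_n$ is well defined in $D(x_0,r)$ for all $n\geq 0$. The measure on the space of backward orbits is given by Rokhlin's natural extension: $\widetilde\mu$ is the measure satisfying $\widetilde\mu(\pi_j^{-1}(A))=\mu(A)$ for all $j\ge0$ and all measurable $A\subset\partial U$, where $\pi_j(\{x_n\}_n)=x_j$, and $\widetilde{\omega_U}$ is the corresponding measure with density $\frac{d\omega_U}{d\mu}\circ\pi_0$ with respect to $\widetilde\mu$; in particular $\widetilde{\omega_U}$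 and $\widetilde\mu$ have the same null sets. *)

theory Defs
  imports "HOL-Complex_Analysis.Complex_Analysis"
begin

section \<open>Normality and the Fatou set\<close>

definition transcendental_entire :: "(complex \<Rightarrow> complex) \<Rightarrow> bool" where
  "transcendental_entire f \<longleftrightarrow> f holomorphic_on UNIV \<and> (\<nexists>p. f = poly p)"

definition locally_uniformly_to_infinity :: "complex set \<Rightarrow> (nat \<Rightarrow> complex \<Rightarrow> complex) \<Rightarrow> bool" where
  "locally_uniformly_to_infinity V s \<longleftrightarrow>
     (\<forall>K B. compact K \<and> K \<subseteq> V \<longrightarrow> (\<forall>\<^sub>F n in sequentially. \<forall>z\<in>K. B < norm (s n z)))"

text \<open>Normality with respect to the spherical metric.  For holomorphic functions on a connected
  open set, a locally uniform limit in the sphere is either finite everywhere or identically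
  infinite; this is why the definition is only used on connected sets.\<close>

definition normal_family_on :: "complex set \<Rightarrow> (complex \<Rightarrow> complex) set \<Rightarrow> bool" where
  "normal_family_on V \<F> \<longleftrightarrow>
     (\<forall>s :: nat \<Rightarrow> complex \<Rightarrow> complex. range s \<subseteq> \<F> \<longrightarrow>
        (\<exists>k. strict_mono k \<and>
          ((\<exists>g. \<forall>K. compact K \<and> K \<subseteq> V \<longrightarrow> uniform_limit K (s \<circ> k) g sequentially) \<or>
           locally_uniformly_to_infinity V (s \<circ> k))))"

definition fatou_set :: "(complex \<Rightarrow> complex) \<Rightarrow> complex set" where
  "fatou_set f = {z. \<exists>V. open V \<and> connected V \<and> z \<in> V \<and> normal_family_on V (range (\<lambda>n. f ^^ n))}"

section \<open>Conformal maps, hyperbolic distance and conjugated maps\<close>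

definition conformal_map :: "complex set \<Rightarrow> complex set \<Rightarrow> (complex \<Rightarrow> complex) \<Rightarrow> bool" where
  "conformal_map S T h \<longleftrightarrow> h holomorphic_on S \<and> bij_betw h S T"

definition disc_dist :: "complex \<Rightarrow> complex \<Rightarrow> real" where
  "disc_dist a b = 2 * artanh (norm (a - b) / norm (1 - cnj b * a))"

text \<open>Only meant for simply connected domains other than the plane.  By Schwarz-Pick the value
  does not depend on the Riemann map that is chosen.\<close>

definition hyperbolic_dist :: "complex set \<Rightarrow> complex \<Rightarrow> complex \<Rightarrow> real" where
  "hyperbolic_dist U z w =
     (let h = (SOME h. conformal_map (ball 0 1) U h)
      in disc_dist (inv_into (ball 0 1) h z) (inv_into (ball 0 1) h w))"

definition conjugate_by ::
    "complex set \<Rightarrow> (complex \<Rightarrow> complex) \<Rightarrow> (complex \<Rightarrow> complex) \<Rightarrow> complex \<Rightarrow> complex" where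
  "conjugate_by S h f = inv_into S h \<circ> f \<circ> h"

abbreviation inner_function :: "(complex \<Rightarrow> complex) \<Rightarrow> (complex \<Rightarrow> complex) \<Rightarrow> complex \<Rightarrow> complex" where
  "inner_function f \<phi> \<equiv> conjugate_by (ball 0 1) \<phi> f"

definition denjoy_wolff_point :: "(complex \<Rightarrow> complex) \<Rightarrow> complex \<Rightarrow> bool" where
  "denjoy_wolff_point g p \<longleftrightarrow> p \<in> sphere 0 1 \<and> (\<forall>z\<in>ball 0 1. (\<lambda>n. (g ^^ n) z) \<longlonglongrightarrow> p)"

definition singularity_of :: "(complex \<Rightarrow> complex) \<Rightarrow> complex \<Rightarrow> bool" where
  "singularity_of g p \<longleftrightarrow> p \<in> sphere 0 1 \<and>
     \<not> (\<exists>e>0. \<exists>h. h holomorphic_on ball p e \<and> (\<forall>z\<in>ball p e \<inter> ball 0 1. h z = g z))"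

definition upper_half_plane :: "complex set" where
  "upper_half_plane = {z. 0 < Im z}"

definition disc_uniformization ::
    "(complex \<Rightarrow> complex) \<Rightarrow> complex set \<Rightarrow> (complex \<Rightarrow> complex) \<Rightarrow> bool" where
  "disc_uniformization f U \<phi> \<longleftrightarrow>
     conformal_map (ball 0 1) U \<phi> \<and> denjoy_wolff_point (inner_function f \<phi>) 1"

definition half_plane_uniformization ::
    "(complex \<Rightarrow> complex) \<Rightarrow> complex set \<Rightarrow> (complex \<Rightarrow> complex) \<Rightarrow> bool" where
  "half_plane_uniformization f U \<psi> \<longleftrightarrow>
     conformal_map upper_half_plane U \<psi> \<and>
     (\<forall>z\<in>upper_half_plane.
        filterlim (\<lambda>n. (conjugate_by upper_half_plane \<psi> f ^^ n) z) at_infinity sequentially)"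

section \<open>Boundary extensions and the measures on the boundary\<close>

text \<open>Boundary extensions may take the value infinity or fail to exist on a null set.  Their
  domains below consist of the points where the limit exists and is finite; the value infinity
  is expressed by convergence to \<^const>\<open>at_infinity\<close>.\<close>

definition radial_domain :: "(complex \<Rightarrow> complex) \<Rightarrow> complex set" where
  "radial_domain \<phi> = {\<zeta> \<in> sphere 0 1. \<exists>l. ((\<lambda>t. \<phi> (of_real t * \<zeta>)) \<longlongrightarrow> l) (at_left 1)}"

definition radial_ext :: "(complex \<Rightarrow> complex) \<Rightarrow> complex \<Rightarrow> complex" where
  "radial_ext \<phi> \<zeta> = Lim (at_left 1) (\<lambda>t. \<phi> (of_real t * \<zeta>))"

definition circle_measure :: "complex measure" where
  "circle_measure = distr (uniform_measure lborel {0..<2 * pi}) borel cis"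

definition omega :: "complex set \<Rightarrow> (complex \<Rightarrow> complex) \<Rightarrow> complex measure" where
  "omega U \<phi> = distr (restrict_space circle_measure (radial_domain \<phi>))
                      (restrict_space borel (frontier U)) (radial_ext \<phi>)"

definition stolz_angle :: "real \<Rightarrow> real \<Rightarrow> complex set" where
  "stolz_angle x \<alpha> = {z. 0 < Im z \<and> \<bar>Re z - x\<bar> < \<alpha> * Im z}"

text \<open>A property holds eventually for this filter iff it holds eventually in every Stolz angle.\<close>

definition nontangential_at :: "real \<Rightarrow> complex filter" where
  "nontangential_at x = (SUP \<alpha>\<in>{0<..}. at (of_real x) within stolz_angle x \<alpha>)"

definition nontangential_domain :: "(complex \<Rightarrow> complex) \<Rightarrow> real set" where
  "nontangential_domain \<psi> = {x. \<exists>l. (\<psi> \<longlongrightarrow> l) (nontangential_at x)}"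

definition nontangential_ext :: "(complex \<Rightarrow> complex) \<Rightarrow> real \<Rightarrow> complex" where
  "nontangential_ext \<psi> x = Lim (nontangential_at x) \<psi>"

definition mu :: "complex set \<Rightarrow> (complex \<Rightarrow> complex) \<Rightarrow> complex measure" where
  "mu U \<psi> = distr (restrict_space lborel (nontangential_domain \<psi>))
                   (restrict_space borel (frontier U)) (nontangential_ext \<psi>)"

section \<open>Expanding Baker domains\<close>

definition doubly_parabolic_Baker_domain :: "(complex \<Rightarrow> complex) \<Rightarrow> complex set \<Rightarrow> bool" where
  "doubly_parabolic_Baker_domain f U \<longleftrightarrow>
     U \<in> components (fatou_set f) \<and> f ` U \<subseteq> U \<and>
     locally_uniformly_to_infinity U (\<lambda>n. f ^^ n) \<and>
     (\<forall>z\<in>U. (\<lambda>n. hyperbolic_dist U ((f ^^ n) z) ((f ^^ Suc n) z)) \<longlonglongrightarrow> 0)"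

text \<open>The point infinity, which is the boundary value at the endpoints, is left out of \<^term>\<open>E\<close>.\<close>

definition finite_target :: "(complex \<Rightarrow> complex) \<Rightarrow> complex set \<Rightarrow> bool" where
  "finite_target \<psi> E \<longleftrightarrow>
     (\<exists>a b. a < b \<and> filterlim \<psi> at_infinity (nontangential_at a) \<and>
            filterlim \<psi> at_infinity (nontangential_at b) \<and>
            E = nontangential_ext \<psi> ` ({a..b} \<inter> nontangential_domain \<psi>))"

definition inverse_branch_on ::
    "(complex \<Rightarrow> complex) \<Rightarrow> complex set \<Rightarrow> (complex \<Rightarrow> complex) \<Rightarrow> bool" where
  "inverse_branch_on f S F \<longleftrightarrow> F holomorphic_on S \<and> (\<forall>z\<in>S. f (F z) = z)"

definition expanding_with_radius ::
    "(complex \<Rightarrow> complex) \<Rightarrow> complex set \<Rightarrow> (complex \<Rightarrow> complex) \<Rightarrow> (complex \<Rightarrow> complex) \<Rightarrow> real \<Rightarrow> bool"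
  where
  "expanding_with_radius f U \<phi> \<psi> r \<longleftrightarrow>
     0 < r \<and>
     doubly_parabolic_Baker_domain f U \<and>
     (\<exists>p. denjoy_wolff_point (inner_function f \<phi>) p \<and> \<not> singularity_of (inner_function f \<phi>) p) \<and>
     (\<forall>x\<in>frontier U. \<forall>y\<in>frontier U. f y = x \<longrightarrow>
        (\<exists>F. inverse_branch_on f (ball x r) F \<and> F x = y \<and> F ` (ball x r \<inter> U) \<subseteq> U)) \<and>
     (\<forall>x\<in>frontier U. \<forall>z\<in>ball x r. 1 < norm (deriv f z)) \<and>
     (\<forall>E. finite_target \<psi> E \<longrightarrow>
        (\<exists>K>1. \<forall>x\<in>E. \<forall>z\<in>ball x r. K \<le> norm (deriv f z)))"

section \<open>The space of backward orbits\<close>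

definition backward_orbits :: "(complex \<Rightarrow> complex) \<Rightarrow> complex set \<Rightarrow> (nat \<Rightarrow> complex) set" where
  "backward_orbits f U = {x. (\<forall>n. x n \<in> frontier U) \<and> (\<forall>n. f (x (Suc n)) = x n)}"

text \<open>Rokhlin's natural extension: the measure on the \<open>\<sigma>\<close>-algebra generated by the coordinates
  that gives each \<open>{x. x j \<in> A}\<close> the mass \<open>\<mu>(A)\<close>.  It exists and is unique because \<open>\<mu>\<close> is
  \<open>\<sigma>\<close>-finite and invariant.\<close>

definition mu_tilde ::
    "(complex \<Rightarrow> complex) \<Rightarrow> complex set \<Rightarrow> (complex \<Rightarrow> complex) \<Rightarrow> (nat \<Rightarrow> complex) measure" where
  "mu_tilde f U \<psi> =
     extend_measure (backward_orbits f U)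
       ((UNIV :: nat set) \<times> sets (restrict_space borel (frontier U)))
       (\<lambda>(j, A). {x \<in> backward_orbits f U. x j \<in> A})
       (\<lambda>(j, A). emeasure (mu U \<psi>) A)"

definition omega_tilde ::
    "(complex \<Rightarrow> complex) \<Rightarrow> complex set \<Rightarrow> (complex \<Rightarrow> complex) \<Rightarrow> (complex \<Rightarrow> complex)
      \<Rightarrow> (nat \<Rightarrow> complex) measure" where
  "omega_tilde f U \<phi> \<psi> =
     density (mu_tilde f U \<psi>) (\<lambda>x. RN_deriv (mu U \<psi>) (omega U \<phi>) (x 0))"

end

theory Submission
  imports Defs
begin

text \<open>Backward orbits visit bounded pieces of the boundary often enough.  By compactness, \<open>|f'|\<close> is
  bounded below by some \<open>\<kappa> > 1\<close> near the points of \<open>\<partial>U\<close> in a bounded set \<open>A\<close>, so every visit to \<open>A\<close>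
  contracts by \<open>1/\<kappa>\<close>, and it suffices that almost every backward orbit starting in \<open>A\<close> makes at
  least \<open>n\<^sup>1\<^sup>/\<^sup>3/2\<close> visits to \<open>A\<close> up to any large time \<open>n\<close>.

  Take \<open>A\<close> inside a set where the density of \<open>\<omega>\<^sub>U\<close> with respect to \<open>\<mu>\<close> is at least \<open>\<delta> > 0\<close>.  The image of \<open>\<omega>\<^sub>U\<close>
  under \<open>f\<^sup>k\<close> is harmonic measure seen from another point, so Harnack's inequality bounds it below by
  \<open>\<epsilon>\<^sub>k \<omega>\<^sub>U\<close> with \<open>\<epsilon>\<^sub>k = (1 - |w\<^sub>k|)/(1 + |w\<^sub>k|)\<close>, where \<open>w\<^sub>k\<close> is the orbit of \<open>0\<close> under the inner function.
  At a regular, doubly parabolic Denjoy-Wolff point \<open>1/(1 - w\<^sub>k)\<close> grows like the square root of \<open>k\<close>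
  inside a sector, so \<open>\<epsilon>\<^sub>0 + \<dots> + \<epsilon>\<^sub>n\<close> is at least of order \<open>\<surd>n\<close>.  Counting, with respect to \<open>\<omega>\<^sub>U\<close>, the times
  \<open>k \<le> n\<close> at which the orbit is in \<open>A\<close> but has fewer than \<open>m\<close> visits ahead shows that the set of
  points of \<open>A\<close> with fewer than \<open>m\<close> visits up to time \<open>n\<close> has \<open>\<mu>\<close>-measure at most of order \<open>m/\<surd>n\<close>.
  By invariance the same holds for backward orbits; the Borel-Cantelli lemma is applied
  with \<open>n = 8\<^sup>j\<close> and \<open>m = 2\<^sup>j\<close>.\<close>

section \<open>Contraction of inverse branches\<close>

text \<open>The invariant measure \<open>mu\<close> need not be finite, so Birkhoff averages give no
  frequency of visits to a bounded set. The rate comes from the finite measure \<open>omega\<close>,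
  which is not invariant but is controlled under \<open>f ^^ k\<close> by Harnack's inequality. A
  backward orbit read from \<open>x n\<close> is a forward orbit segment ending at
  \<open>x 0\<close>; this is how forward and backward counts are matched. The image of harmonic
  measure is found without boundary values of the inner function: a continuous function of the
  values on a circle of radius s < 1 is compared with the Poisson integral of its boundary values at
  the same points, whose mean over the circle does not depend on s. As \<phi> may be unbounded, this
  is done in a bounded univalent coordinate. At the parabolic point, W = 1/(1 - z) turns the inner
  function into W + b + c/W + O(|W|^-2). Vanishing hyperbolic steps exclude b \<noteq> 0; then W^2
  moves by about 2c with c > 0, which is the origin of the square root. The exponent 1/3 is one
  choice below 1/2: for m a smaller power of n than the square root, the bound m divided by the
  square root of n is summable along geometric scales.\<close>

lemma inverse_branch_deriv:
  assumes "f holomorphic_on UNIV" "inverse_branch_on f S G" "open S" "z \<in> S"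
  shows "deriv f (G z) * deriv G z = 1"
proof -
  have G: "G holomorphic_on S" "\<And>w. w \<in> S \<Longrightarrow> f (G w) = w"
    using assms by (auto simp: inverse_branch_on_def)
  have "((\<lambda>w. f (G w)) has_field_derivative deriv f (G z) * deriv G z) (at z)"
    using assms(3,4) by (intro DERIV_chain2[of f] holomorphic_derivI[OF assms(1)] holomorphic_derivI[OF G(1)]) auto
  moreover have "((\<lambda>w. f (G w)) has_field_derivative 1) (at z)"
    by (rule has_field_derivative_transform_within_open[OF DERIV_ident assms(3,4)]) (use G in auto)
  ultimately show ?thesis by (rule DERIV_unique)
qed

text \<open>Expansion is assumed only on \<open>ball y r\<close>, so no derivative bound for
  \<open>G\<close> is available before its image is known to lie there. The segment from
  \<open>x\<close> to \<open>z\<close> is followed up to its first exit: until then \<open>G\<close>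
  does not increase lengths, so the image moves at most \<open>norm (z - x) < r\<close>, too little
  to reach distance \<open>r\<close> from \<open>y\<close>.\<close>

lemma inverse_branch_image:
  assumes f: "f holomorphic_on UNIV" and G: "inverse_branch_on f (ball x r) G" "G x = y"
    and exp: "\<And>z. z \<in> ball y r \<Longrightarrow> 1 < norm (deriv f z)"
  shows "G ` ball x r \<subseteq> ball y r"
proof (rule image_subsetI)
  fix z assume z: "z \<in> ball x r"
  show "G z \<in> ball y r"
  proof (rule ccontr)
    assume "G z \<notin> ball y r"
    define \<gamma> where "\<gamma> t = x + of_real t * (z - x)" for t :: real
    define S where "S = {t\<in>{0..1}. r \<le> dist y (G (\<gamma> t))}"
    have rpos: "0 < r"
      using z le_less_trans[OF zero_le_dist, of x z r] by simp
    have \<gamma>: "\<gamma> t \<in> ball x r" if "t \<in> {0..1}" for t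
    proof -
      have "dist x (\<gamma> t) = t * dist x z"
        using that by (simp add: \<gamma>_def dist_norm norm_mult norm_minus_commute)
      also have "\<dots> \<le> dist x z" using that by (simp add: mult_left_le_one_le)
      finally show ?thesis using z by simp
    qed
    have holG: "G holomorphic_on ball x r" using G by (simp add: inverse_branch_on_def)
    have cont: "continuous_on {0..1} (\<lambda>t. G (\<gamma> t))"
    proof (rule continuous_on_compose2[of "ball x r" G])
      show "continuous_on (ball x r) G" using holG by (rule holomorphic_on_imp_continuous_on)
      show "continuous_on {0..1} \<gamma>" unfolding \<gamma>_def by (intro continuous_intros)
    qed (use \<gamma> in auto)
    have "S = {0..1} \<inter> (\<lambda>t. dist y (G (\<gamma> t))) -` {r..}" unfolding S_def by auto
    moreover have "closed ({0..1} \<inter> (\<lambda>t. dist y (G (\<gamma> t))) -` {r..})"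
      by (intro continuous_closed_preimage continuous_intros cont)
    ultimately have "closed S" by simp
    moreover have "1 \<in> S" using \<open>G z \<notin> ball y r\<close> by (simp add: S_def \<gamma>_def)
    moreover have bdd: "bdd_below S" by (rule bdd_belowI[of _ 0]) (simp add: S_def)
    ultimately have t0: "Inf S \<in> S" by (intro closed_contains_Inf) auto
    define t0 where "t0 = Inf S"
    have t0': "t0 \<in> {0..1}" "r \<le> dist y (G (\<gamma> t0))" using t0 by (auto simp: S_def t0_def)
    have "t0 \<noteq> 0" using t0' G(2) rpos by (auto simp: \<gamma>_def)
    then have "0 < t0" using t0' by auto
    have less: "dist y (G (\<gamma> t)) < r" if "0 \<le> t" "t < t0" for t
      using cInf_lower[OF _ bdd, of t] that t0' by (force simp: S_def t0_def)
    have der: "((\<lambda>t. G (\<gamma> t)) has_vector_derivative (z - x) * deriv G (\<gamma> t)) (at t)" 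
      if "t \<in> {0<..<t0}" for t
    proof (rule field_vector_diff_chain_at[where f = \<gamma> and g = G, unfolded o_def])
      show "(\<gamma> has_vector_derivative z - x) (at t)" unfolding \<gamma>_def
        by (auto intro!: derivative_eq_intros)
      show "(G has_field_derivative deriv G (\<gamma> t)) (at (\<gamma> t))"
        using that t0' by (intro holomorphic_derivI[OF holG]) (auto intro!: \<gamma> simp del: mem_ball)
    qed
    \<comment> \<open>Only a parameter strictly before the exit time enters the mean value
      inequality; there the image still lies inside \<open>ball y r\<close>.\<close>
    obtain t where t: "t \<in> {0<..<t0}"
       and le: "norm (G (\<gamma> t0) - G (\<gamma> 0)) \<le> norm ((t0 - 0) *\<^sub>R ((z - x) * deriv G (\<gamma> t)))"
      using mvt_general[OF \<open>0 < t0\<close>, of "\<lambda>t. G (\<gamma> t)" "\<lambda>t h. h *\<^sub>R ((z - x) * deriv G (\<gamma> t))"]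
        continuous_on_subset[OF cont, of "{0..t0}"] der t0'
      unfolding has_vector_derivative_def by fastforce
    have "\<gamma> t \<in> ball x r" using t t0' by (auto intro!: \<gamma> simp del: mem_ball)
    then have "deriv f (G (\<gamma> t)) * deriv G (\<gamma> t) = 1"
      by (intro inverse_branch_deriv[OF f G(1)]) auto
    moreover have "1 < norm (deriv f (G (\<gamma> t)))" using less[of t] t by (intro exp) auto
    ultimately have "norm (deriv G (\<gamma> t)) \<le> 1"
      by (smt (verit, best) mult_le_cancel_right2 norm_mult norm_one norm_ge_zero)
    then have "norm ((t0 - 0) *\<^sub>R ((z - x) * deriv G (\<gamma> t))) \<le> 1 * (norm (z - x) * 1)"
      unfolding norm_scaleR norm_mult using t0' by (intro mult_mono) auto
    with le have "dist y (G (\<gamma> t0)) \<le> norm (z - x)"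
      using G(2) by (simp add: \<gamma>_def dist_norm norm_minus_commute)
    with t0'(2) z show False by (simp add: dist_norm norm_minus_commute)
  qed
qed

text \<open>The radius \<open>s\<close> is separate from \<open>r\<close> because compactness will
  give a uniform bound \<open>\<kappa>\<close> only on smaller balls. Asking only
  \<open>0 < \<kappa>\<close> lets the case \<open>\<kappa> = 1\<close> cover the steps that do not
  end in \<open>A\<close>.\<close>

lemma inverse_branch_contraction:
  assumes f: "f holomorphic_on UNIV" and G: "inverse_branch_on f (ball x r) G" "G x = y"
    and exp: "\<And>z. z \<in> ball y r \<Longrightarrow> 1 < norm (deriv f z)"
    and \<kappa>: "0 < \<kappa>" "\<And>z. z \<in> ball y s \<Longrightarrow> \<kappa> \<le> norm (deriv f z)"
    and s: "s \<le> r" and z: "z \<in> ball x s"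
  shows "dist y (G z) \<le> dist x z / \<kappa>"
proof -
  have sub: "ball x s \<subseteq> ball x r" "ball y s \<subseteq> ball y r" using s by auto
  have G': "inverse_branch_on f (ball x s) G"
    using G(1) sub(1) holomorphic_on_subset by (fastforce simp: inverse_branch_on_def)
  have im: "G ` ball x s \<subseteq> ball y s"
    by (rule inverse_branch_image[OF f G' G(2)]) (use exp sub in blast)
  have holG: "G holomorphic_on ball x s" using G' by (simp add: inverse_branch_on_def)
  have "norm (deriv G w) \<le> 1 / \<kappa>" if w: "w \<in> ball x s" for w
  proof -
    have "norm (deriv f (G w)) * norm (deriv G w) = 1"
      using inverse_branch_deriv[OF f G' open_ball w] by (metis norm_mult norm_one)
    moreover have "\<kappa> \<le> norm (deriv f (G w))" using im w \<kappa> by blast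
    ultimately show ?thesis using \<kappa>(1)
      by (metis (no_types, opaque_lifting) mult.commute mult_right_mono norm_ge_zero pos_le_divide_eq)
  qed
  then have "norm (G z - G x) \<le> 1 / \<kappa> * norm (z - x)"
    using z holG by (intro field_differentiable_bound[of "ball x s" G "deriv G"])
      (auto intro!: holomorphic_derivI[OF holG, THEN DERIV_subset] intro: le_less_trans[OF zero_le_dist])
  then show ?thesis using G(2) by (simp add: dist_norm norm_minus_commute)
qed

text \<open>The branches are built before \<open>r0\<close>, \<open>\<kappa>\<close> and
  \<open>A\<close> are chosen, because a single sequence \<open>F\<close> has to serve every
  \<open>r0\<close>; hence the contraction estimate is quantified inside the
  \<open>obtains\<close>.\<close>

lemma inverse_branches_along_orbit:
  assumes f: "f holomorphic_on UNIV" and "0 < r"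
    and G: "\<And>n. inverse_branch_on f (ball (x n) r) (G n)" "\<And>n. G n (x n) = x (Suc n)"
    and exp: "\<And>n z. z \<in> ball (x n) r \<Longrightarrow> 1 < norm (deriv f z)"
  obtains F :: "nat \<Rightarrow> complex \<Rightarrow> complex" where
    "\<And>n. inverse_branch_on (f ^^ n) (ball (x 0) r) (F n)" "\<And>n. F n (x 0) = x n"
    "\<And>r0 \<kappa> A n z. \<lbrakk>r0 \<le> r; 1 \<le> \<kappa>; \<forall>k. x k \<in> A \<longrightarrow> (\<forall>z\<in>ball (x k) r0. \<kappa> \<le> norm (deriv f z));
        z \<in> ball (x 0) r0\<rbrakk> \<Longrightarrow> dist (x n) (F n z) \<le> dist (x 0) z / \<kappa> ^ card {k\<in>{1..n}. x k \<in> A}"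
proof
  define F where "F = rec_nat id (\<lambda>n H. G n \<circ> H)"
  have F [simp]: "F 0 = id" "F (Suc n) = G n \<circ> F n" for n by (simp_all add: F_def)
  show Fx: "F n (x 0) = x n" for n by (induction n) (simp_all add: G)
  have im: "F n ` ball (x 0) r \<subseteq> ball (x n) r" for n
  proof (induction n)
    case (Suc n)
    then show ?case using inverse_branch_image[OF f G(1) G(2) exp, of n] by fastforce
  qed simp
  show "inverse_branch_on (f ^^ n) (ball (x 0) r) (F n)" for n
  proof (induction n)
    case (Suc n)
    have "(G n \<circ> F n) holomorphic_on ball (x 0) r"
      by (rule holomorphic_on_compose_gen[OF _ _ im]) (use Suc G in \<open>auto simp: inverse_branch_on_def\<close>)
    moreover have "f (G n (F n z)) = F n z" if "z \<in> ball (x 0) r" for z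
      using G(1)[of n] im[of n] that unfolding inverse_branch_on_def by blast
    ultimately show ?case using Suc by (simp add: inverse_branch_on_def funpow_Suc_right o_def del: funpow.simps)
  qed (auto simp: inverse_branch_on_def)
  fix r0 \<kappa> :: real and A n z
  assume r0: "r0 \<le> r" and \<kappa>: "1 \<le> \<kappa>" and \<kappa>A: "\<forall>k. x k \<in> A \<longrightarrow> (\<forall>z\<in>ball (x k) r0. \<kappa> \<le> norm (deriv f z))"
    and z: "z \<in> ball (x 0) r0"
  show "dist (x n) (F n z) \<le> dist (x 0) z / \<kappa> ^ card {k\<in>{1..n}. x k \<in> A}"
  proof (induction n)
    case (Suc n)
    \<comment> \<open>The step from \<open>x n\<close> to \<open>x (Suc n)\<close> is governed by
      the derivative near \<open>x (Suc n)\<close>, so the count starts at 1 and leaves out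
      \<open>x 0\<close>.\<close>
    define N where "N n = card {k\<in>{1..n}. x k \<in> A}" for n
    have "{k\<in>{1..Suc n}. x k \<in> A} = (if x (Suc n) \<in> A then insert (Suc n) else id) {k\<in>{1..n}. x k \<in> A}"
      by (auto simp: le_Suc_eq)
    then have NS: "N (Suc n) = (if x (Suc n) \<in> A then Suc (N n) else N n)"
      unfolding N_def by (auto simp: card_insert_if)
    \<comment> \<open>As \<open>1 \<le> \<kappa>\<close>, the induction hypothesis itself keeps
      \<open>F n z\<close> within \<open>r0\<close> of \<open>x n\<close>, where the next
      contraction applies.\<close>
    have "dist (x 0) z / \<kappa> ^ N n \<le> dist (x 0) z / 1"
      using \<kappa> by (intro divide_left_mono) (auto simp: one_le_power)
    then have Fz: "F n z \<in> ball (x n) r0" using Suc z by (simp add: N_def)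
    define c where "c = (if x (Suc n) \<in> A then \<kappa> else 1)"
    have "dist (x (Suc n)) (G n (F n z)) \<le> dist (x n) (F n z) / c"
    proof (rule inverse_branch_contraction[OF f G exp _ _ r0 Fz])
      show "0 < c" using \<kappa> by (simp add: c_def)
      show "c \<le> norm (deriv f w)" if "w \<in> ball (x (Suc n)) r0" for w
        using \<kappa>A[rule_format, of "Suc n" w] exp[of w "Suc n"] that r0 by (auto simp: c_def)
    qed
    also have "\<dots> \<le> (dist (x 0) z / \<kappa> ^ N n) / c"
      using Suc \<kappa> by (intro divide_right_mono) (auto simp: N_def c_def)
    also have "\<dots> = dist (x 0) z / \<kappa> ^ N (Suc n)" by (simp add: NS c_def)
    finally show ?case by (simp add: N_def)
  qed simp
qed

section \<open>Invariance of the boundary\<close>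

text \<open>Every iterate of order at least 1 factors through \<open>f\<close>, so normality near
  \<open>f x\<close> pulls back along \<open>f\<close>. Only the identity does not factor; a
  sequence containing it infinitely often has a constant subsequence. A ball replaces the whole
  preimage of \<open>V\<close> because a connected neighbourhood is required.\<close>

lemma fatou_set_preimage:
  assumes f: "continuous_on UNIV f" and fx: "f x \<in> fatou_set f"
  shows "x \<in> fatou_set f"
proof -
  obtain V where V: "open V" "f x \<in> V" "normal_family_on V (range (\<lambda>n. f ^^ n))"
    using fx by (auto simp: fatou_set_def)
  have "open (f -` V)" using f V(1) by (simp add: continuous_on_open_vimage)
  then obtain e where e: "0 < e" "ball x e \<subseteq> f -` V"
    using V(2) by (meson openE vimageI)
  have "normal_family_on (ball x e) (range (\<lambda>n. f ^^ n))"
    unfolding normal_family_on_def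
  proof (intro allI impI)
    fix s :: "nat \<Rightarrow> complex \<Rightarrow> complex" assume "range s \<subseteq> range (\<lambda>n. f ^^ n)"
    then have "\<forall>i. \<exists>m. s i = f ^^ m" by blast
    then obtain m where m: "\<And>i. s i = f ^^ m i" by metis
    let ?goal = "\<lambda>k. (\<exists>g. \<forall>K. compact K \<and> K \<subseteq> ball x e \<longrightarrow> uniform_limit K (s \<circ> k) g sequentially) \<or>
           locally_uniformly_to_infinity (ball x e) (s \<circ> k)"
    show "\<exists>k. strict_mono k \<and> ?goal k"
    proof (cases "infinite {i. m i = 0}")
      case True
      define k where "k = enumerate {i. m i = 0}"
      have "m (k i) = 0" for i using enumerate_in_set[OF True] by (simp add: k_def)
      then have "s \<circ> k = (\<lambda>_. id)" by (auto simp: m fun_eq_iff)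
      then have "?goal k" by (auto simp: uniform_limit_iff intro!: exI[of _ id])
      moreover have "strict_mono k" using True by (simp add: k_def strict_mono_enumerate)
      ultimately show ?thesis by blast
    next
      case False
      then obtain N where N: "\<And>i. N \<le> i \<Longrightarrow> m i \<noteq> 0"
        by (metis (mono_tags, lifting) infinite_nat_iff_unbounded_le mem_Collect_eq)
      define s' where "s' i = f ^^ (m i - 1)" for i
      have s: "s i = s' i \<circ> f" if "N \<le> i" for i
        using N[OF that] by (simp add: m s'_def funpow_Suc_right[symmetric] del: funpow.simps)
      have "range s' \<subseteq> range (\<lambda>n. f ^^ n)" by (auto simp: s'_def)
      then obtain k where k: "strict_mono k" and
        alt: "(\<exists>g. \<forall>K. compact K \<and> K \<subseteq> V \<longrightarrow> uniform_limit K (s' \<circ> k) g sequentially) \<or>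
           locally_uniformly_to_infinity V (s' \<circ> k)"
        using V(3) unfolding normal_family_on_def by blast
      have ev: "\<forall>\<^sub>F n in sequentially. s (k n) = s' (k n) \<circ> f"
      proof (rule eventually_sequentiallyI)
        show "s (k n) = s' (k n) \<circ> f" if "N \<le> n" for n
          using s seq_suble[OF k, of n] that by auto
      qed
      have cpt: "compact (f ` K) \<and> f ` K \<subseteq> V" if "compact K \<and> K \<subseteq> ball x e" for K
        using that e(2) compact_continuous_image[OF continuous_on_subset[OF f]] by blast
      from alt have "?goal k"
      proof
        assume "\<exists>g. \<forall>K. compact K \<and> K \<subseteq> V \<longrightarrow> uniform_limit K (s' \<circ> k) g sequentially"
        then obtain g where g: "\<And>K. compact K \<and> K \<subseteq> V \<Longrightarrow> uniform_limit K (s' \<circ> k) g sequentially"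
          by blast
        have "uniform_limit K (s \<circ> k) (g \<circ> f) sequentially" if "compact K \<and> K \<subseteq> ball x e" for K
          using g[OF cpt[OF that]] unfolding uniform_limit_iff
        proof (intro allI impI)
          fix d :: real assume "0 < d" and "\<forall>e>0. \<forall>\<^sub>F n in sequentially. \<forall>x\<in>f ` K. dist ((s' \<circ> k) n x) (g x) < e"
          then have "\<forall>\<^sub>F n in sequentially. \<forall>x\<in>f ` K. dist ((s' \<circ> k) n x) (g x) < d" by blast
          with ev show "\<forall>\<^sub>F n in sequentially. \<forall>x\<in>K. dist ((s \<circ> k) n x) ((g \<circ> f) x) < d"
            by eventually_elim auto
        qed
        then show ?thesis by blast
      next
        assume *: "locally_uniformly_to_infinity V (s' \<circ> k)"
        have "locally_uniformly_to_infinity (ball x e) (s \<circ> k)"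
          unfolding locally_uniformly_to_infinity_def
        proof (intro allI impI)
          fix K B assume "compact K \<and> K \<subseteq> ball x e"
          with * cpt have "\<forall>\<^sub>F n in sequentially. \<forall>z\<in>f ` K. B < norm ((s' \<circ> k) n z)"
            unfolding locally_uniformly_to_infinity_def by blast
          with ev show "\<forall>\<^sub>F n in sequentially. \<forall>z\<in>K. B < norm ((s \<circ> k) n z)"
            by eventually_elim auto
        qed
        then show ?thesis by blast
      qed
      then show ?thesis using k by blast
    qed
  qed
  then show ?thesis using e(1) by (auto simp: fatou_set_def intro!: exI[of _ "ball x e"])
qed

lemma open_fatou_set: "open (fatou_set f)"
  unfolding fatou_set_def by (subst open_subopen) blast

text \<open>A boundary point mapped into \<open>U\<close> would lie in the Fatou set; its open
  component would meet \<open>U\<close> and hence be \<open>U\<close>, although an open set contains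
  none of its boundary points.\<close>

lemma fatou_component_frontier_image:
  assumes f: "continuous_on UNIV f" and U: "U \<in> components (fatou_set f)" "f ` U \<subseteq> U"
  shows "f ` frontier U \<subseteq> frontier U"
proof (rule image_subsetI)
  fix x assume x: "x \<in> frontier U"
  have opU: "open U" using U(1) open_fatou_set open_components by blast
  have "f x \<in> f ` closure U" using x by (auto simp: frontier_def)
  also have "\<dots> \<subseteq> closure (f ` U)" by (intro image_closure_subset closure_subset closed_closure continuous_on_subset[OF f]) auto
  also have "\<dots> \<subseteq> closure U" using U(2) by (rule closure_mono)
  finally have cl: "f x \<in> closure U" .
  have "f x \<notin> U"
  proof
    assume "f x \<in> U"
    then have "x \<in> fatou_set f"
      using U(1) in_components_subset fatou_set_preimage[OF f] by blast
    then obtain C where C: "C \<in> components (fatou_set f)" "x \<in> C"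
      by (metis Union_components UnionE)
    have "open C" using C(1) open_fatou_set open_components by blast
    then have "C \<inter> U \<noteq> {}" using C(2) x open_Int_closure_eq_empty[of C U] by (auto simp: frontier_def)
    then have "C = U" using C(1) U(1) components_eq by blast
    then show False using C(2) x opU by (simp add: frontier_def interior_open)
  qed
  then show "f x \<in> frontier U" using cl opU by (simp add: frontier_def interior_open)
qed

section \<open>Poisson integrals\<close>

text \<open>Its image under \<open>cis\<close> is \<open>circle_measure\<close>. Integrating over
  angles keeps the whole real line with its Borel sets as the underlying space.\<close>

definition angle :: "real measure" where
  "angle = uniform_measure lborel {0..<2 * pi}"

lemma sets_angle [measurable_cong, simp]: "sets angle = sets borel"
  and space_angle [simp]: "space angle = UNIV"
  by (simp_all add: angle_def)

lemma emeasure_angle_UNIV: "emeasure angle UNIV = 1"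
  unfolding angle_def by (subst emeasure_uniform_measure) (auto simp: ennreal_divide_self)

interpretation angle: finite_measure angle
  by standard (simp add: emeasure_angle_UNIV)

interpretation angle_pair: pair_sigma_finite angle angle
  by standard

lemma measure_angle_UNIV [simp]: "measure angle UNIV = 1"
  by (simp add: measure_def emeasure_angle_UNIV)

lemma angle_eq_density: "angle = density lborel (\<lambda>\<theta>. ennreal (indicator {0..<2 * pi} \<theta> / (2 * pi)))"
  unfolding angle_def uniform_measure_def
  by (intro density_cong) (auto simp: indicator_def divide_ennreal ennreal_1[symmetric] simp del: ennreal_1)

lemma integral_angle:
  fixes h :: "real \<Rightarrow> complex"
  assumes h: "continuous_on UNIV h"
  shows "(\<integral>\<theta>. h \<theta> \<partial>angle) = integral {0..2 * pi} h / (2 * pi)"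
proof -
  have h_borel [measurable]: "h \<in> borel_measurable borel"
    using h by (rule borel_measurable_continuous_onI)
  have "(\<integral>\<theta>. h \<theta> \<partial>angle) = (\<integral>\<theta>. (indicator {0..<2 * pi} \<theta> / (2 * pi)) *\<^sub>R h \<theta> \<partial>lborel)"
    unfolding angle_eq_density by (intro integral_density) auto
  also have "\<dots> = (\<integral>\<theta>. (indicator {0..2 * pi} \<theta> *\<^sub>R h \<theta>) / (2 * pi) \<partial>lborel)"
    by (intro integral_cong_AE, measurable)
       (use AE_lborel_singleton[of "2 * pi"] in \<open>eventually_elim, auto simp: indicator_def scaleR_conv_of_real\<close>)
  also have "\<dots> = (LINT \<theta>:{0..2*pi}|lborel. h \<theta>) / (2 * pi)"
    unfolding set_lebesgue_integral_def by simp
  also have "(LINT \<theta>:{0..2*pi}|lborel. h \<theta>) = integral {0..2 * pi} h"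
    by (intro set_borel_integral_eq_integral borel_integrable_atLeastAtMost' continuous_on_subset[OF h]) auto
  finally show ?thesis .
qed

lemma integrable_angle_bounded:
  fixes h :: "real \<Rightarrow> 'a :: {banach, second_countable_topology}"
  assumes "h \<in> borel_measurable borel" "\<And>\<theta>. norm (h \<theta>) \<le> B"
  shows "integrable angle h"
  by (rule angle.integrable_const_bound[of _ B]) (use assms in auto)

lemma Cauchy_angle:
  assumes k: "continuous_on (cball 0 1) k" "k holomorphic_on ball 0 1" and w: "norm w < 1"
  shows "(\<integral>\<theta>. k (cis \<theta>) * cis \<theta> / (cis \<theta> - w) \<partial>angle) = k w"
proof -
  have ne: "cis \<theta> \<noteq> w" for \<theta> using w norm_cis[of \<theta>] by auto
  have "((\<lambda>u. k u / (u - w)) has_contour_integral (2 * of_real pi * \<i> * k w)) (circlepath 0 1)"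
    using w by (intro Cauchy_integral_circlepath k) auto
  then have "((\<lambda>t. k (cis t) / (cis t - w) * \<i> * cis t) has_integral (2 * of_real pi * \<i> * k w)) {0..2 * pi}"
    unfolding circlepath_def by (subst (asm) has_contour_integral_part_circlepath_iff) auto
  from has_integral_mult_right[OF this, of "-\<i>"]
  have "((\<lambda>t. k (cis t) * cis t / (cis t - w)) has_integral (2 * of_real pi * k w)) {0..2 * pi}"
    by (simp add: algebra_simps)
  then have "integral {0..2 * pi} (\<lambda>t. k (cis t) * cis t / (cis t - w)) = 2 * of_real pi * k w"
    by (rule integral_unique)
  moreover have "continuous_on UNIV (\<lambda>t. k (cis t) * cis t / (cis t - w))"
    using ne by (intro continuous_intros continuous_on_compose2[OF k(1)]) auto
  ultimately show ?thesis by (simp add: integral_angle)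
qed

lemma mean_value_angle:
  assumes F: "F holomorphic_on ball 0 1" and s: "0 \<le> s" "s < 1"
  shows "(\<integral>\<theta>. F (of_real s * cis \<theta>) \<partial>angle) = F 0"
proof -
  have im: "of_real s * z \<in> ball 0 1" if "z \<in> cball 0 1" for z :: complex
    using s that mult_left_le[of "norm z" s] by (simp add: norm_mult)
  have hol: "(\<lambda>z. F (of_real s * z)) holomorphic_on ball 0 1"
    using im by (intro holomorphic_on_compose_gen[OF _ F, unfolded o_def] holomorphic_intros) auto
  have cont: "continuous_on (cball 0 1) (\<lambda>z. F (of_real s * z))"
    using im by (intro continuous_on_compose2[OF holomorphic_on_imp_continuous_on[OF F]] continuous_intros) auto
  from Cauchy_angle[OF cont hol, of 0] show ?thesis by simp
qed

definition poisson :: "complex \<Rightarrow> complex \<Rightarrow> real" where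
  "poisson w \<xi> = (1 - (norm w)\<^sup>2) / (norm (\<xi> - w))\<^sup>2"

lemma poisson_nonneg: "norm w < 1 \<Longrightarrow> 0 \<le> poisson w \<xi>"
  by (simp add: poisson_def power_le_one)

text \<open>The right-hand side is the real part of a function holomorphic in \<open>w\<close>,
  which is the harmonicity behind \<open>poisson_mean\<close>.\<close>

lemma poisson_eq_Re:
  assumes "norm \<xi> = 1" "norm w < 1"
  shows "poisson w \<xi> = Re ((\<xi> + w) / (\<xi> - w))"
proof -
  have "(Re \<xi>)\<^sup>2 + (Im \<xi>)\<^sup>2 = 1" using assms(1) by (simp add: cmod_def)
  then have "(Re (\<xi> + w) * Re (\<xi> - w) + Im (\<xi> + w) * Im (\<xi> - w)) = 1 - (norm w)\<^sup>2"
    by (simp add: cmod_power2) (simp add: power2_eq_square algebra_simps)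
  then show ?thesis by (simp add: poisson_def Re_divide cmod_power2[symmetric] del: plus_complex.sel minus_complex.sel)
qed

text \<open>On the unit circle, the squared distance of \<open>\<xi>\<close> and \<open>w\<close>
  times \<open>\<xi>\<close> factors as \<open>(\<xi> - w) * (1 - cnj w * \<xi>)\<close>. This
  exhibits the kernel as a Cauchy kernel times a factor holomorphic in \<open>\<xi>\<close>.\<close>

lemma poisson_eq_Cauchy:
  assumes "norm \<xi> = 1" "norm w < 1"
  shows "of_real (poisson w \<xi>) = (1 - (norm w)\<^sup>2) / (1 - cnj w * \<xi>) * \<xi> / (\<xi> - w)"
proof -
  have "\<xi> * cnj \<xi> = 1" using assms by (simp add: complex_norm_square[symmetric])
  then have "of_real ((norm (\<xi> - w))\<^sup>2) * \<xi> = (\<xi> - w) * (1 - cnj w * \<xi>)"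
    unfolding complex_norm_square by (simp add: algebra_simps)
  moreover have "\<xi> \<noteq> 0" "\<xi> \<noteq> w" "1 - cnj w * \<xi> \<noteq> 0"
  proof -
    show "1 - cnj w * \<xi> \<noteq> 0"
    proof
      assume "1 - cnj w * \<xi> = 0"
      then have "norm (cnj w * \<xi>) = 1" by (metis eq_iff_diff_eq_0 norm_one)
      then show False using assms by (simp add: norm_mult)
    qed
  qed (use assms in auto)
  ultimately show ?thesis unfolding poisson_def
    by (simp add: divide_simps) (simp add: algebra_simps)
qed

lemma Harnack_lower:
  assumes "norm \<xi> = 1" "norm w < 1"
  shows "(1 - norm w) / (1 + norm w) \<le> poisson w \<xi>"
proof -
  have "norm (\<xi> - w) \<le> 1 + norm w" using assms norm_triangle_ineq4[of \<xi> w] by simp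
  moreover have "0 < norm (\<xi> - w)" using assms by auto
  ultimately have "(1 - (norm w)\<^sup>2) / (1 + norm w)\<^sup>2 \<le> poisson w \<xi>"
    unfolding poisson_def using assms by (intro divide_left_mono power_mono mult_pos_pos) (auto simp: power_le_one abs_square_le_1 intro!: add_pos_nonneg)
  moreover have "1 + norm w \<noteq> 0" by (smt (verit) norm_ge_zero)
  then have "((1 - norm w) * (1 + norm w)) / ((1 + norm w) * (1 + norm w)) = (1 - norm w) / (1 + norm w)"
    by simp
  then have "(1 - (norm w)\<^sup>2) / (1 + norm w)\<^sup>2 = (1 - norm w) / (1 + norm w)"
    by (simp add: algebra_simps power2_eq_square)
  ultimately show ?thesis by simp
qed

lemma Harnack_upper:
  assumes "norm \<xi> = 1" "norm w < 1"
  shows "poisson w \<xi> \<le> (1 + norm w) / (1 - norm w)"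
proof -
  have "1 - norm w \<le> norm (\<xi> - w)" using assms norm_triangle_ineq2[of \<xi> w] by simp
  then have "poisson w \<xi> \<le> (1 - (norm w)\<^sup>2) / (1 - norm w)\<^sup>2"
    unfolding poisson_def using assms
    by (intro divide_left_mono power_mono mult_pos_pos) (auto simp: power_le_one abs_square_le_1)
  also have "\<dots> = ((1 + norm w) * (1 - norm w)) / ((1 - norm w) * (1 - norm w))"
    by (simp add: field_simps power2_eq_square)
  also have "\<dots> = (1 + norm w) / (1 - norm w)" using assms by simp
  finally show ?thesis .
qed

lemma poisson_measurable [measurable]:
  "poisson w \<in> borel_measurable borel"
  unfolding poisson_def by measurable

lemma cis_measurable [measurable]: "cis \<in> borel_measurable borel"
  by (intro borel_measurable_continuous_onI continuous_intros)

lemma integrable_poisson: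
  fixes c :: "real \<Rightarrow> 'a :: {banach, second_countable_topology}"
  assumes [measurable]: "c \<in> borel_measurable borel" and c: "\<And>\<theta>. norm (c \<theta>) \<le> B" and w: "norm w < 1"
  shows "integrable angle (\<lambda>\<theta>. poisson w (cis \<theta>) *\<^sub>R c \<theta>)"
proof (rule integrable_angle_bounded)
  show "norm (poisson w (cis \<theta>) *\<^sub>R c \<theta>) \<le> ((1 + norm w) / (1 - norm w)) * B" for \<theta>
    unfolding norm_scaleR using Harnack_upper[of "cis \<theta>" w] poisson_nonneg[OF w, of "cis \<theta>"] w c
    by (intro mult_mono) auto
qed simp

text \<open>Cauchy's formula is applied to \<open>F\<close> times the holomorphic factor of
  \<open>poisson_eq_Cauchy\<close>, which takes the value 1 at \<open>w\<close>.\<close>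

lemma Poisson_formula:
  assumes F: "continuous_on (cball 0 1) F" "F holomorphic_on ball 0 1" and w: "norm w < 1"
  shows "(\<integral>\<theta>. poisson w (cis \<theta>) *\<^sub>R F (cis \<theta>) \<partial>angle) = F w"
proof -
  define k where "k \<xi> = F \<xi> * ((1 - (norm w)\<^sup>2) / (1 - cnj w * \<xi>))" for \<xi>
  have ne: "1 - cnj w * \<xi> \<noteq> 0" if "\<xi> \<in> cball 0 1" for \<xi>
  proof
    assume "1 - cnj w * \<xi> = 0"
    then have "norm (cnj w * \<xi>) = 1" by (metis eq_iff_diff_eq_0 norm_one)
    moreover have "norm w * norm \<xi> \<le> norm w * 1" using that by (intro mult_left_mono) auto
    ultimately show False using w by (simp add: norm_mult)
  qed
  have "(\<integral>\<theta>. k (cis \<theta>) * cis \<theta> / (cis \<theta> - w) \<partial>angle) = k w"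
    unfolding k_def using ne w
    by (intro Cauchy_angle continuous_intros holomorphic_intros F) auto
  moreover have "k w = F w"
  proof -
    have "1 - cnj w * w = 1 - (norm w)\<^sup>2" using complex_norm_square[of w] by (simp add: mult.commute)
    then show ?thesis using ne[of w] w by (simp add: k_def)
  qed
  moreover have "poisson w (cis \<theta>) *\<^sub>R F (cis \<theta>) = k (cis \<theta>) * cis \<theta> / (cis \<theta> - w)" for \<theta>
    using w by (simp add: scaleR_conv_of_real poisson_eq_Cauchy k_def)
  ultimately show ?thesis by simp
qed

lemma integral_poisson: "norm w < 1 \<Longrightarrow> (\<integral>\<theta>. poisson w (cis \<theta>) \<partial>angle) = 1"
proof -
  assume w: "norm w < 1"
  have "complex_of_real (\<integral>\<theta>. poisson w (cis \<theta>) \<partial>angle) = 1"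
    using Poisson_formula[of "\<lambda>_. 1", OF _ _ w] by (simp add: scaleR_conv_of_real)
  then show ?thesis by simp
qed

lemma continuous_on_circle:
  assumes g: "g holomorphic_on ball 0 1" and s: "0 \<le> s" "s < 1"
  shows "continuous_on UNIV (\<lambda>\<theta>. g (of_real s * cis \<theta>))"
  using s by (intro continuous_on_compose2[OF holomorphic_on_imp_continuous_on[OF g]] continuous_intros)
    (auto simp: norm_mult)

lemma integrable_circle:
  assumes F: "F holomorphic_on ball 0 1" and s: "0 \<le> s" "s < 1"
  shows "integrable angle (\<lambda>\<theta>. F (of_real s * cis \<theta>))"
proof -
  have "compact ((\<lambda>z. F (of_real s * z)) ` sphere 0 1)"
    using s by (intro compact_continuous_image continuous_on_compose2[OF holomorphic_on_imp_continuous_on[OF F]] continuous_intros)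
      (auto simp: norm_mult)
  then obtain B where "\<And>z. z \<in> sphere 0 1 \<Longrightarrow> norm (F (of_real s * z)) \<le> B"
    using compact_imp_bounded[THEN bounded_iff[THEN iffD1]] by (metis imageI)
  then show ?thesis
    by (intro integrable_angle_bounded[of _ B] borel_measurable_continuous_onI continuous_on_circle[OF F s]) auto
qed

lemma poisson_mean:
  assumes g: "g holomorphic_on ball 0 1" "g ` ball 0 1 \<subseteq> ball 0 1"
    and \<xi>: "norm \<xi> = 1" and s: "0 \<le> s" "s < 1"
  shows "(\<integral>\<theta>. poisson (g (of_real s * cis \<theta>)) \<xi> \<partial>angle) = poisson (g 0) \<xi>"
proof -
  have g1: "norm (g z) < 1" if "norm z < 1" for z using g(2) that by (auto simp: image_subset_iff)
  have im: "norm (of_real s * cis \<theta>) < 1" for \<theta> using s by (simp add: norm_mult)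
  have ne: "\<xi> - g z \<noteq> 0" if "norm z < 1" for z using g1[OF that] \<xi> by auto
  define k where "k z = (\<xi> + g z) / (\<xi> - g z)" for z
  have hol: "k holomorphic_on ball 0 1"
    unfolding k_def using ne by (intro holomorphic_intros g) auto
  have int: "integrable angle (\<lambda>\<theta>. k (of_real s * cis \<theta>))" by (rule integrable_circle[OF hol s])
  have "(\<integral>\<theta>. poisson (g (of_real s * cis \<theta>)) \<xi> \<partial>angle) = (\<integral>\<theta>. Re (k (of_real s * cis \<theta>)) \<partial>angle)"
    using poisson_eq_Re[OF \<xi> g1[OF im]] by (simp add: k_def)
  also have "\<dots> = Re (\<integral>\<theta>. k (of_real s * cis \<theta>) \<partial>angle)"
    using int by (rule integral_Re)
  also have "\<dots> = Re (k 0)" using mean_value_angle[OF hol s] by simp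
  also have "\<dots> = poisson (g 0) \<xi>" using poisson_eq_Re[OF \<xi> g1[of 0]] by (simp add: k_def)
  finally show ?thesis .
qed

lemma bounded_on_circle:
  assumes g: "g holomorphic_on ball 0 1" "g ` ball 0 1 \<subseteq> ball 0 1" and s: "0 \<le> s" "s < 1"
  obtains R where "R < 1" "\<And>\<theta>. norm (g (of_real s * cis \<theta>)) \<le> R"
proof -
  have c: "continuous_on (sphere 0 1) (\<lambda>z. norm (g (of_real s * z)))"
    using s by (intro continuous_on_compose2[OF holomorphic_on_imp_continuous_on[OF g(1)]] continuous_intros)
      (auto simp: norm_mult)
  have "sphere 0 1 \<noteq> ({} :: complex set)" by (metis norm_one mem_sphere_0 empty_iff)
  from continuous_attains_sup[OF compact_sphere this c] obtain z0 where z0: "z0 \<in> sphere 0 1"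
    "\<And>z. z \<in> sphere 0 1 \<Longrightarrow> norm (g (of_real s * z)) \<le> norm (g (of_real s * z0))" by blast
  moreover have "norm (of_real s * z0) < 1" using s z0(1) by (simp add: norm_mult)
  then have "norm (g (of_real s * z0)) < 1" using g(2) by (auto simp: image_subset_iff)
  ultimately show ?thesis using that by auto
qed

text \<open>Loewner's lemma in integrated form: for fixed \<open>\<xi>\<close> the Poisson kernel is harmonic in its first
  argument, so its composition with \<open>g\<close> has the mean value property.\<close>

lemma Poisson_integral_mean:
  fixes c :: "real \<Rightarrow> real"
  assumes g: "g holomorphic_on ball 0 1" "g ` ball 0 1 \<subseteq> ball 0 1" and s: "0 \<le> s" "s < 1"
    and c [measurable]: "c \<in> borel_measurable borel" and cB: "\<And>\<theta>. norm (c \<theta>) \<le> B"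
  shows "integrable angle (\<lambda>\<theta>. \<integral>\<eta>. poisson (g (of_real s * cis \<theta>)) (cis \<eta>) * c \<eta> \<partial>angle)" (is ?int)
    and "(\<integral>\<theta>. (\<integral>\<eta>. poisson (g (of_real s * cis \<theta>)) (cis \<eta>) * c \<eta> \<partial>angle) \<partial>angle)
         = (\<integral>\<eta>. poisson (g 0) (cis \<eta>) * c \<eta> \<partial>angle)" (is ?eq)
proof -
  let ?\<sigma> = "\<lambda>\<theta>. g (of_real s * cis \<theta>)"
  obtain R where R: "R < 1" "\<And>\<theta>. norm (?\<sigma> \<theta>) \<le> R" using bounded_on_circle[OF g s] by metis
  have R0: "0 \<le> R" using R(2)[of 0] norm_ge_zero order_trans by blast
  have \<sigma> [measurable]: "?\<sigma> \<in> borel_measurable borel"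
    by (intro borel_measurable_continuous_onI continuous_on_circle[OF g(1) s])
  have m: "(\<lambda>(\<theta>, \<eta>). poisson (?\<sigma> \<theta>) (cis \<eta>) * c \<eta>) \<in> borel_measurable (angle \<Otimes>\<^sub>M angle)"
    unfolding poisson_def by measurable
  have "emeasure (angle \<Otimes>\<^sub>M angle) (UNIV \<times> UNIV) = 1"
    by (subst angle.emeasure_pair_measure_Times) (auto simp: emeasure_angle_UNIV)
  then interpret P: finite_measure "angle \<Otimes>\<^sub>M angle"
    by (intro finite_measureI) (simp add: space_pair_measure)
  have bd: "norm (poisson (?\<sigma> \<theta>) (cis \<eta>) * c \<eta>) \<le> ((1 + R) / (1 - R)) * B" for \<theta> \<eta>
  proof -
    have l: "norm (?\<sigma> \<theta>) < 1" using R(1) R(2)[of \<theta>] by linarith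
    have "poisson (?\<sigma> \<theta>) (cis \<eta>) \<le> (1 + norm (?\<sigma> \<theta>)) / (1 - norm (?\<sigma> \<theta>))"
      using l by (intro Harnack_upper) auto
    also have "\<dots> \<le> (1 + R) / (1 - R)" using R(1) R(2)[of \<theta>] l R0 by (intro frac_le) auto
    finally show ?thesis unfolding norm_mult using poisson_nonneg[OF l, of "cis \<eta>"] cB R0 R(1)
      by (intro mult_mono) auto
  qed
  have int: "integrable (angle \<Otimes>\<^sub>M angle) (\<lambda>(\<theta>, \<eta>). poisson (?\<sigma> \<theta>) (cis \<eta>) * c \<eta>)"
    using bd m by (intro P.integrable_const_bound[of _ "((1 + R) / (1 - R)) * B"]) (auto simp del: real_norm_def)
  show ?int using angle_pair.integrable_fst'[OF int] by simp
  have "(\<integral>\<theta>. (\<integral>\<eta>. poisson (?\<sigma> \<theta>) (cis \<eta>) * c \<eta> \<partial>angle) \<partial>angle)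
     = (\<integral>\<eta>. (\<integral>\<theta>. poisson (?\<sigma> \<theta>) (cis \<eta>) * c \<eta> \<partial>angle) \<partial>angle)"
    using angle_pair.Fubini_integral[OF int] by simp
  also have "\<dots> = (\<integral>\<eta>. poisson (g 0) (cis \<eta>) * c \<eta> \<partial>angle)"
    using poisson_mean[OF g _ s] by simp
  finally show ?eq .
qed

section \<open>Composition with inner functions\<close>

text \<open>A sequence of radii instead of a continuous limit, so that dominated convergence and
  Fatou's lemma apply. The shift by 2 keeps every radius positive.\<close>

definition rad :: "nat \<Rightarrow> real" where
  "rad n = 1 - 1 / (real n + 2)"

lemma rad: "0 \<le> rad n" "rad n < 1"
  by (auto simp: rad_def field_simps)

lemma rad_tendsto: "rad \<longlonglongrightarrow> 1"
proof -
  have "(\<lambda>n. 1 - 1 / real (n + 2)) \<longlonglongrightarrow> 1 - 0"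
    by (intro tendsto_intros LIMSEQ_ignore_initial_segment[OF lim_1_over_n])
  then show ?thesis by (simp add: rad_def[abs_def] add.commute)
qed

lemma rad_circle: "norm z \<le> 1 \<Longrightarrow> norm (of_real (rad n) * z :: complex) < 1"
  using rad[of n] mult_left_le[of "norm z" "rad n"] by (simp add: norm_mult)

lemma rad_tendsto_left: "filterlim rad (at_left 1) sequentially"
  using rad_tendsto by (auto simp: filterlim_at intro!: always_eventually rad) (metis rad(2) less_irrefl)

text \<open>The boundary function \<open>\<beta>s\<close> is total, measurable and bounded
  everywhere, with the limit relation only almost everywhere; integrals over all angles then need no
  restriction to the set of convergence.\<close>

locale radial_limit =
  fixes \<beta> :: "complex \<Rightarrow> complex" and \<beta>s :: "real \<Rightarrow> complex" and B :: real
  assumes hol: "\<beta> holomorphic_on ball 0 1"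
    and bound: "\<And>z. norm z < 1 \<Longrightarrow> norm (\<beta> z) \<le> B"
    and meas [measurable]: "\<beta>s \<in> borel_measurable borel"
    and bounds: "\<And>\<theta>. norm (\<beta>s \<theta>) \<le> B"
    and lim: "AE \<theta> in angle. (\<lambda>n. \<beta> (of_real (rad n) * cis \<theta>)) \<longlonglongrightarrow> \<beta>s \<theta>"
begin

lemma meas_rad [measurable]: "(\<lambda>\<theta>. \<beta> (of_real (rad n) * cis \<theta>)) \<in> borel_measurable borel"
  by (intro borel_measurable_continuous_onI continuous_on_circle hol rad)

lemma Poisson_radial_limit:
  assumes w: "norm w < 1"
  shows "(\<integral>\<theta>. poisson w (cis \<theta>) *\<^sub>R \<beta>s \<theta> \<partial>angle) = \<beta> w"
proof -
  let ?F = "\<lambda>n \<theta>. poisson w (cis \<theta>) *\<^sub>R \<beta> (of_real (rad n) * cis \<theta>)"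
  have 1: "(\<integral>\<theta>. ?F n \<theta> \<partial>angle) = \<beta> (of_real (rad n) * w)" for n
  proof (rule Poisson_formula[of "\<lambda>z. \<beta> (of_real (rad n) * z)", OF _ _ w])
    show "continuous_on (cball 0 1) (\<lambda>z. \<beta> (of_real (rad n) * z))"
      by (rule continuous_on_compose2[OF holomorphic_on_imp_continuous_on[OF hol]])
        (auto intro!: continuous_intros rad_circle)
    have "(\<beta> \<circ> (\<lambda>z. of_real (rad n) * z)) holomorphic_on ball 0 1"
    proof (rule holomorphic_on_compose_gen[OF _ hol])
      show "(*) (of_real (rad n)) ` ball 0 1 \<subseteq> ball (0::complex) 1"
        using rad_circle[of _ n] by force
    qed (intro holomorphic_intros)
    then show "(\<lambda>z. \<beta> (of_real (rad n) * z)) holomorphic_on ball 0 1" by (simp add: o_def)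
  qed
  have 2: "(\<lambda>n. \<beta> (of_real (rad n) * w)) \<longlonglongrightarrow> \<beta> w"
  proof -
    have "isCont \<beta> w"
      using w hol by (intro continuous_on_interior[of "ball 0 1"] holomorphic_on_imp_continuous_on) auto
    moreover have "(\<lambda>n. of_real (rad n) * w) \<longlonglongrightarrow> w"
      using tendsto_mult[OF tendsto_of_real[OF rad_tendsto] tendsto_const[of w]] by simp
    ultimately show ?thesis by (rule isCont_tendsto_compose)
  qed
  have 3: "(\<lambda>n. \<integral>\<theta>. ?F n \<theta> \<partial>angle) \<longlonglongrightarrow> (\<integral>\<theta>. poisson w (cis \<theta>) *\<^sub>R \<beta>s \<theta> \<partial>angle)"
  proof (rule integral_dominated_convergence[where w = "\<lambda>_. ((1 + norm w) / (1 - norm w)) * B"])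
    show "AE \<theta> in angle. (\<lambda>n. ?F n \<theta>) \<longlonglongrightarrow> poisson w (cis \<theta>) *\<^sub>R \<beta>s \<theta>"
      using lim by eventually_elim (rule tendsto_scaleR[OF tendsto_const])
    show "AE \<theta> in angle. norm (?F n \<theta>) \<le> ((1 + norm w) / (1 - norm w)) * B" for n
      unfolding norm_scaleR
      using Harnack_upper[OF _ w] poisson_nonneg[OF w] bound[OF rad_circle] w
      by (intro AE_I2 mult_mono) auto
    show "(\<lambda>\<theta>. poisson w (cis \<theta>) *\<^sub>R \<beta>s \<theta>) \<in> borel_measurable angle" by measurable
    show "?F n \<in> borel_measurable angle" for n by measurable
    show "integrable angle (\<lambda>_. ((1 + norm w) / (1 - norm w)) * B)" by (rule angle.integrable_const)
  qed
  show ?thesis using LIMSEQ_unique[OF 3] 2 unfolding 1 by blast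
qed

text \<open>The Poisson kernel at \<open>w\<close> is a probability density under which
  \<open>\<beta>s\<close> has mean \<open>\<beta> w\<close>, and the mean minimises the quadratic
  deviation.\<close>

lemma Poisson_variance_le:
  assumes w: "norm w < 1"
  shows "(\<integral>\<theta>. poisson w (cis \<theta>) * (norm (\<beta>s \<theta> - \<beta> w))\<^sup>2 \<partial>angle)
    \<le> (\<integral>\<theta>. poisson w (cis \<theta>) * (norm (\<beta>s \<theta> - c))\<^sup>2 \<partial>angle)"
proof -
  let ?P = "\<lambda>\<theta>. poisson w (cis \<theta>)"
  define d where "d = \<beta> w - c"
  have sq: "(norm (x - c))\<^sup>2 = (norm (x - \<beta> w))\<^sup>2 + (norm d)\<^sup>2 + 2 * Re (cnj d * (x - \<beta> w))" for x
  proof -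
    have "x - c = (x - \<beta> w) + d" by (simp add: d_def)
    then show ?thesis
      by (simp only: cmod_power2) (simp add: power2_eq_square algebra_simps)
  qed
  have bb: "norm (\<beta>s \<theta> - c') \<le> B + norm c'" for \<theta> c'
    using norm_triangle_ineq4[of "\<beta>s \<theta>" c'] bounds[of \<theta>] by linarith
  have int2: "integrable angle (\<lambda>\<theta>. ?P \<theta> * (norm (\<beta>s \<theta> - c'))\<^sup>2)" for c'
  proof -
    have "norm ((norm (\<beta>s \<theta> - c'))\<^sup>2) \<le> (B + norm c')\<^sup>2" for \<theta>
      using power_mono[OF bb[of \<theta> c'], of 2] by simp
    from integrable_poisson[OF _ this w] show ?thesis by simp
  qed
  have int1: "integrable angle (\<lambda>\<theta>. ?P \<theta> *\<^sub>R (cnj d * (\<beta>s \<theta> - \<beta> w)))"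
  proof -
    have "norm (cnj d * (\<beta>s \<theta> - \<beta> w)) \<le> norm d * (B + norm (\<beta> w))" for \<theta>
      unfolding norm_mult complex_mod_cnj by (rule mult_left_mono[OF bb]) simp
    from integrable_poisson[OF _ this w] show ?thesis by simp
  qed
  have intP: "integrable angle ?P"
    using integrable_poisson[OF _ _ w, of "\<lambda>\<theta>. 1::real" 1] by simp
  have ints: "integrable angle (\<lambda>\<theta>. ?P \<theta> *\<^sub>R \<beta>s \<theta>)"
    by (rule integrable_poisson[OF _ bounds w]) simp
  have "(\<integral>\<theta>. ?P \<theta> *\<^sub>R (cnj d * (\<beta>s \<theta> - \<beta> w)) \<partial>angle)
      = (\<integral>\<theta>. cnj d * (?P \<theta> *\<^sub>R \<beta>s \<theta>) - cnj d * (?P \<theta> *\<^sub>R \<beta> w) \<partial>angle)"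
    by (simp add: algebra_simps scaleR_conv_of_real)
  also have "\<dots> = cnj d * (\<integral>\<theta>. ?P \<theta> *\<^sub>R \<beta>s \<theta> \<partial>angle) - cnj d * ((\<integral>\<theta>. ?P \<theta> \<partial>angle) *\<^sub>R \<beta> w)"
    unfolding integral_mult_right_zero[symmetric] integral_scaleR_left[OF intP, symmetric]
    by (intro Bochner_Integration.integral_diff integrable_mult_right integrable_scaleR_left ints intP)
  also have "\<dots> = 0" using Poisson_radial_limit[OF w] integral_poisson[OF w] by simp
  finally have "Re (\<integral>\<theta>. ?P \<theta> *\<^sub>R (cnj d * (\<beta>s \<theta> - \<beta> w)) \<partial>angle) = 0" by simp
  then have 0: "(\<integral>\<theta>. ?P \<theta> * Re (cnj d * (\<beta>s \<theta> - \<beta> w)) \<partial>angle) = 0"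
    using integral_Re[OF int1] by (simp del: times_complex.sel minus_complex.sel)
  have intR: "integrable angle (\<lambda>\<theta>. ?P \<theta> * Re (cnj d * (\<beta>s \<theta> - \<beta> w)))"
    using integrable_Re[OF int1] by (simp del: times_complex.sel minus_complex.sel)
  have "(\<integral>\<theta>. ?P \<theta> * (norm (\<beta>s \<theta> - c))\<^sup>2 \<partial>angle)
    = (\<integral>\<theta>. ?P \<theta> * (norm (\<beta>s \<theta> - \<beta> w))\<^sup>2 + (?P \<theta> * (norm d)\<^sup>2 + 2 * (?P \<theta> * Re (cnj d * (\<beta>s \<theta> - \<beta> w)))) \<partial>angle)"
    unfolding sq by (intro Bochner_Integration.integral_cong) (auto simp: distrib_left)
  also have "\<dots> = (\<integral>\<theta>. ?P \<theta> * (norm (\<beta>s \<theta> - \<beta> w))\<^sup>2 \<partial>angle) + ((norm d)\<^sup>2 + 0)"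
    using int2 intP intR 0 integral_poisson[OF w]
    by (subst Bochner_Integration.integral_add) (auto simp del: times_complex.sel minus_complex.sel)
  finally show ?thesis by simp
qed

text \<open>The dilate of \<open>\<beta>\<close> by \<open>rad m\<close> is holomorphic across the
  circle and serves as a smooth approximation of \<open>\<beta>s\<close>; this is its pointwise
  quadratic error.\<close>

definition err :: "nat \<Rightarrow> real \<Rightarrow> real" where
  "err m \<theta> = (norm (\<beta>s \<theta> - \<beta> (of_real (rad m) * cis \<theta>)))\<^sup>2"

lemma err_measurable [measurable]: "err m \<in> borel_measurable borel"
  unfolding err_def by measurable

lemma err_bound: "norm (err m \<theta>) \<le> (2 * B)\<^sup>2"
proof -
  have "norm (\<beta>s \<theta> - \<beta> (of_real (rad m) * cis \<theta>)) \<le> B + B"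
    using bound[OF rad_circle, of "cis \<theta>" m] bounds[of \<theta>]
    by (intro order_trans[OF norm_triangle_ineq4] add_mono) auto
  then have "(norm (\<beta>s \<theta> - \<beta> (of_real (rad m) * cis \<theta>)))\<^sup>2 \<le> (2 * B)\<^sup>2"
    by (intro power_mono) auto
  then show ?thesis unfolding err_def by simp
qed

lemma err_tendsto:
  assumes w: "norm w < 1"
  shows "(\<lambda>m. \<integral>\<theta>. poisson w (cis \<theta>) * err m \<theta> \<partial>angle) \<longlonglongrightarrow> 0"
proof -
  have "(\<lambda>m. \<integral>\<theta>. poisson w (cis \<theta>) * err m \<theta> \<partial>angle) \<longlonglongrightarrow> (\<integral>\<theta>. 0 \<partial>angle)"
  proof (rule integral_dominated_convergence[where w = "\<lambda>_. ((1 + norm w) / (1 - norm w)) * (2 * B)\<^sup>2"])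
    show "AE \<theta> in angle. (\<lambda>m. poisson w (cis \<theta>) * err m \<theta>) \<longlonglongrightarrow> 0"
      using lim
    proof eventually_elim
      case (elim \<theta>)
      have "(\<lambda>m. poisson w (cis \<theta>) * err m \<theta>) \<longlonglongrightarrow> poisson w (cis \<theta>) * (norm (\<beta>s \<theta> - \<beta>s \<theta>))\<^sup>2"
        unfolding err_def by (intro tendsto_intros elim)
      then show ?case by simp
    qed
    show "AE \<theta> in angle. norm (poisson w (cis \<theta>) * err m \<theta>) \<le> ((1 + norm w) / (1 - norm w)) * (2 * B)\<^sup>2" for m
      unfolding norm_mult
      using Harnack_upper[OF _ w] poisson_nonneg[OF w] err_bound[of m] w
      by (intro AE_I2 mult_mono) auto
  qed auto
  then show ?thesis by simp
qed

text \<open>By \<open>Poisson_variance_le\<close> the centre \<open>\<beta> w\<close> may be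
  replaced by the value \<open>\<gamma> w\<close> of the smooth dilate. Splitting at
  \<open>\<gamma> (cis \<theta>)\<close> leaves \<open>err m\<close> and a Lipschitz term, and the
  kernel times the squared distance of \<open>cis \<theta>\<close> and \<open>w\<close> is exactly
  \<open>1 - (norm w)\<^sup>2\<close>. So near the circle the variance is essentially the
  approximation error.\<close>

lemma Poisson_variance_err:
  obtains L where "0 \<le> L" "\<And>w. norm w < 1 \<Longrightarrow> (\<integral>\<theta>. poisson w (cis \<theta>) * (norm (\<beta>s \<theta> - \<beta> w))\<^sup>2 \<partial>angle)
    \<le> 2 * (\<integral>\<theta>. poisson w (cis \<theta>) * err m \<theta> \<partial>angle) + L * (1 - (norm w)\<^sup>2)"
proof -
  define \<gamma> where "\<gamma> z = \<beta> (of_real (rad m) * z)" for z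
  have hol': "\<gamma> holomorphic_on ball 0 (1 / rad m)"
    unfolding \<gamma>_def
  proof (intro holomorphic_on_compose_gen[OF _ hol, unfolded o_def] holomorphic_intros image_subsetI)
    fix z :: complex assume "z \<in> ball 0 (1 / rad m)"
    then show "of_real (rad m) * z \<in> ball 0 1"
      using rad[of m] by (cases "rad m = 0") (auto simp: norm_mult field_simps)
  qed
  have rp: "0 < rad m" by (simp add: rad_def field_simps)
  have "1 < 1 / rad m" using rad[of m] rp by (simp add: field_simps)
  then have sub: "cball 0 1 \<subseteq> ball (0::complex) (1 / rad m)" by auto
  have "continuous_on (cball 0 1) (deriv \<gamma>)"
    using holomorphic_deriv[OF hol'] sub holomorphic_on_imp_continuous_on continuous_on_subset by blast
  then have "bounded (deriv \<gamma> ` cball 0 1)"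
    by (intro compact_imp_bounded compact_continuous_image) auto
  then obtain L where L: "0 \<le> L" "\<And>z. z \<in> cball 0 1 \<Longrightarrow> norm (deriv \<gamma> z) \<le> L"
    by (metis bounded_pos imageI less_imp_le)
  have lip: "norm (\<gamma> x - \<gamma> w) \<le> L * norm (x - w)" if "norm x \<le> 1" "norm w \<le> 1" for x w
    using that L(2) sub
    by (intro field_differentiable_bound[of "cball 0 1" \<gamma> "deriv \<gamma>"] DERIV_subset[OF holomorphic_derivI[OF hol']]) auto
  show thesis
  proof
    show "0 \<le> 2 * L\<^sup>2" by simp
    fix w :: complex assume w: "norm w < 1"
    let ?P = "\<lambda>\<theta>. poisson w (cis \<theta>)"
    have intP: "integrable angle ?P"
      using integrable_poisson[OF _ _ w, of "\<lambda>\<theta>. 1::real" 1] by simp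
    have ie: "integrable angle (\<lambda>\<theta>. ?P \<theta> * err m \<theta>)"
      using integrable_poisson[OF _ err_bound[of m] w] by simp
    have pw: "?P \<theta> * (norm (\<beta>s \<theta> - \<gamma> w))\<^sup>2 \<le> 2 * (?P \<theta> * err m \<theta>) + 2 * L\<^sup>2 * (1 - (norm w)\<^sup>2)" for \<theta>
    proof -
      have tri: "(norm (a + b))\<^sup>2 \<le> 2 * (norm a)\<^sup>2 + 2 * (norm b)\<^sup>2" for a b :: complex
      proof -
        have "(norm (a + b))\<^sup>2 \<le> (norm a + norm b)\<^sup>2" by (intro power_mono norm_triangle_ineq) auto
        also have "\<dots> \<le> 2 * (norm a)\<^sup>2 + 2 * (norm b)\<^sup>2"
          using sum_squares_bound[of "norm a" "norm b"] by (simp add: power2_sum)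
        finally show ?thesis .
      qed
      have "(norm (\<beta>s \<theta> - \<gamma> w))\<^sup>2 \<le> 2 * err m \<theta> + 2 * (norm (\<gamma> (cis \<theta>) - \<gamma> w))\<^sup>2"
        using tri[of "\<beta>s \<theta> - \<gamma> (cis \<theta>)" "\<gamma> (cis \<theta>) - \<gamma> w"] by (simp add: err_def \<gamma>_def)
      also have "\<dots> \<le> 2 * err m \<theta> + 2 * (L * norm (cis \<theta> - w))\<^sup>2"
        using lip[of "cis \<theta>" w] w by (intro add_left_mono mult_left_mono power_mono) auto
      finally have "?P \<theta> * (norm (\<beta>s \<theta> - \<gamma> w))\<^sup>2 \<le> ?P \<theta> * (2 * err m \<theta> + 2 * (L * norm (cis \<theta> - w))\<^sup>2)"
        by (rule mult_left_mono) (rule poisson_nonneg[OF w])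
      also have "\<dots> = 2 * (?P \<theta> * err m \<theta>) + 2 * L\<^sup>2 * (?P \<theta> * (norm (cis \<theta> - w))\<^sup>2)"
        by (simp add: power_mult_distrib algebra_simps)
      also have "?P \<theta> * (norm (cis \<theta> - w))\<^sup>2 = 1 - (norm w)\<^sup>2"
        using w by (auto simp: poisson_def)
      finally show ?thesis .
    qed
    have "(\<integral>\<theta>. ?P \<theta> * (norm (\<beta>s \<theta> - \<beta> w))\<^sup>2 \<partial>angle) \<le> (\<integral>\<theta>. ?P \<theta> * (norm (\<beta>s \<theta> - \<gamma> w))\<^sup>2 \<partial>angle)"
      by (rule Poisson_variance_le[OF w])
    also have "\<dots> \<le> (\<integral>\<theta>. 2 * (?P \<theta> * err m \<theta>) + 2 * L\<^sup>2 * (1 - (norm w)\<^sup>2) \<partial>angle)"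
      using pw ie poisson_nonneg[OF w] order_trans[OF mult_nonneg_nonneg pw]
      by (intro integral_mono_AE' AE_I2) auto
    also have "\<dots> = 2 * (\<integral>\<theta>. ?P \<theta> * err m \<theta> \<partial>angle) + 2 * L\<^sup>2 * (1 - (norm w)\<^sup>2)"
      using ie by simp
    finally show "(\<integral>\<theta>. ?P \<theta> * (norm (\<beta>s \<theta> - \<beta> w))\<^sup>2 \<partial>angle)
       \<le> 2 * (\<integral>\<theta>. ?P \<theta> * err m \<theta> \<partial>angle) + 2 * L\<^sup>2 * (1 - (norm w)\<^sup>2)" .
  qed
qed

text \<open>At each point \<open>g (rad n * cis \<theta>)\<close> the function
  \<open>b \<circ> \<beta>\<close> is compared with the Poisson integral of
  \<open>b \<circ> \<beta>s\<close>, whose mean over \<open>\<theta>\<close> is its value at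
  \<open>g 0\<close>. The discrepancy is bounded by the variance of \<open>\<beta>s\<close>, whose
  two parts are small for different reasons: the averaged \<open>err m\<close> because
  \<open>m\<close> is large, the other because the values of \<open>g\<close> approach the
  circle.\<close>

lemma inner_composition_limit:
  fixes b :: "complex \<Rightarrow> real"
  assumes b: "continuous_on UNIV b"
    and g: "g holomorphic_on ball 0 1" "g ` ball 0 1 \<subseteq> ball 0 1"
    and inner: "AE \<theta> in angle. (\<lambda>n. norm (g (of_real (rad n) * cis \<theta>))) \<longlonglongrightarrow> 1"
  shows "(\<lambda>n. \<integral>\<theta>. b (\<beta> (g (of_real (rad n) * cis \<theta>))) \<partial>angle)
           \<longlonglongrightarrow> (\<integral>\<theta>. poisson (g 0) (cis \<theta>) * b (\<beta>s \<theta>) \<partial>angle)"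
proof (rule LIMSEQ_I)
  fix e :: real assume e: "0 < e"
  let ?\<sigma> = "\<lambda>n \<theta>. g (of_real (rad n) * cis \<theta>)"
  have b_meas [measurable]: "b \<in> borel_measurable borel" using b by (rule borel_measurable_continuous_onI)
  have \<sigma>_meas [measurable]: "?\<sigma> n \<in> borel_measurable borel" for n
    by (intro borel_measurable_continuous_onI continuous_on_circle g rad)
  have \<sigma>1: "norm (?\<sigma> n \<theta>) < 1" for n \<theta> using g(2) rad_circle[of "cis \<theta>" n] by (auto simp: image_subset_iff)
  have g0: "norm (g 0) < 1" using g(2) by (auto simp: image_subset_iff)
  have \<beta>\<sigma>_meas [measurable]: "(\<lambda>\<theta>. \<beta> (?\<sigma> n \<theta>)) \<in> borel_measurable borel" for n
    using \<sigma>1 by (intro borel_measurable_continuous_onI continuous_on_compose2[OF holomorphic_on_imp_continuous_on[OF hol]]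
        continuous_on_circle g rad) auto
  have cb: "continuous_on (cball 0 B) b" using b continuous_on_subset by blast
  then have "bounded (b ` cball 0 B)" by (intro compact_imp_bounded compact_continuous_image) auto
  then obtain M where M: "0 < M" "\<And>x. norm x \<le> B \<Longrightarrow> norm (b x) \<le> M"
    unfolding bounded_pos by force
  have "uniformly_continuous_on (cball 0 B) b"
    using cb compact_uniformly_continuous compact_cball by blast
  then obtain \<delta> where \<delta>: "0 < \<delta>" "\<And>x y. \<lbrakk>norm x \<le> B; norm y \<le> B; dist x y < \<delta>\<rbrakk> \<Longrightarrow> dist (b x) (b y) < e / 4"
    unfolding uniformly_continuous_on_def using e by (metis divide_pos_pos mem_cball_0 zero_less_numeral dist_commute)
  \<comment> \<open>With this \<open>K\<close> the quadratic term alone exceeds the maximal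
    oscillation \<open>2 * M\<close> once the points are at least \<open>\<delta>\<close> apart, as
    in Chebyshev's inequality.\<close>
  define K where "K = 2 * M / \<delta>\<^sup>2"
  have K0: "0 < K" using M \<delta> by (simp add: K_def)
  have bK: "\<bar>b x - b y\<bar> \<le> e / 4 + K * (norm (y - x))\<^sup>2" if "norm x \<le> B" "norm y \<le> B" for x y
  proof (cases "dist x y < \<delta>")
    case True
    then have "\<bar>b x - b y\<bar> < e / 4" using \<delta>(2) that by (simp add: dist_real_def)
    moreover have "0 \<le> K * (norm (y - x))\<^sup>2" using K0 by simp
    ultimately show ?thesis by linarith
  next
    case False
    then have "\<delta>\<^sup>2 \<le> (norm (y - x))\<^sup>2" using \<delta>(1) by (intro power_mono) (auto simp: dist_norm norm_minus_commute)
    then have "K * \<delta>\<^sup>2 \<le> K * (norm (y - x))\<^sup>2" using K0 by simp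
    moreover have "K * \<delta>\<^sup>2 = 2 * M" using \<delta>(1) by (simp add: K_def)
    moreover have "\<bar>b x - b y\<bar> \<le> 2 * M" using M(2)[of x] M(2)[of y] that by simp
    ultimately show ?thesis using e by linarith
  qed
  have bs: "norm (b (\<beta>s \<theta>)) \<le> M" for \<theta> using M(2) bounds by auto
  have b\<sigma>: "norm (b (\<beta> (?\<sigma> n \<theta>))) \<le> M" for n \<theta> using M(2) bound \<sigma>1 by auto
  have "(\<lambda>m. 2 * K * (\<integral>\<theta>. poisson (g 0) (cis \<theta>) * err m \<theta> \<partial>angle)) \<longlonglongrightarrow> 2 * K * 0"
    by (intro tendsto_intros err_tendsto g0)
  then have "\<forall>\<^sub>F m in sequentially. 2 * K * (\<integral>\<theta>. poisson (g 0) (cis \<theta>) * err m \<theta> \<partial>angle) < e / 4"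
    using e by (intro order_tendstoD(2)) auto
  \<comment> \<open>The order matters: \<open>m\<close> is fixed first, since the constant
    \<open>L\<close> below depends on it; \<open>n\<close> is taken large afterwards.\<close>
  then obtain m where m: "2 * K * (\<integral>\<theta>. poisson (g 0) (cis \<theta>) * err m \<theta> \<partial>angle) < e / 4"
    by (auto simp: eventually_sequentially)
  obtain L where L: "0 \<le> L" "\<And>w. norm w < 1 \<Longrightarrow> (\<integral>\<theta>. poisson w (cis \<theta>) * (norm (\<beta>s \<theta> - \<beta> w))\<^sup>2 \<partial>angle)
    \<le> 2 * (\<integral>\<theta>. poisson w (cis \<theta>) * err m \<theta> \<partial>angle) + L * (1 - (norm w)\<^sup>2)"
    by (rule Poisson_variance_err[of m], rule that)
  have int\<sigma>: "integrable angle (\<lambda>\<theta>. 1 - (norm (?\<sigma> n \<theta>))\<^sup>2)" for n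
    using less_imp_le[OF \<sigma>1]
    by (intro integrable_angle_bounded[of _ 1]) (auto simp: power_le_one)
  have "(\<lambda>n. \<integral>\<theta>. 1 - (norm (?\<sigma> n \<theta>))\<^sup>2 \<partial>angle) \<longlonglongrightarrow> (\<integral>\<theta>. 0 \<partial>angle)"
  proof (rule integral_dominated_convergence[where w = "\<lambda>_. 1"])
    show "AE \<theta> in angle. (\<lambda>n. 1 - (norm (?\<sigma> n \<theta>))\<^sup>2) \<longlonglongrightarrow> 0"
      using inner
    proof eventually_elim
      case (elim \<theta>)
      have "(\<lambda>n. 1 - (norm (?\<sigma> n \<theta>))\<^sup>2) \<longlonglongrightarrow> 1 - 1\<^sup>2" by (intro tendsto_intros elim)
      then show ?case by simp
    qed
    show "AE \<theta> in angle. norm (1 - (norm (?\<sigma> n \<theta>))\<^sup>2) \<le> 1" for n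
      using less_imp_le[OF \<sigma>1] by (auto simp: power_le_one)
  qed simp_all
  then have "(\<lambda>n. K * L * (\<integral>\<theta>. 1 - (norm (?\<sigma> n \<theta>))\<^sup>2 \<partial>angle)) \<longlonglongrightarrow> K * L * 0"
    by (intro tendsto_intros) simp
  then have "\<forall>\<^sub>F n in sequentially. K * L * (\<integral>\<theta>. 1 - (norm (?\<sigma> n \<theta>))\<^sup>2 \<partial>angle) < e / 4"
    using e by (intro order_tendstoD(2)) auto
  then obtain n0 where n0: "\<And>n. n0 \<le> n \<Longrightarrow> K * L * (\<integral>\<theta>. 1 - (norm (?\<sigma> n \<theta>))\<^sup>2 \<partial>angle) < e / 4"
    by (auto simp: eventually_sequentially)
  show "\<exists>no. \<forall>n\<ge>no. norm ((\<integral>\<theta>. b (\<beta> (?\<sigma> n \<theta>)) \<partial>angle)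
           - (\<integral>\<theta>. poisson (g 0) (cis \<theta>) * b (\<beta>s \<theta>) \<partial>angle)) < e"
  proof (intro exI allI impI)
    fix n assume n: "n0 \<le> n"
    define Q where "Q w = (\<integral>\<eta>. poisson w (cis \<eta>) * b (\<beta>s \<eta>) \<partial>angle)" for w
    define D where "D w = (\<integral>\<eta>. poisson w (cis \<eta>) * err m \<eta> \<partial>angle)" for w
    \<comment> \<open>The two averages are evaluated exactly at \<open>g 0\<close>, so they no
      longer depend on \<open>n\<close>.\<close>
    have Q: "integrable angle (\<lambda>\<theta>. Q (?\<sigma> n \<theta>))" "(\<integral>\<theta>. Q (?\<sigma> n \<theta>) \<partial>angle) = Q (g 0)"
      unfolding Q_def using Poisson_integral_mean[OF g rad[of n] _ bs] by simp_all
    have D: "integrable angle (\<lambda>\<theta>. D (?\<sigma> n \<theta>))" "(\<integral>\<theta>. D (?\<sigma> n \<theta>) \<partial>angle) = D (g 0)"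
      unfolding D_def using Poisson_integral_mean[OF g rad[of n] _ err_bound[of m]] by simp_all
    have ib: "integrable angle (\<lambda>\<theta>. b (\<beta> (?\<sigma> n \<theta>)))"
      by (rule integrable_angle_bounded[OF _ b\<sigma>]) simp
    have pw: "\<bar>b (\<beta> w) - Q w\<bar> \<le> e / 4 + 2 * K * D w + K * L * (1 - (norm w)\<^sup>2)" if w: "norm w < 1" for w
    proof -
      let ?P = "\<lambda>\<theta>. poisson w (cis \<theta>)"
      have intP: "integrable angle ?P"
        using integrable_poisson[OF _ _ w, of "\<lambda>\<theta>. 1::real" 1] by simp
      have iq: "integrable angle (\<lambda>\<theta>. ?P \<theta> * b (\<beta>s \<theta>))"
        using integrable_poisson[OF _ bs w] by simp
      have iv: "integrable angle (\<lambda>\<theta>. ?P \<theta> * (norm (\<beta>s \<theta> - \<beta> w))\<^sup>2)"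
      proof -
        have "norm (\<beta>s \<theta> - \<beta> w) \<le> B + B" for \<theta>
          using bounds[of \<theta>] bound[OF w] norm_triangle_ineq4[of "\<beta>s \<theta>" "\<beta> w"] by linarith
        then have "norm ((norm (\<beta>s \<theta> - \<beta> w))\<^sup>2) \<le> (B + B)\<^sup>2" for \<theta>
          by (simp only: real_norm_def abs_power2) (rule power_mono, auto)
        from integrable_poisson[OF _ this w] show ?thesis by simp
      qed
      have "b (\<beta> w) - Q w = (\<integral>\<theta>. ?P \<theta> * b (\<beta> w) - ?P \<theta> * b (\<beta>s \<theta>) \<partial>angle)"
        unfolding Q_def using intP iq integral_poisson[OF w] by (subst Bochner_Integration.integral_diff) auto
      then have "\<bar>b (\<beta> w) - Q w\<bar> \<le> (\<integral>\<theta>. \<bar>?P \<theta> * b (\<beta> w) - ?P \<theta> * b (\<beta>s \<theta>)\<bar> \<partial>angle)"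
        using integral_abs_bound by metis
      also have "\<dots> \<le> (\<integral>\<theta>. e / 4 * ?P \<theta> + K * (?P \<theta> * (norm (\<beta>s \<theta> - \<beta> w))\<^sup>2) \<partial>angle)"
      proof (rule integral_mono)
        fix \<theta>
        have "\<bar>?P \<theta> * b (\<beta> w) - ?P \<theta> * b (\<beta>s \<theta>)\<bar> = ?P \<theta> * \<bar>b (\<beta> w) - b (\<beta>s \<theta>)\<bar>"
          using poisson_nonneg[OF w, of "cis \<theta>"] by (simp add: right_diff_distrib[symmetric] abs_mult)
        also have "\<dots> \<le> ?P \<theta> * (e / 4 + K * (norm (\<beta>s \<theta> - \<beta> w))\<^sup>2)"
          using poisson_nonneg[OF w] bound[OF w] bounds by (intro mult_left_mono bK) auto
        finally show "\<bar>?P \<theta> * b (\<beta> w) - ?P \<theta> * b (\<beta>s \<theta>)\<bar> \<le> e / 4 * ?P \<theta> + K * (?P \<theta> * (norm (\<beta>s \<theta> - \<beta> w))\<^sup>2)"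
          by (simp add: algebra_simps)
      qed (use intP iq iv in \<open>auto intro!: integrable_abs Bochner_Integration.integrable_diff\<close>)
      also have "\<dots> = e / 4 + K * (\<integral>\<theta>. ?P \<theta> * (norm (\<beta>s \<theta> - \<beta> w))\<^sup>2 \<partial>angle)"
        using intP iv integral_poisson[OF w] by (subst Bochner_Integration.integral_add) auto
      also have "\<dots> \<le> e / 4 + K * (2 * D w + L * (1 - (norm w)\<^sup>2))"
        using L(2)[OF w] K0 unfolding D_def by (intro add_left_mono mult_left_mono) auto
      finally show ?thesis by (simp add: algebra_simps)
    qed
    have "norm ((\<integral>\<theta>. b (\<beta> (?\<sigma> n \<theta>)) \<partial>angle) - Q (g 0)) = \<bar>\<integral>\<theta>. b (\<beta> (?\<sigma> n \<theta>)) - Q (?\<sigma> n \<theta>) \<partial>angle\<bar>"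
      using Q ib by simp
    also have "\<dots> \<le> (\<integral>\<theta>. \<bar>b (\<beta> (?\<sigma> n \<theta>)) - Q (?\<sigma> n \<theta>)\<bar> \<partial>angle)"
      by (rule integral_abs_bound)
    also have "\<dots> \<le> (\<integral>\<theta>. e / 4 + 2 * K * D (?\<sigma> n \<theta>) + K * L * (1 - (norm (?\<sigma> n \<theta>))\<^sup>2) \<partial>angle)"
      using pw[OF \<sigma>1] Q(1) D(1) ib int\<sigma>
      by (intro integral_mono) (auto intro!: integrable_abs Bochner_Integration.integrable_diff Bochner_Integration.integrable_add)
    also have "\<dots> = e / 4 + 2 * K * D (g 0) + K * L * (\<integral>\<theta>. 1 - (norm (?\<sigma> n \<theta>))\<^sup>2 \<partial>angle)"
      using D int\<sigma> by (subst Bochner_Integration.integral_add) (auto intro!: Bochner_Integration.integrable_add)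
    also have "\<dots> < e / 4 + e / 4 + e / 4" using m n0[OF n] unfolding D_def by linarith
    also have "\<dots> < e" using e by simp
    finally show "norm ((\<integral>\<theta>. b (\<beta> (?\<sigma> n \<theta>)) \<partial>angle)
       - (\<integral>\<theta>. poisson (g 0) (cis \<theta>) * b (\<beta>s \<theta>) \<partial>angle)) < e" by (simp add: Q_def)
  qed
qed

end

section \<open>Radial limits of univalent functions\<close>

text \<open>The change of variables formula with Jacobian determinants is stated on Cartesian
  spaces, so points of the plane are transported there.\<close>

definition vec2 :: "complex \<Rightarrow> real ^ 2" where
  "vec2 z = (\<chi> i. if i = 1 then Re z else Im z)"

lemma vec2_nth [simp]: "vec2 z $ 1 = Re z" "vec2 z $ 2 = Im z"
  by (simp_all add: vec2_def)

lemma norm_vec2 [simp]: "norm (vec2 z) = norm z"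
  by (simp add: norm_vec_def L2_set_def sum_2 cmod_def)

lemma bounded_linear_vec2: "bounded_linear vec2"
proof (rule bounded_linear_intro[of _ 1])
  show "norm (vec2 z) \<le> norm z * 1" for z by simp
qed (simp_all add: vec2_def vec_eq_iff)

lemma inj_vec2: "inj vec2"
  by (auto simp: inj_def vec2_def vec_eq_iff complex_eq_iff forall_2)

definition pair2 :: "real \<times> real \<Rightarrow> real ^ 2" where
  "pair2 = (\<lambda>(a, b). vec2 (Complex a b))"

lemma pair2_nth [simp]: "pair2 p $ 1 = fst p" "pair2 p $ 2 = snd p"
  by (simp_all add: pair2_def split: prod.split)

lemma pair2_measurable [measurable]: "pair2 \<in> borel_measurable borel"
proof (rule borel_measurable_continuous_onI)
  have "linear pair2" by (rule linearI) (auto simp: vec_eq_iff forall_2)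
  then show "continuous_on UNIV pair2"
    by (simp add: linear_continuous_on linear_conv_bounded_linear)
qed

text \<open>Lets Tonelli's theorem for the product of two real lines act on integrals over
  \<open>real ^ 2\<close>.\<close>

lemma lborel_eq_distr_pair2: "(lborel :: (real ^ 2) measure) = distr lborel borel pair2"
proof (rule lborel_eqI)
  fix l u :: "real ^ 2" assume le: "\<And>b. b \<in> Basis \<Longrightarrow> l \<bullet> b \<le> u \<bullet> b"
  have le': "l $ i \<le> u $ i" for i
    using le[of "axis i 1"] by (auto simp: inner_axis axis_in_Basis_iff)
  have eq: "pair2 -` box l u = box (l $ 1) (u $ 1) \<times> box (l $ 2) (u $ 2)"
    by (auto simp: mem_box_cart forall_2 simp del: box_real)
  have "emeasure (distr lborel borel pair2) (box l u) = emeasure lborel (box (l $ 1) (u $ 1) \<times> box (l $ 2) (u $ 2))"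
    by (subst emeasure_distr) (auto simp: eq simp del: box_real)
  also have "\<dots> = emeasure lborel (box (l $ 1) (u $ 1)) * emeasure lborel (box (l $ 2) (u $ 2))"
    unfolding lborel_prod[symmetric] by (rule lborel.emeasure_pair_measure_Times) auto
  also have "\<dots> = ennreal ((u $ 1 - l $ 1) * (u $ 2 - l $ 2))"
    using le' by (simp add: ennreal_mult)
  also have "(u $ 1 - l $ 1) * (u $ 2 - l $ 2) = (\<Prod>b\<in>Basis. (u - l) \<bullet> b)"
    by (simp add: Basis_vec_def image_UN UNION_singleton_eq_range prod.reindex inj_on_def axis_eq_axis inner_axis UNIV_2)
  finally show "emeasure (distr lborel borel pair2) (box l u) = (\<Prod>b\<in>Basis. (u - l) \<bullet> b)" .
qed simp

text \<open>In polar coordinates the Jacobian of \<open>\<beta>\<close> is the integrand below, and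
  by injectivity its double integral is the area of the image, finite because the image is bounded.
  Tonelli's theorem then leaves a finite radial integral for almost every angle.\<close>

lemma polar_area_finite:
  assumes hol: "\<beta> holomorphic_on ball 0 1" and inj: "inj_on \<beta> (ball 0 1)"
    and bound: "\<And>z. norm z < 1 \<Longrightarrow> norm (\<beta> z) \<le> B"
  shows "AE \<theta> in lborel. 0 < \<theta> \<longrightarrow> \<theta> < 2 * pi \<longrightarrow>
     (\<integral>\<^sup>+s. indicator {0<..<1} s * ennreal (s * (norm (deriv \<beta> (of_real s * cis \<theta>)))\<^sup>2) \<partial>lborel) < \<infinity>"
proof -
  define P :: "real ^ 2 \<Rightarrow> complex" where "P v = of_real (v $ 1) * cis (v $ 2)" for v
  \<comment> \<open>Leaving out radius 0 and angle 0 makes the polar parametrisation injective on an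
    open set.\<close>
  define S :: "(real ^ 2) set" where "S = {v. 0 < v $ 1 \<and> v $ 1 < 1 \<and> 0 < v $ 2 \<and> v $ 2 < 2 * pi}"
  have S_box: "S = box (vec2 0) (vec2 (Complex 1 (2 * pi)))"
    by (auto simp: S_def mem_box_cart forall_2)
  have S_open: "open S" unfolding S_box by (rule open_box)
  have PS: "norm (P v) < 1" if "v \<in> S" for v
    using that by (simp add: P_def S_def norm_mult)
  define F where "F v = vec2 (\<beta> (P v))" for v
  define F' where "F' v h = vec2 (deriv \<beta> (P v) * (of_real (h $ 1) * cis (v $ 2) + of_real (v $ 1) * (h $ 2 *\<^sub>R (\<i> * cis (v $ 2)))))"
    for v h :: "real ^ 2"
  have der: "(F has_derivative F' v) (at v within S)" if v: "v \<in> S" for v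
  proof -
    have nth: "((\<lambda>v. v $ i) has_derivative (\<lambda>h. h $ i)) (at v within S)" for i
      by (rule bounded_linear_imp_has_derivative[OF bounded_linear_vec_nth])
    have cis: "((\<lambda>v. cis (v $ 2)) has_derivative (\<lambda>h. h $ 2 *\<^sub>R (\<i> * cis (v $ 2)))) (at v within S)"
    proof -
      have "(cis has_derivative (\<lambda>h. h *\<^sub>R (\<i> * cis (v $ 2)))) (at (v $ 2))"
        unfolding has_vector_derivative_def[symmetric] cis_conv_exp
        by (rule has_vector_derivative_real_field) (auto intro!: derivative_eq_intros)
      from has_derivative_compose[OF nth[of 2] this] show ?thesis .
    qed
    have "(P has_derivative (\<lambda>h. of_real (v $ 1) * (h $ 2 *\<^sub>R (\<i> * cis (v $ 2))) + of_real (h $ 1) * cis (v $ 2))) (at v within S)"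
      unfolding P_def by (intro has_derivative_mult bounded_linear.has_derivative[OF bounded_linear_of_real] nth cis)
    moreover have "(\<beta> has_derivative (*) (deriv \<beta> (P v))) (at (P v))"
      using holomorphic_derivI[OF hol open_ball, of "P v"] PS[OF v] by (simp add: has_field_derivative_def)
    ultimately have "((\<lambda>v. \<beta> (P v)) has_derivative
        (\<lambda>h. deriv \<beta> (P v) * (of_real (v $ 1) * (h $ 2 *\<^sub>R (\<i> * cis (v $ 2))) + of_real (h $ 1) * cis (v $ 2)))) (at v within S)"
      by (rule has_derivative_compose)
    from bounded_linear.has_derivative[OF bounded_linear_vec2 this] show ?thesis
      unfolding F_def[abs_def] F'_def[abs_def] by (simp add: add.commute)
  qed
  have injF: "inj_on F S"
  proof (rule inj_onI)
    fix v w assume vw: "v \<in> S" "w \<in> S" "F v = F w"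
    then have "\<beta> (P v) = \<beta> (P w)" using inj_vec2 by (auto simp: F_def inj_def)
    then have eq: "P v = P w" using PS vw inj by (auto dest: inj_onD)
    then have "norm (P v) = norm (P w)" by simp
    then have 1: "v $ 1 = w $ 1" using vw by (simp add: P_def S_def norm_mult)
    then have "cis (v $ 2) = cis (w $ 2)" using eq vw by (simp add: P_def S_def)
    moreover have "Arg2pi (cis (u $ 2)) = u $ 2" if "u \<in> S" for u :: "real ^ 2"
      using that by (intro Arg2pi_unique[of 1]) (auto simp: S_def cis_conv_exp)
    ultimately have "v $ 2 = w $ 2" using vw by metis
    with 1 show "v = w" by (simp add: vec_eq_iff forall_2)
  qed
  have det: "det (matrix (F' v)) = v $ 1 * (norm (deriv \<beta> (P v)))\<^sup>2" for v
  proof -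
    obtain c s where cs: "c = cos (v $ 2)" "s = sin (v $ 2)" by blast
    have "det (matrix (F' v)) = v $ 1 * ((norm (deriv \<beta> (P v)))\<^sup>2 * (c\<^sup>2 + s\<^sup>2))"
      unfolding cmod_power2 by (simp add: det_2 matrix_def F'_def axis_def flip: cs)
        (simp add: power2_eq_square algebra_simps)
    then have "det (matrix (F' v)) = v $ 1 * (norm (deriv \<beta> (P v)))\<^sup>2" by (simp add: cs)
    then show ?thesis by simp
  qed
  \<comment> \<open>The formula takes vector-valued integrands, so the constant 1 becomes a vector
    with one component.\<close>
  let ?one = "\<lambda>_ :: real ^ 2. vec 1 :: real ^ 1"
  have "F differentiable_on S"
    using der by (auto simp: differentiable_on_def differentiable_def)
  have "open (F ` S)"
    by (rule invariance_of_domain[OF _ S_open injF])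
      (rule differentiable_imp_continuous_on, fact)
  moreover have "bounded (F ` S)"
    using PS bound by (auto simp: bounded_iff F_def)
  ultimately have "F ` S \<in> lmeasurable" by (intro lmeasurable_open)
  then have "?one absolutely_integrable_on (F ` S)"
    unfolding set_integrable_def lmeasurable_iff_integrable by (rule integrable_scaleR_left)
  then have "(\<lambda>v. \<bar>det (matrix (F' v))\<bar> *\<^sub>R ?one (F v)) absolutely_integrable_on S"
    using absolutely_integrable_change_of_variables[OF _ der injF, of ?one] S_open by simp
  then have "(\<lambda>v. (\<bar>det (matrix (F' v))\<bar> *\<^sub>R ?one (F v)) $ 1) absolutely_integrable_on S"
    by (rule absolutely_integrable_linear[OF _ bounded_linear_vec_nth, unfolded o_def])
  also have "?this \<longleftrightarrow> (\<lambda>v. v $ 1 * (norm (deriv \<beta> (P v)))\<^sup>2) absolutely_integrable_on S"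
    by (intro set_integrable_cong) (auto simp: det S_def)
  finally have ai: "integrable lebesgue (\<lambda>v. indicator S v *\<^sub>R (v $ 1 * (norm (deriv \<beta> (P v)))\<^sup>2))"
    unfolding set_integrable_def .
  define q where "q v = indicator S v *\<^sub>R (v $ 1 * (norm (deriv \<beta> (P v)))\<^sup>2)" for v
  have "continuous_on S (\<lambda>v. v $ 1 * (norm (deriv \<beta> (P v)))\<^sup>2)"
  proof -
    have "continuous_on S P" unfolding P_def cis_conv_exp by (intro continuous_intros)
    then have "continuous_on S (\<lambda>v. deriv \<beta> (P v))"
      by (rule continuous_on_compose2[OF holomorphic_on_imp_continuous_on[OF holomorphic_deriv[OF hol open_ball]]])
        (use PS in auto)
    then show ?thesis by (intro continuous_intros)
  qed
  then have q_meas [measurable]: "q \<in> borel_measurable borel"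
    unfolding q_def[abs_def] using S_open by (intro borel_measurable_continuous_on_indicator) auto
  have "integrable lborel q"
    using ai integrable_completion[of q lborel] unfolding q_def[abs_def, symmetric] by simp
  then have "(\<integral>\<^sup>+v. ennreal (norm (q v)) \<partial>lborel) < \<infinity>" by (simp add: integrable_iff_bounded)
  also have "(\<integral>\<^sup>+v. ennreal (norm (q v)) \<partial>lborel) = (\<integral>\<^sup>+p. ennreal (norm (q (pair2 p))) \<partial>(lborel \<Otimes>\<^sub>M lborel))"
    unfolding lborel_prod by (subst lborel_eq_distr_pair2) (simp add: nn_integral_distr)
  also have "\<dots> = (\<integral>\<^sup>+\<theta>. (\<integral>\<^sup>+s. ennreal (norm (q (pair2 (s, \<theta>)))) \<partial>lborel) \<partial>lborel)"
    by (rule lborel_pair.nn_integral_snd[symmetric]) (simp add: lborel_prod)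
  finally have fin: "(\<integral>\<^sup>+\<theta>. (\<integral>\<^sup>+s. ennreal (norm (q (pair2 (s, \<theta>)))) \<partial>lborel) \<partial>lborel) < \<infinity>" .
  have "AE \<theta> in lborel. (\<integral>\<^sup>+s. ennreal (norm (q (pair2 (s, \<theta>)))) \<partial>lborel) \<noteq> \<infinity>"
    by (rule nn_integral_PInf_AE) (use fin in \<open>auto simp: less_top[symmetric]\<close>)
  then show ?thesis
  proof eventually_elim
    case (elim \<theta>)
    show ?case
    proof (intro impI)
      assume "0 < \<theta>" "\<theta> < 2 * pi"
      then have "ennreal (norm (q (pair2 (s, \<theta>)))) = indicator {0<..<1} s * ennreal (s * (norm (deriv \<beta> (of_real s * cis \<theta>)))\<^sup>2)" for s
        by (auto simp: q_def S_def P_def indicator_def abs_mult)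
      then show "(\<integral>\<^sup>+s. indicator {0<..<1} s * ennreal (s * (norm (deriv \<beta> (of_real s * cis \<theta>)))\<^sup>2) \<partial>lborel) < \<infinity>"
        using elim by (simp add: less_top[symmetric])
    qed
  qed
qed

text \<open>Finite energy bounds the length of the image of the radius:
  \<open>2 * d \<le> 1 + d\<^sup>2\<close> plays the part of the Cauchy-Schwarz inequality.
  Increments of \<open>h\<close> are dominated by those of the increasing bounded function
  \<open>G\<close>, which gives the Cauchy property at 1.\<close>

lemma radial_limit_if_finite_energy:
  assumes hol: "\<beta> holomorphic_on ball 0 1" and \<zeta>: "norm \<zeta> = 1"
    and fin: "(\<integral>\<^sup>+s. indicator {0<..<1} s * ennreal (s * (norm (deriv \<beta> (of_real s * \<zeta>)))\<^sup>2) \<partial>lborel) < \<infinity>"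
  shows "\<exists>l. ((\<lambda>t. \<beta> (of_real t * \<zeta>)) \<longlongrightarrow> l) (at_left 1)"
proof -
  define h where "h t = \<beta> (of_real t * \<zeta>)" for t :: real
  define d where "d t = norm (deriv \<beta> (of_real t * \<zeta>))" for t :: real
  define k where "k t = 1 + (d t)\<^sup>2" for t
  have ball: "of_real t * \<zeta> \<in> ball 0 1" if "0 \<le> t" "t < 1" for t using that \<zeta> by (simp add: norm_mult)
  have cont: "continuous_on {1/2..t} k" "continuous_on {1/2..t} d" if "t < 1" for t
  proof -
    show *: "continuous_on {1/2..t} d" unfolding d_def
      by (intro continuous_intros continuous_on_compose2[OF holomorphic_on_imp_continuous_on[OF holomorphic_deriv[OF hol open_ball]]])
        (use that in \<open>auto intro!: ball simp del: mem_ball mem_ball_0\<close>)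
    show "continuous_on {1/2..t} k" unfolding k_def by (intro continuous_intros *)
  qed
  have int: "k integrable_on {s..t}" if "1/2 \<le> s" "t < 1" for s t
    using that by (intro integrable_continuous_interval continuous_on_subset[OF cont(1)[of t]]) auto
  \<comment> \<open>Starting at 1/2 bounds the weight \<open>s\<close> of the energy from below, so
    dropping it costs only a factor 2.\<close>
  define G where "G t = integral {1/2..t} k" for t
  have diff: "norm (h t - h s) \<le> G t - G s" if st: "1/2 \<le> s" "s \<le> t" "t < 1" for s t
  proof -
    have "((\<lambda>t. \<zeta> * deriv \<beta> (of_real t * \<zeta>)) has_integral h t - h s) {s..t}"
    proof (rule fundamental_theorem_of_calculus)
      fix x assume x: "x \<in> {s..t}"
      have "((\<lambda>x. of_real x * \<zeta>) has_vector_derivative \<zeta>) (at x within {s..t})"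
        by (auto intro!: derivative_eq_intros)
      moreover have "(\<beta> has_field_derivative deriv \<beta> (of_real x * \<zeta>)) (at (of_real x * \<zeta>))"
        using x st by (intro holomorphic_derivI[OF hol open_ball] ball) auto
      ultimately have "(\<beta> \<circ> (\<lambda>x. of_real x * \<zeta>) has_vector_derivative \<zeta> * deriv \<beta> (of_real x * \<zeta>)) (at x within {s..t})"
        by (intro field_vector_diff_chain_within) (auto intro: has_field_derivative_at_within)
      then show "(h has_vector_derivative \<zeta> * deriv \<beta> (of_real x * \<zeta>)) (at x within {s..t})"
        by (simp add: h_def[abs_def] o_def)
    qed (use st in simp)
    then have hi: "(\<lambda>t. \<zeta> * deriv \<beta> (of_real t * \<zeta>)) integrable_on {s..t}"
      "integral {s..t} (\<lambda>t. \<zeta> * deriv \<beta> (of_real t * \<zeta>)) = h t - h s"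
      by (blast, rule integral_unique)
    have "norm (h t - h s) \<le> integral {s..t} k"
      unfolding hi(2)[symmetric]
    proof (rule integral_norm_bound_integral[OF hi(1)])
      show "k integrable_on {s..t}" using int st by simp
      show "norm (\<zeta> * deriv \<beta> (of_real x * \<zeta>)) \<le> k x" if "x \<in> {s..t}" for x
      proof -
        have "0 \<le> (d x - 1)\<^sup>2" by simp
        then have "2 * d x \<le> k x" by (simp add: k_def power2_eq_square algebra_simps)
        moreover have "0 \<le> d x" "norm (\<zeta> * deriv \<beta> (of_real x * \<zeta>)) = d x"
          using \<zeta> by (simp_all add: d_def norm_mult)
        ultimately show ?thesis by linarith
      qed
    qed
    also have "\<dots> = G t - G s"
      using Henstock_Kurzweil_Integration.integral_combine[of "1/2" s t k] int[of "1/2" t] st by (simp add: G_def)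
    finally show ?thesis .
  qed
  obtain C where C: "\<And>t. 1/2 \<le> t \<Longrightarrow> t < 1 \<Longrightarrow> G t \<le> C"
  proof -
    let ?I = "\<integral>\<^sup>+s. indicator {0<..<1} s * ennreal (s * (d s)\<^sup>2) \<partial>lborel"
    have I: "?I < \<infinity>" using fin by (simp add: d_def)
    have "G t \<le> 1 + 2 * enn2real ?I" if t: "1/2 \<le> t" "t < 1" for t
    proof -
      have si: "set_integrable lborel {1/2..t} (\<lambda>s. (d s)\<^sup>2)"
        using cont(2)[of t] t by (intro borel_integrable_atLeastAtMost' continuous_intros) auto
      have "(d has_integral integral {1/2..t} d) {1/2..t}" 
        using cont(2)[of t] t by (intro integrable_integral integrable_continuous_interval) auto
      have "ennreal (integral {1/2..t} (\<lambda>s. (d s)\<^sup>2)) = ennreal (\<integral>s. indicator {1/2..t} s *\<^sub>R (d s)\<^sup>2 \<partial>lborel)"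
        using set_borel_integral_eq_integral(2)[OF si] by (simp add: set_lebesgue_integral_def)
      also have "\<dots> = (\<integral>\<^sup>+s. ennreal (indicator {1/2..t} s *\<^sub>R (d s)\<^sup>2) \<partial>lborel)"
        using si unfolding set_integrable_def by (intro nn_integral_eq_integral[symmetric]) auto
      also have "\<dots> \<le> (\<integral>\<^sup>+s. 2 * (indicator {0<..<1} s * ennreal (s * (d s)\<^sup>2)) \<partial>lborel)"
      proof (intro nn_integral_mono)
        fix s :: real
        have "(d s)\<^sup>2 \<le> 2 * (s * (d s)\<^sup>2)" if "1/2 \<le> s"
          using mult_right_mono[of 1 "2 * s" "(d s)\<^sup>2"] that by simp
        then show "ennreal (indicator {1/2..t} s *\<^sub>R (d s)\<^sup>2) \<le> 2 * (indicator {0<..<1} s * ennreal (s * (d s)\<^sup>2))"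
          using t by (auto simp: indicator_def ennreal_mult'[symmetric] ennreal_numeral[symmetric] intro!: ennreal_leI simp del: ennreal_numeral)
      qed
      also have "\<dots> = 2 * ?I"
      proof (rule nn_integral_cmult)
        have "continuous_on {0<..<1} (\<lambda>s. s * (d s)\<^sup>2)" unfolding d_def
          by (intro continuous_intros continuous_on_compose2[OF holomorphic_on_imp_continuous_on[OF holomorphic_deriv[OF hol open_ball]]])
            (auto intro!: ball simp del: mem_ball mem_ball_0)
        then have "(\<lambda>s. indicator {0<..<1} s *\<^sub>R (s * (d s)\<^sup>2)) \<in> borel_measurable borel"
          by (intro borel_measurable_continuous_on_indicator) auto
        then have "(\<lambda>s. ennreal (indicator {0<..<1} s *\<^sub>R (s * (d s)\<^sup>2))) \<in> borel_measurable lborel" by simp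
        also have "(\<lambda>s. ennreal (indicator {0<..<1} s *\<^sub>R (s * (d s)\<^sup>2))) = (\<lambda>s. indicator {0<..<1} s * ennreal (s * (d s)\<^sup>2))"
          by (auto simp: indicator_def)
        finally show "(\<lambda>s. indicator {0<..<1} s * ennreal (s * (d s)\<^sup>2)) \<in> borel_measurable lborel" .
      qed
      also have "\<dots> = ennreal (2 * enn2real ?I)"
        using I by (simp add: ennreal_mult less_top[symmetric])
      finally have "integral {1/2..t} (\<lambda>s. (d s)\<^sup>2) \<le> 2 * enn2real ?I"
        by (subst (asm) ennreal_le_iff) auto
      moreover have "G t = integral {1/2..t} (\<lambda>_. 1) + integral {1/2..t} (\<lambda>s. (d s)\<^sup>2)"
        unfolding G_def k_def using cont(2)[of t] t
        by (intro Henstock_Kurzweil_Integration.integral_add integrable_continuous_interval continuous_intros) auto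
      ultimately show ?thesis using t by simp
    qed
    then show ?thesis using that by blast
  qed
  define Gs where "Gs = Sup (G ` {1/2..<1})"
  have bdd: "bdd_above (G ` {1/2..<1})" by (rule bdd_aboveI2[of _ _ C]) (use C in auto)
  have G_le: "G t \<le> Gs" if "1/2 \<le> t" "t < 1" for t
    unfolding Gs_def using that by (intro cSup_upper bdd) auto
  have "cauchy_filter (filtermap h (at_left 1))"
    unfolding cauchy_filter_metric
  proof (intro allI impI)
    fix e :: real assume e: "0 < e"
    have "\<exists>x\<in>G ` {1/2..<1}. Gs - e / 2 < x"
      unfolding Gs_def using e by (intro less_cSupD) auto
    then obtain t0 where t0: "1/2 \<le> t0" "t0 < 1" "Gs - e / 2 < G t0" by auto
    have near: "norm (h t - h t0) < e / 2" if "t0 \<le> t" "t < 1" for t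
      using diff[of t0 t] G_le[of t] t0 that by simp
    show "\<exists>P. eventually P (filtermap h (at_left 1)) \<and> (\<forall>x y. P x \<and> P y \<longrightarrow> dist x y < e)"
    proof (intro exI conjI allI impI)
      have "\<forall>\<^sub>F t in at_left 1. t \<in> {t0<..<1}" using t0 by (intro eventually_at_leftI[of t0]) auto
      then show "eventually (\<lambda>x. norm (x - h t0) < e / 2) (filtermap h (at_left 1))"
        unfolding eventually_filtermap by eventually_elim (use near in auto)
      fix x y assume "norm (x - h t0) < e / 2 \<and> norm (y - h t0) < e / 2"
      then show "dist x y < e" using dist_triangle_half_r[of "h t0" x e y]
        by (simp add: dist_norm norm_minus_commute)
    qed
  qed
  moreover have "filtermap h (at_left 1) \<noteq> bot" by (simp add: filtermap_bot_iff)
  ultimately have "\<exists>x\<in>UNIV. filtermap h (at_left 1) \<le> nhds x"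
    using complete_UNIV unfolding complete_uniform by (metis principal_UNIV top_greatest)
  then show ?thesis by (auto simp: filterlim_def h_def[abs_def])
qed

lemma AE_angle_iff: "(AE \<theta> in angle. Q \<theta>) \<longleftrightarrow> (AE \<theta> in lborel. \<theta> \<in> {0..<2 * pi} \<longrightarrow> Q \<theta>)"
  unfolding angle_def by (rule AE_uniform_measure) auto

theorem bounded_univalent_radial_limit:
  assumes hol: "\<beta> holomorphic_on ball 0 1" and inj: "inj_on \<beta> (ball 0 1)"
    and bound: "\<And>z. norm z < 1 \<Longrightarrow> norm (\<beta> z) \<le> B"
  shows "AE \<theta> in angle. \<exists>l. ((\<lambda>t. \<beta> (of_real t * cis \<theta>)) \<longlongrightarrow> l) (at_left 1)"
proof -
  have "AE \<theta> in lborel. 0 < \<theta> \<longrightarrow> \<theta> < 2 * pi \<longrightarrow>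
     (\<integral>\<^sup>+s. indicator {0<..<1} s * ennreal (s * (norm (deriv \<beta> (of_real s * cis \<theta>)))\<^sup>2) \<partial>lborel) < \<infinity>"
    by (rule polar_area_finite[OF hol inj bound])
  then show ?thesis
    unfolding AE_angle_iff using AE_lborel_singleton[of 0]
  proof eventually_elim
    case (elim \<theta>)
    then show ?case by (intro impI radial_limit_if_finite_energy[OF hol]) auto
  qed
qed

section \<open>Measurability of the boundary values of a Riemann map\<close>

text \<open>The default \<open>y\<close> will be a boundary point of \<open>U\<close>, so that the
  function takes all its values in \<open>frontier U\<close>, including at angles without a finite
  radial limit.\<close>

definition boundary_value :: "(complex \<Rightarrow> complex) \<Rightarrow> complex \<Rightarrow> real \<Rightarrow> complex" where
  "boundary_value \<phi> y \<theta> = (if cis \<theta> \<in> radial_domain \<phi> then radial_ext \<phi> (cis \<theta>) else y)"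

lemma radial_ext_eqI: "((\<lambda>t. \<phi> (of_real t * \<zeta>)) \<longlongrightarrow> l) (at_left 1) \<Longrightarrow> radial_ext \<phi> \<zeta> = l"
  unfolding radial_ext_def by (rule tendsto_Lim) auto

lemma radial_domain_tendsto:
  "\<zeta> \<in> radial_domain \<phi> \<Longrightarrow> ((\<lambda>t. \<phi> (of_real t * \<zeta>)) \<longlongrightarrow> radial_ext \<phi> \<zeta>) (at_left 1)"
  unfolding radial_domain_def using radial_ext_eqI by fastforce

lemma radial_domain_tendsto_rad:
  "\<zeta> \<in> radial_domain \<phi> \<Longrightarrow> (\<lambda>n. \<phi> (of_real (rad n) * \<zeta>)) \<longlonglongrightarrow> radial_ext \<phi> \<zeta>"
  using filterlim_compose[OF radial_domain_tendsto rad_tendsto_left] .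

text \<open>Cauchy's criterion with countably many tolerances and starting radii. The nonstrict
  inequality makes each inner set closed for continuous \<open>\<phi>\<close>, which yields
  measurability in \<open>radial_domain_borel\<close>.\<close>

lemma radial_domain_Cauchy:
  "radial_domain \<phi> = (\<Inter>k::nat. \<Union>n::nat. {\<zeta>\<in>sphere 0 1. \<forall>s\<in>{rad n..<1}. \<forall>t\<in>{rad n..<1}.
     dist (\<phi> (of_real s * \<zeta>)) (\<phi> (of_real t * \<zeta>)) \<le> 1 / (real k + 1)})" (is "_ = ?R")
proof (intro set_eqI iffI)
  fix \<zeta> assume \<zeta>: "\<zeta> \<in> radial_domain \<phi>"
  show "\<zeta> \<in> ?R"
  proof
    fix k :: nat
    have "\<forall>\<^sub>F t in at_left 1. dist (\<phi> (of_real t * \<zeta>)) (radial_ext \<phi> \<zeta>) < 1 / (real k + 1) / 2"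
      using radial_domain_tendsto[OF \<zeta>] by (rule tendstoD) simp
    then obtain b where b: "b < 1" "\<And>t. b < t \<Longrightarrow> t < 1 \<Longrightarrow> dist (\<phi> (of_real t * \<zeta>)) (radial_ext \<phi> \<zeta>) < 1 / (real k + 1) / 2"
      unfolding eventually_at_left_field by blast
    obtain n where n: "b < rad n"
      using order_tendstoD(1)[OF rad_tendsto b(1)] by (auto simp: eventually_sequentially)
    have "dist (\<phi> (of_real s * \<zeta>)) (\<phi> (of_real t * \<zeta>)) \<le> 1 / (real k + 1)"
      if "s \<in> {rad n..<1}" "t \<in> {rad n..<1}" for s t
      using that n by (intro less_imp_le dist_triangle_half_l[OF b(2) b(2)]) auto
    then show "\<zeta> \<in> (\<Union>n::nat. {\<zeta>\<in>sphere 0 1. \<forall>s\<in>{rad n..<1}. \<forall>t\<in>{rad n..<1}.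
     dist (\<phi> (of_real s * \<zeta>)) (\<phi> (of_real t * \<zeta>)) \<le> 1 / (real k + 1)})"
      using \<zeta> unfolding radial_domain_def by blast
  qed
next
  fix \<zeta> assume \<zeta>: "\<zeta> \<in> ?R"
  have 1: "\<zeta> \<in> sphere 0 1" using INT_D[OF \<zeta> UNIV_I, of 0] by (elim UN_E CollectE) simp
  have "cauchy_filter (filtermap (\<lambda>t. \<phi> (of_real t * \<zeta>)) (at_left 1))"
    unfolding cauchy_filter_metric_filtermap
  proof (intro allI impI)
    fix e :: real assume "0 < e"
    then obtain k where "inverse (real (Suc k)) < e" using reals_Archimedean by blast
    then have k: "1 / (real k + 1) < e" by (simp add: inverse_eq_divide add.commute)
    obtain n where "\<zeta> \<in> {\<zeta>\<in>sphere 0 1. \<forall>s\<in>{rad n..<1}. \<forall>t\<in>{rad n..<1}.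
        dist (\<phi> (of_real s * \<zeta>)) (\<phi> (of_real t * \<zeta>)) \<le> 1 / (real k + 1)}"
      using INT_D[OF \<zeta> UNIV_I, of k] by (rule UN_E)
    then have n: "dist (\<phi> (of_real s * \<zeta>)) (\<phi> (of_real t * \<zeta>)) \<le> 1 / (real k + 1)"
      if "s \<in> {rad n..<1}" "t \<in> {rad n..<1}" for s t
      using that by simp
    have "\<forall>\<^sub>F t in at_left 1. t \<in> {rad n..<1}"
      using rad(2)[of n] by (intro eventually_at_leftI[of "rad n"]) auto
    then show "\<exists>P. eventually P (at_left 1) \<and>
        (\<forall>x y. P x \<and> P y \<longrightarrow> dist (\<phi> (of_real x * \<zeta>)) (\<phi> (of_real y * \<zeta>)) < e)"
      using n k by (intro exI[of _ "\<lambda>t. t \<in> {rad n..<1}"]) (meson le_less_trans)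
  qed
  moreover have "filtermap (\<lambda>t. \<phi> (of_real t * \<zeta>)) (at_left 1) \<noteq> bot" by (simp add: filtermap_bot_iff)
  ultimately have "\<exists>x\<in>UNIV. filtermap (\<lambda>t. \<phi> (of_real t * \<zeta>)) (at_left 1) \<le> nhds x"
    using complete_UNIV unfolding complete_uniform by (metis principal_UNIV top_greatest)
  then show "\<zeta> \<in> radial_domain \<phi>" using 1 by (auto simp: filterlim_def radial_domain_def)
qed

lemma radial_domain_borel:
  assumes \<phi>: "continuous_on (ball 0 1) \<phi>"
  shows "radial_domain \<phi> \<in> sets borel"
proof -
  have c: "continuous_on (sphere 0 1) (\<lambda>\<zeta>. \<phi> (of_real s * \<zeta>))" if "s \<in> {rad n..<1}" for s n
    using that rad(1)[of n] by (intro continuous_on_compose2[OF \<phi>] continuous_intros) (auto simp: norm_mult)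
  have "closed {\<zeta>\<in>sphere 0 1. \<forall>s\<in>{rad n..<1}. \<forall>t\<in>{rad n..<1}.
     dist (\<phi> (of_real s * \<zeta>)) (\<phi> (of_real t * \<zeta>)) \<le> 1 / (real k + 1)}" (is "closed ?S") for n k :: nat
  proof -
    have "?S = sphere 0 1 \<inter> (\<Inter>s\<in>{rad n..<1}. \<Inter>t\<in>{rad n..<1}.
        sphere 0 1 \<inter> (\<lambda>\<zeta>. dist (\<phi> (of_real s * \<zeta>)) (\<phi> (of_real t * \<zeta>))) -` {..1 / (real k + 1)})"
      by blast
    also have "closed \<dots>"
      by (intro closed_Int closed_INT ballI closed_sphere continuous_closed_preimage continuous_on_dist closed_atMost c)
    finally show ?thesis .
  qed
  then show ?thesis unfolding radial_domain_Cauchy by (intro sets.countable_INT' sets.countable_UN') auto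
qed

lemma radial_ext_measurable:
  assumes \<phi>: "continuous_on (ball 0 1) \<phi>"
  shows "radial_ext \<phi> \<in> borel_measurable (restrict_space borel (radial_domain \<phi>))"
proof (rule borel_measurable_LIMSEQ_metric)
  show "(\<lambda>\<zeta>. \<phi> (of_real (rad n) * \<zeta>)) \<in> borel_measurable (restrict_space borel (radial_domain \<phi>))" for n
    using rad[of n] by (intro borel_measurable_continuous_on_restrict continuous_on_compose2[OF \<phi>] continuous_intros)
      (auto simp: norm_mult radial_domain_def)
qed (auto simp: space_restrict_space intro: radial_domain_tendsto_rad)

lemma boundary_value_measurable [measurable (raw)]:
  assumes \<phi>: "continuous_on (ball 0 1) \<phi>"
  shows "boundary_value \<phi> y \<in> borel_measurable borel"
proof -
  have "(\<lambda>\<zeta>. if \<zeta> \<in> radial_domain \<phi> then radial_ext \<phi> \<zeta> else y) \<in> borel_measurable borel"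
    using radial_domain_borel[OF \<phi>] radial_ext_measurable[OF \<phi>]
    by (subst measurable_If_restrict_space_iff) auto
  from measurable_compose[OF cis_measurable this] show ?thesis
    by (simp add: boundary_value_def[abs_def])
qed

text \<open>If the limit were in \<open>U\<close>, continuity of the inverse map would force the
  radius to converge to a point inside the disc, whereas it converges to
  \<open>\<zeta>\<close>.\<close>

lemma radial_ext_frontier:
  assumes \<phi>: "conformal_map (ball 0 1) U \<phi>" and \<zeta>: "\<zeta> \<in> radial_domain \<phi>"
  shows "radial_ext \<phi> \<zeta> \<in> frontier U"
proof -
  have hol: "\<phi> holomorphic_on ball 0 1" and inj: "inj_on \<phi> (ball 0 1)" and im: "\<phi> ` ball 0 1 = U"
    using \<phi> by (auto simp: conformal_map_def bij_betw_def)
  have opU: "open U" using open_mapping_thm3[OF hol open_ball inj] im by simp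
  have b: "of_real (rad n) * \<zeta> \<in> ball 0 1" for n
    using rad_circle[of \<zeta> n] \<zeta> by (simp add: radial_domain_def)
  have lim: "(\<lambda>n. \<phi> (of_real (rad n) * \<zeta>)) \<longlonglongrightarrow> radial_ext \<phi> \<zeta>" by (rule radial_domain_tendsto_rad[OF \<zeta>])
  have "radial_ext \<phi> \<zeta> \<in> closure U"
    using lim b im by (intro closed_sequentially[OF closed_closure _ lim]) (use closure_subset in blast)
  moreover have "radial_ext \<phi> \<zeta> \<notin> U"
  proof
    assume l: "radial_ext \<phi> \<zeta> \<in> U"
    obtain k where k: "k holomorphic_on \<phi> ` ball 0 1" "\<And>z. z \<in> ball 0 1 \<Longrightarrow> k (\<phi> z) = z"
      using holomorphic_has_inverse[OF hol open_ball inj] by metis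
    have "isCont k (radial_ext \<phi> \<zeta>)"
      using k(1) l opU im by (metis continuous_on_eq_continuous_at holomorphic_on_imp_continuous_on)
    then have "(\<lambda>n. k (\<phi> (of_real (rad n) * \<zeta>))) \<longlonglongrightarrow> k (radial_ext \<phi> \<zeta>)"
      using lim by (rule isCont_tendsto_compose)
    then have "(\<lambda>n. of_real (rad n) * \<zeta>) \<longlonglongrightarrow> k (radial_ext \<phi> \<zeta>)" using k(2) b by simp
    moreover have "(\<lambda>n. of_real (rad n) * \<zeta>) \<longlonglongrightarrow> \<zeta>"
      using tendsto_mult[OF tendsto_of_real[OF rad_tendsto] tendsto_const[of \<zeta>]] by simp
    ultimately have "\<zeta> = k (radial_ext \<phi> \<zeta>)" using LIMSEQ_unique by blast
    moreover have "k (radial_ext \<phi> \<zeta>) \<in> ball 0 1" using k l im by force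
    ultimately show False using \<zeta> by (simp add: radial_domain_def)
  qed
  ultimately show ?thesis using opU by (simp add: frontier_def interior_open)
qed

text \<open>The Koebe transform: a square root of \<^term>\<open>\<phi> - y\<close> omits the reflection of its own image.\<close>

lemma univalent_bounded_coordinate:
  assumes hol: "\<phi> holomorphic_on ball 0 1" and inj: "inj_on \<phi> (ball 0 1)" and y: "y \<notin> \<phi> ` ball 0 1"
  obtains \<beta> c B where "\<beta> holomorphic_on ball 0 1" "inj_on \<beta> (ball 0 1)" "\<And>z. norm z < 1 \<Longrightarrow> norm (\<beta> z) \<le> B"
    "\<And>z. norm z < 1 \<Longrightarrow> \<beta> z \<noteq> 0" "\<And>z. norm z < 1 \<Longrightarrow> \<phi> z = y + (1 / \<beta> z - c)\<^sup>2"
proof -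
  have h1: "(\<lambda>z. \<phi> z - y) holomorphic_on ball 0 1" by (intro holomorphic_intros hol)
  have h2: "contractible (ball (0::complex) 1)" by (simp add: convex_imp_contractible)
  obtain l where l: "l holomorphic_on ball 0 1" "\<And>z. z \<in> ball 0 1 \<Longrightarrow> \<phi> z - y = (l z)\<^sup>2"
  proof (rule contractible_imp_holomorphic_sqrt[OF h1 h2])
    show "\<phi> z - y \<noteq> 0" if "z \<in> ball 0 1" for z using y that by auto
  qed (rule that)
  have eq: "z = w" if "z \<in> ball 0 1" "w \<in> ball 0 1" "(l z)\<^sup>2 = (l w)\<^sup>2" for z w
  proof -
    have "\<phi> z - y = \<phi> w - y" by (simp only: l(2)[OF that(1)] l(2)[OF that(2)] that(3))
    then have "\<phi> z = \<phi> w" by simp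
    then show ?thesis using inj that by (meson inj_onD)
  qed
  have l_ne: "l z \<noteq> 0" if "z \<in> ball 0 1" for z using l(2)[OF that] y that by auto
  have "inj_on l (ball 0 1)" using eq by (auto simp: inj_on_def)
  then have "open (l ` ball 0 1)" using open_mapping_thm3[OF l(1)] by simp
  moreover have "l 0 \<in> l ` ball 0 1" by simp
  ultimately obtain \<rho> where \<rho>: "0 < \<rho>" "ball (l 0) \<rho> \<subseteq> l ` ball 0 1" by (meson openE)
  have far: "\<rho> \<le> norm (l z + l 0)" if z: "z \<in> ball 0 1" for z
  proof (rule ccontr)
    assume "\<not> \<rho> \<le> norm (l z + l 0)"
    then have "- l z \<in> ball (l 0) \<rho>" by (simp add: dist_norm add.commute)
    \<comment> \<open>A reflected value \<open>- l z = l w\<close> has the same square, so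
      \<open>z = w\<close> and \<open>l z = 0\<close>, which is excluded because
      \<open>\<phi>\<close> omits \<open>y\<close>.\<close>
    then obtain w where w: "w \<in> ball 0 1" "- l z = l w" using \<rho>(2) by blast
    then have "z = w" using eq[OF z w(1)] by (metis power2_minus)
    then have "l z = - l z" using w(2) by simp
    then have "Re (l z) = 0" "Im (l z) = 0" by (simp_all add: complex_eq_iff)
    then show False using l_ne[OF z] by (simp add: complex_eq_iff)
  qed
  have ne: "l z + l 0 \<noteq> 0" if "z \<in> ball 0 1" for z using far[OF that] \<rho>(1) by auto
  show thesis
  proof
    show "(\<lambda>z. 1 / (l z + l 0)) holomorphic_on ball 0 1" using ne by (intro holomorphic_intros l) auto
    show "inj_on (\<lambda>z. 1 / (l z + l 0)) (ball 0 1)"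
      using ne eq by (auto simp: inj_on_def)
    show "norm (1 / (l z + l 0)) \<le> 1 / \<rho>" if "norm z < 1" for z
      using far[of z] that \<rho>(1) by (simp add: norm_divide frac_le)
    show "1 / (l z + l 0) \<noteq> 0" if "norm z < 1" for z using ne[of z] that by simp
    show "\<phi> z = y + (1 / (1 / (l z + l 0)) - l 0)\<^sup>2" if "norm z < 1" for z
      using l(2)[of z] that by (simp add: algebra_simps)
  qed
qed

section \<open>Radial limits and test functions for unbounded univalent maps\<close>

text \<open>The function \<open>ln B - ln (norm (\<beta> z))\<close> is harmonic and nonnegative, so
  its circle means are constant. By Fatou's lemma its lower radial limit is finite almost
  everywhere, while a radial limit 0 of \<open>\<beta>\<close> would make it infinite. This excludes
  the boundary value infinity of the original map.\<close>

lemma nonvanishing_radial_limit: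
  assumes hol: "\<beta> holomorphic_on ball 0 1" and bound: "\<And>z. norm z < 1 \<Longrightarrow> norm (\<beta> z) \<le> B"
    and ne: "\<And>z. norm z < 1 \<Longrightarrow> \<beta> z \<noteq> 0"
  shows "AE \<theta> in angle. \<not> (\<lambda>n. \<beta> (of_real (rad n) * cis \<theta>)) \<longlonglongrightarrow> 0"
proof -
  have "contractible (ball (0::complex) 1)" by (simp add: convex_imp_contractible)
  then obtain L where L: "L holomorphic_on ball 0 1" "\<And>z. z \<in> ball 0 1 \<Longrightarrow> \<beta> z = exp (L z)"
    using contractible_imp_holomorphic_log[OF hol] ne by (metis mem_ball_0)
  have B: "0 < B" using bound[of 0] ne[of 0] by (metis norm_zero zero_less_norm_iff zero_less_one order_less_le_trans)
  define f where "f n \<theta> = ln B - Re (L (of_real (rad n) * cis \<theta>))" for n \<theta>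
  have ReL: "Re (L z) = ln (norm (\<beta> z))" if "norm z < 1" for z using L(2)[of z] that by simp
  have f0: "0 \<le> f n \<theta>" for n \<theta>
    using bound[OF rad_circle, of "cis \<theta>" n] ne[OF rad_circle, of "cis \<theta>" n] B
    by (simp add: f_def ReL rad_circle)
  have int: "integrable angle (f n)" for n
    unfolding f_def using integrable_Re[OF integrable_circle[OF L(1) rad]] by (intro Bochner_Integration.integrable_diff) auto
  have f_meas [measurable]: "f n \<in> borel_measurable angle" for n using int by (rule borel_measurable_integrable)
  have If: "(\<integral>\<theta>. f n \<theta> \<partial>angle) = ln B - Re (L 0)" for n
  proof -
    have "(\<integral>\<theta>. Re (L (of_real (rad n) * cis \<theta>)) \<partial>angle) = Re (L 0)"
      using integral_Re[OF integrable_circle[OF L(1) rad]] mean_value_angle[OF L(1) rad] by simp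
    then show ?thesis unfolding f_def
      using integrable_Re[OF integrable_circle[OF L(1) rad]] by (subst Bochner_Integration.integral_diff) auto
  qed
  have "(\<integral>\<^sup>+\<theta>. liminf (\<lambda>n. ennreal (f n \<theta>)) \<partial>angle) \<le> liminf (\<lambda>n. \<integral>\<^sup>+\<theta>. ennreal (f n \<theta>) \<partial>angle)"
    by (rule nn_integral_liminf) simp
  also have "\<dots> = ennreal (ln B - Re (L 0))"
    using If f0 by (simp add: nn_integral_eq_integral[OF int] Liminf_const)
  also have "\<dots> < \<infinity>" by simp
  finally have "AE \<theta> in angle. liminf (\<lambda>n. ennreal (f n \<theta>)) \<noteq> \<infinity>"
    by (intro nn_integral_PInf_AE) auto
  then show ?thesis
  proof eventually_elim
    case (elim \<theta>)
    show ?case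
    proof
      assume "(\<lambda>n. \<beta> (of_real (rad n) * cis \<theta>)) \<longlonglongrightarrow> 0"
      then have "(\<lambda>n. norm (\<beta> (of_real (rad n) * cis \<theta>))) \<longlonglongrightarrow> 0" by (rule tendsto_norm_zero)
      then have "filterlim (\<lambda>n. norm (\<beta> (of_real (rad n) * cis \<theta>))) (at_right 0) sequentially"
        using ne[OF rad_circle] by (auto simp: filterlim_at intro!: always_eventually)
      then have "filterlim (\<lambda>n. Re (L (of_real (rad n) * cis \<theta>))) at_bot sequentially"
        using filterlim_compose[OF ln_at_0] by (simp add: ReL rad_circle)
      then have "filterlim (\<lambda>n. ln B + - Re (L (of_real (rad n) * cis \<theta>))) at_top sequentially"
        unfolding filterlim_uminus_at_bot by (rule filterlim_tendsto_add_at_top[OF tendsto_const])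
      then have "filterlim (\<lambda>n. f n \<theta>) at_top sequentially" by (simp add: f_def)
      then have "(\<lambda>n. ennreal (f n \<theta>)) \<longlonglongrightarrow> \<infinity>"
        by (simp add: ennreal_tendsto_top_eq_at_top)
      then show False using elim lim_imp_Liminf[of sequentially] by (metis trivial_limit_sequentially)
    qed
  qed
qed

text \<open>Continuous approximations of the indicator. For \<open>S = UNIV\<close> they would all
  vanish, because \<open>infdist\<close> to the empty set is 0.\<close>

lemma infdist_indicator_open:
  fixes S :: "'a :: metric_space set"
  assumes "open S" "- S \<noteq> {}"
  shows "(\<lambda>n. min 1 (real n * infdist z (- S))) \<longlonglongrightarrow> indicator S z"
proof (cases "z \<in> S")
  case True
  then have pos: "0 < infdist z (- S)"
    using assms by (metis ComplD closed_Compl in_closed_iff_infdist_zero infdist_nonneg order_less_le)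
  have "\<forall>\<^sub>F n in sequentially. 1 / infdist z (- S) \<le> real n"
    using filterlim_real_sequentially by (rule filterlim_at_top[THEN iffD1, rule_format])
  then have "\<forall>\<^sub>F n in sequentially. min 1 (real n * infdist z (- S)) = indicator S z"
    by eventually_elim (use True pos in \<open>simp add: min_def field_simps\<close>)
  then show ?thesis by (rule tendsto_eventually)
next
  case False
  then have "infdist z (- S) = 0" by (simp add: infdist_zero)
  then show ?thesis using False by simp
qed

text \<open>The point \<open>u = 0\<close> corresponds to infinity in the original coordinate, where
  \<open>b\<close> vanishes; bounded support is what makes the transported test function continuous
  there.\<close>

lemma Koebe_coordinate_continuous:
  fixes b :: "complex \<Rightarrow> real"
  assumes b: "continuous_on UNIV b" and supp: "\<And>z. R < norm z \<Longrightarrow> b z = 0"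
  shows "continuous_on UNIV (\<lambda>u. if u = 0 then 0 else b (y + (1 / u - c)\<^sup>2))" (is "continuous_on UNIV ?b")
proof -
  have "isCont ?b u" for u
  proof (cases "u = 0")
    case False
    have "continuous_on (- {0}) (\<lambda>u. b (y + (1 / u - c)\<^sup>2))"
      by (intro continuous_on_compose2[OF b] continuous_intros) auto
    then have "continuous_on (- {0}) ?b"
      by (rule continuous_on_cong[THEN iffD1, OF refl, rotated]) auto
    then show ?thesis using False by (simp add: continuous_on_eq_continuous_at open_Compl)
  next
    case True
    have "filterlim (\<lambda>u. - c + inverse u) at_infinity (at 0)"
      by (intro tendsto_add_filterlim_at_infinity[OF tendsto_const] filterlim_inverse_at_infinity)
    then have "filterlim (\<lambda>u. y + (- c + inverse u)\<^sup>2) at_infinity (at 0)"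
      unfolding power2_eq_square
      by (intro tendsto_add_filterlim_at_infinity[OF tendsto_const] filterlim_at_infinity_times filterlim_inverse_at_infinity)
    then have "\<forall>\<^sub>F u in at 0. R < norm (y + (- c + inverse u)\<^sup>2)"
      unfolding filterlim_at_infinity_conv_norm_at_top filterlim_at_top_dense by blast
    then have "\<forall>\<^sub>F u in at 0. R < norm (y + (1 / u - c)\<^sup>2)"
      by eventually_elim (simp add: inverse_eq_divide)
    then have "\<forall>\<^sub>F u in at 0. ?b u = 0"
      by eventually_elim (use supp in auto)
    then show ?thesis using True by (simp add: isCont_def tendsto_eventually)
  qed
  then show ?thesis by (simp add: continuous_at_imp_continuous_on)
qed

text \<open>The bounded coordinate \<open>\<beta>\<close> has radial limits almost everywhere, and
  almost all of them are nonzero, so the formula expressing \<open>\<phi>\<close> by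
  \<open>1 / \<beta>\<close> passes to finite limits.\<close>

lemma AE_radial_domain:
  assumes hol: "\<phi> holomorphic_on ball 0 1" and inj: "inj_on \<phi> (ball 0 1)" and y: "y \<notin> \<phi> ` ball 0 1"
  obtains \<beta> c B \<beta>s where "radial_limit \<beta> \<beta>s B" 
    "\<And>z. norm z < 1 \<Longrightarrow> \<beta> z \<noteq> 0" "\<And>z. norm z < 1 \<Longrightarrow> \<phi> z = y + (1 / \<beta> z - c)\<^sup>2"
    "AE \<theta> in angle. cis \<theta> \<in> radial_domain \<phi> \<and> \<beta>s \<theta> \<noteq> 0 \<and> radial_ext \<phi> (cis \<theta>) = y + (1 / \<beta>s \<theta> - c)\<^sup>2"
proof -
  obtain \<beta> c B where \<beta>: "\<beta> holomorphic_on ball 0 1" "inj_on \<beta> (ball 0 1)"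
    and B: "\<And>z. norm z < 1 \<Longrightarrow> norm (\<beta> z) \<le> B"
    and ne: "\<And>z. norm z < 1 \<Longrightarrow> \<beta> z \<noteq> 0" and eq: "\<And>z. norm z < 1 \<Longrightarrow> \<phi> z = y + (1 / \<beta> z - c)\<^sup>2"
    using univalent_bounded_coordinate[OF assms] by metis
  define \<beta>s where "\<beta>s = boundary_value \<beta> 0"
  have c\<beta>: "continuous_on (ball 0 1) \<beta>" using \<beta>(1) by (rule holomorphic_on_imp_continuous_on)
  have lim1: "AE \<theta> in angle. \<exists>l. ((\<lambda>t. \<beta> (of_real t * cis \<theta>)) \<longlongrightarrow> l) (at_left 1)"
    by (rule bounded_univalent_radial_limit[OF \<beta> B])
  then have dom: "AE \<theta> in angle. cis \<theta> \<in> radial_domain \<beta>"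
    by eventually_elim (simp add: radial_domain_def)
  show thesis
  proof
    show "radial_limit \<beta> \<beta>s B"
    proof
      show "\<beta>s \<in> borel_measurable borel" unfolding \<beta>s_def by (rule boundary_value_measurable[OF c\<beta>])
      show "norm (\<beta>s \<theta>) \<le> B" for \<theta>
      proof (cases "cis \<theta> \<in> radial_domain \<beta>")
        case True
        then have "(\<lambda>n. norm (\<beta> (of_real (rad n) * cis \<theta>))) \<longlonglongrightarrow> norm (\<beta>s \<theta>)"
          unfolding \<beta>s_def boundary_value_def by (auto intro!: tendsto_norm radial_domain_tendsto_rad)
        then show ?thesis by (rule LIMSEQ_le_const2) (auto intro!: B rad_circle)
      next
        case False
        then show ?thesis using order_trans[OF norm_ge_zero B[of 0]] by (simp add: \<beta>s_def boundary_value_def)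
      qed
      show "AE \<theta> in angle. (\<lambda>n. \<beta> (of_real (rad n) * cis \<theta>)) \<longlonglongrightarrow> \<beta>s \<theta>"
        using dom by eventually_elim (simp add: \<beta>s_def boundary_value_def radial_domain_tendsto_rad)
    qed (use \<beta> B in auto)
    have "AE \<theta> in angle. \<not> (\<lambda>n. \<beta> (of_real (rad n) * cis \<theta>)) \<longlonglongrightarrow> 0"
      by (rule nonvanishing_radial_limit[OF \<beta>(1) B ne])
    then show "AE \<theta> in angle. cis \<theta> \<in> radial_domain \<phi> \<and> \<beta>s \<theta> \<noteq> 0 \<and> radial_ext \<phi> (cis \<theta>) = y + (1 / \<beta>s \<theta> - c)\<^sup>2"
      using dom
    proof eventually_elim
      case (elim \<theta>)
      have \<beta>s: "\<beta>s \<theta> = radial_ext \<beta> (cis \<theta>)" using elim by (simp add: \<beta>s_def boundary_value_def)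
      then have 0: "\<beta>s \<theta> \<noteq> 0" using elim radial_domain_tendsto_rad by metis
      have "((\<lambda>t. y + (1 / \<beta> (of_real t * cis \<theta>) - c)\<^sup>2) \<longlongrightarrow> y + (1 / \<beta>s \<theta> - c)\<^sup>2) (at_left 1)"
        using radial_domain_tendsto[OF elim(2)] 0 unfolding \<beta>s by (intro tendsto_intros)
      moreover have "\<forall>\<^sub>F t in at_left (1::real). y + (1 / \<beta> (of_real t * cis \<theta>) - c)\<^sup>2 = \<phi> (of_real t * cis \<theta>)"
        by (rule eventually_at_leftI[of 0]) (auto simp: eq norm_mult)
      ultimately have "((\<lambda>t. \<phi> (of_real t * cis \<theta>)) \<longlongrightarrow> y + (1 / \<beta>s \<theta> - c)\<^sup>2) (at_left 1)"
        by (rule Lim_transform_eventually)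
      then show ?case using 0 radial_ext_eqI by (auto simp: radial_domain_def)
    qed
  qed (use ne eq in auto)
qed

section \<open>Images of harmonic measure\<close>

text \<open>Instantiated later with all pairs of iterates \<open>f ^^ k\<close> and
  \<open>g ^^ k\<close>. That \<open>T\<close> keeps boundary points out of \<open>U\<close> is what
  makes \<open>g\<close> inner.\<close>

locale semiconjugacy =
  fixes U :: "complex set" and \<phi> g T :: "complex \<Rightarrow> complex" and y :: complex
  assumes \<phi>: "conformal_map (ball 0 1) U \<phi>" and y: "y \<in> frontier U"
    and g: "g holomorphic_on ball 0 1" "g ` ball 0 1 \<subseteq> ball 0 1"
    and T: "continuous_on UNIV T" "\<And>x. x \<in> frontier U \<Longrightarrow> T x \<notin> U"
    and conj: "\<And>z. norm z < 1 \<Longrightarrow> T (\<phi> z) = \<phi> (g z)"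
begin

abbreviation "bv \<equiv> boundary_value \<phi> y"

lemma \<phi>_holomorphic: "\<phi> holomorphic_on ball 0 1" and \<phi>_inj: "inj_on \<phi> (ball 0 1)" and \<phi>_image: "\<phi> ` ball 0 1 = U"
  using \<phi> by (auto simp: conformal_map_def bij_betw_def)

lemma \<phi>_continuous: "continuous_on (ball 0 1) \<phi>"
  using \<phi>_holomorphic by (rule holomorphic_on_imp_continuous_on)

lemma y_notin: "y \<notin> \<phi> ` ball 0 1"
proof -
  have "open U" using open_mapping_thm3[OF \<phi>_holomorphic open_ball \<phi>_inj] \<phi>_image by simp
  then show ?thesis using y \<phi>_image by (simp add: frontier_def interior_open)
qed

lemma bv_frontier: "bv \<theta> \<in> frontier U"
  using radial_ext_frontier[OF \<phi>] y by (simp add: boundary_value_def)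

lemma bv_measurable [measurable]: "bv \<in> borel_measurable borel"
  by (rule boundary_value_measurable[OF \<phi>_continuous])

lemma T_measurable [measurable]: "T \<in> borel_measurable borel"
  using T(1) by (rule borel_measurable_continuous_onI)

lemma g_norm: "norm z < 1 \<Longrightarrow> norm (g z) < 1"
  using g(2) by (auto simp: image_subset_iff)

lemma T_tendsto:
  assumes "cis \<theta> \<in> radial_domain \<phi>"
  shows "(\<lambda>n. \<phi> (g (of_real (rad n) * cis \<theta>))) \<longlonglongrightarrow> T (bv \<theta>)"
proof -
  have "isCont T (bv \<theta>)" using T(1) by (simp add: continuous_on_eq_continuous_at)
  moreover have "(\<lambda>n. \<phi> (of_real (rad n) * cis \<theta>)) \<longlonglongrightarrow> bv \<theta>"
    using radial_domain_tendsto_rad[OF assms] assms by (simp add: boundary_value_def)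
  ultimately have "(\<lambda>n. T (\<phi> (of_real (rad n) * cis \<theta>))) \<longlonglongrightarrow> T (bv \<theta>)" by (rule isCont_tendsto_compose)
  then show ?thesis by (simp add: conj rad_circle)
qed

lemma g_inner:
  assumes "cis \<theta> \<in> radial_domain \<phi>"
  shows "(\<lambda>n. norm (g (of_real (rad n) * cis \<theta>))) \<longlonglongrightarrow> 1"
proof (rule order_tendstoI)
  fix a :: real assume a: "a < 1"
  have "compact (\<phi> ` cball 0 a)"
    using a by (intro compact_continuous_image continuous_on_subset[OF \<phi>_continuous]) auto
  then have "open (- (\<phi> ` cball 0 a))" by (simp add: compact_imp_closed open_Compl)
  moreover have "T (bv \<theta>) \<in> - (\<phi> ` cball 0 a)"
    using T(2)[OF bv_frontier[of \<theta>]] \<phi>_image a by auto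
  ultimately have "\<forall>\<^sub>F n in sequentially. \<phi> (g (of_real (rad n) * cis \<theta>)) \<in> - (\<phi> ` cball 0 a)"
    using T_tendsto[OF assms] by (rule topological_tendstoD[rotated 1])
  then show "\<forall>\<^sub>F n in sequentially. a < norm (g (of_real (rad n) * cis \<theta>))"
    by eventually_elim force
next
  fix a :: real assume "1 < a"
  then show "\<forall>\<^sub>F n in sequentially. norm (g (of_real (rad n) * cis \<theta>)) < a"
    using g_norm[OF rad_circle] by (intro always_eventually allI) (metis less_trans norm_cis order_refl)
qed

lemma AE_in_radial_domain: "AE \<theta> in angle. cis \<theta> \<in> radial_domain \<phi>"
proof -
  obtain \<beta> c B \<beta>s where "radial_limit \<beta> \<beta>s B"
    "\<And>z. norm z < 1 \<Longrightarrow> \<beta> z \<noteq> 0" "\<And>z. norm z < 1 \<Longrightarrow> \<phi> z = y + (1 / \<beta> z - c)\<^sup>2"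
    and "AE \<theta> in angle. cis \<theta> \<in> radial_domain \<phi> \<and> \<beta>s \<theta> \<noteq> 0 \<and> radial_ext \<phi> (cis \<theta>) = y + (1 / \<beta>s \<theta> - c)\<^sup>2"
    by (rule AE_radial_domain[OF \<phi>_holomorphic \<phi>_inj y_notin]) (rule that)
  then show ?thesis by (auto elim: eventually_mono)
qed

text \<open>The integrals of \<open>b (\<phi> (g (rad n * cis \<theta>)))\<close> have two limits:
  one by continuity of \<open>T\<close> along the radius, the other from
  \<open>inner_composition_limit\<close> in the bounded coordinate. Equating them gives the
  formula.\<close>

lemma integral_T_bv:
  fixes b :: "complex \<Rightarrow> real"
  assumes b: "continuous_on UNIV b" and supp: "\<And>z. R < norm z \<Longrightarrow> b z = 0" and bM: "\<And>z. norm (b z) \<le> M"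
  shows "(\<integral>\<theta>. b (T (bv \<theta>)) \<partial>angle) = (\<integral>\<theta>. poisson (g 0) (cis \<theta>) * b (bv \<theta>) \<partial>angle)"
proof -
  obtain \<beta> c B \<beta>s where rl: "radial_limit \<beta> \<beta>s B" 
    and ne: "\<And>z. norm z < 1 \<Longrightarrow> \<beta> z \<noteq> 0" and eq: "\<And>z. norm z < 1 \<Longrightarrow> \<phi> z = y + (1 / \<beta> z - c)\<^sup>2"
    and ae: "AE \<theta> in angle. cis \<theta> \<in> radial_domain \<phi> \<and> \<beta>s \<theta> \<noteq> 0 \<and> radial_ext \<phi> (cis \<theta>) = y + (1 / \<beta>s \<theta> - c)\<^sup>2"
    by (rule AE_radial_domain[OF \<phi>_holomorphic \<phi>_inj y_notin]) (rule that)
  interpret radial_limit \<beta> \<beta>s B by (fact rl)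
  have b_meas [measurable]: "b \<in> borel_measurable borel" using b by (rule borel_measurable_continuous_onI)
  define b' where "b' u = (if u = 0 then 0 else b (y + (1 / u - c)\<^sup>2))" for u
  have b'_cont: "continuous_on UNIV b'"
    unfolding b'_def[abs_def] by (rule Koebe_coordinate_continuous[OF b supp])
  have b'_meas [measurable]: "b' \<in> borel_measurable borel" using b'_cont by (rule borel_measurable_continuous_onI)
  have inner: "AE \<theta> in angle. (\<lambda>n. norm (g (of_real (rad n) * cis \<theta>))) \<longlonglongrightarrow> 1"
    using AE_in_radial_domain by eventually_elim (rule g_inner)
  have b\<phi>: "b' (\<beta> z) = b (\<phi> z)" if "norm z < 1" for z
    using ne[OF that] eq[OF that] by (simp add: b'_def)
  have "(\<lambda>n. \<integral>\<theta>. b' (\<beta> (g (of_real (rad n) * cis \<theta>))) \<partial>angle)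
           \<longlonglongrightarrow> (\<integral>\<theta>. poisson (g 0) (cis \<theta>) * b' (\<beta>s \<theta>) \<partial>angle)"
    by (rule inner_composition_limit[OF b'_cont g inner])
  also have "(\<integral>\<theta>. poisson (g 0) (cis \<theta>) * b' (\<beta>s \<theta>) \<partial>angle) = (\<integral>\<theta>. poisson (g 0) (cis \<theta>) * b (bv \<theta>) \<partial>angle)"
    by (intro integral_cong_AE, measurable)
      (use ae in \<open>eventually_elim, auto simp: b'_def boundary_value_def\<close>)
  also have "(\<lambda>n. \<integral>\<theta>. b' (\<beta> (g (of_real (rad n) * cis \<theta>))) \<partial>angle) = (\<lambda>n. \<integral>\<theta>. b (\<phi> (g (of_real (rad n) * cis \<theta>))) \<partial>angle)"
    using b\<phi>[OF g_norm[OF rad_circle]] by simp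
  finally have 1: "(\<lambda>n. \<integral>\<theta>. b (\<phi> (g (of_real (rad n) * cis \<theta>))) \<partial>angle) \<longlonglongrightarrow> (\<integral>\<theta>. poisson (g 0) (cis \<theta>) * b (bv \<theta>) \<partial>angle)" .
  have "(\<lambda>n. \<integral>\<theta>. b (\<phi> (g (of_real (rad n) * cis \<theta>))) \<partial>angle) \<longlonglongrightarrow> (\<integral>\<theta>. b (T (bv \<theta>)) \<partial>angle)"
  proof (rule integral_dominated_convergence[where w = "\<lambda>_. M"])
    show "AE \<theta> in angle. (\<lambda>n. b (\<phi> (g (of_real (rad n) * cis \<theta>)))) \<longlonglongrightarrow> b (T (bv \<theta>))"
      using AE_in_radial_domain
    proof eventually_elim
      case (elim \<theta>)
      have "isCont b (T (bv \<theta>))" using b by (simp add: continuous_on_eq_continuous_at)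
      then show ?case using T_tendsto[OF elim] by (rule isCont_tendsto_compose)
    qed
    show "(\<lambda>\<theta>. b (\<phi> (g (of_real (rad n) * cis \<theta>)))) \<in> borel_measurable angle" for n
    proof -
      have "continuous_on UNIV (\<lambda>\<theta>. \<phi> (g (of_real (rad n) * cis \<theta>)))"
        by (rule continuous_on_compose2[OF \<phi>_continuous continuous_on_circle[OF g(1) rad]])
          (use g_norm[OF rad_circle] in auto)
      then have [measurable]: "(\<lambda>\<theta>. \<phi> (g (of_real (rad n) * cis \<theta>))) \<in> borel_measurable borel"
        by (rule borel_measurable_continuous_onI)
      show ?thesis by measurable
    qed
  qed (use bM in auto)
  with 1 show ?thesis using LIMSEQ_unique by blast
qed

text \<open>Loewner's lemma for measures: the right-hand side is harmonic measure seen from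
  \<open>\<phi> (g 0)\<close>. Open boxes generate the Borel sets and are stable under intersection,
  and their indicators are limits of continuous functions with bounded support.\<close>

lemma distr_T_bv:
  "distr angle borel (\<lambda>\<theta>. T (bv \<theta>)) = distr (density angle (\<lambda>\<theta>. ennreal (poisson (g 0) (cis \<theta>)))) borel bv"
    (is "?N1 = ?N2")
proof -
  have g0: "norm (g 0) < 1" using g_norm[of 0] by simp
  have eq: "emeasure ?N1 (box a d) = emeasure ?N2 (box a d)" for a d :: complex
  proof -
    let ?S = "box a d"
    have ne: "- ?S \<noteq> {}" using not_bounded_UNIV[where 'a = complex] bounded_box[of a d] by (metis Compl_empty_eq double_compl)
    define b where "b n z = min 1 (real n * infdist z (- ?S))" for n :: nat and z
    have b01: "0 \<le> b n z" "b n z \<le> 1" for n z by (auto simp: b_def infdist_nonneg)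
    have b_meas [measurable]: "b n \<in> borel_measurable borel" for n
      unfolding b_def[abs_def] by (intro borel_measurable_continuous_onI continuous_intros)
    obtain R where R: "\<And>z. z \<in> ?S \<Longrightarrow> norm z \<le> R" using bounded_box[of a d] by (auto simp: bounded_iff)
    have supp: "b n z = 0" if "R < norm z" for n z
    proof -
      have "z \<in> - ?S" using R[of z] that by force
      then have "infdist z (- ?S) = 0" by (rule infdist_zero)
      then show ?thesis by (simp add: b_def)
    qed
    have eqb: "(\<integral>\<theta>. b n (T (bv \<theta>)) \<partial>angle) = (\<integral>\<theta>. poisson (g 0) (cis \<theta>) * b n (bv \<theta>) \<partial>angle)" for n
    proof (rule integral_T_bv)
      show "continuous_on UNIV (b n)" unfolding b_def[abs_def] by (intro continuous_intros)
      show "b n z = 0" if "R < norm z" for z using supp that by blast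
      show "norm (b n z) \<le> 1" for z using b01 by simp
    qed
    have lim: "(\<lambda>n. b n z) \<longlonglongrightarrow> indicator ?S z" for z
      unfolding b_def by (rule infdist_indicator_open[OF open_box ne])
    have intP: "integrable angle (\<lambda>\<theta>. poisson (g 0) (cis \<theta>))"
      using integrable_poisson[OF _ _ g0, of "\<lambda>\<theta>. 1::real" 1] by simp
    have "(\<lambda>n. \<integral>\<theta>. b n (T (bv \<theta>)) \<partial>angle) \<longlonglongrightarrow> (\<integral>\<theta>. indicator ?S (T (bv \<theta>)) \<partial>angle)"
      using b01 by (intro integral_dominated_convergence[where w = "\<lambda>_. 1"]) (auto intro: lim)
    moreover have "(\<lambda>n. \<integral>\<theta>. poisson (g 0) (cis \<theta>) * b n (bv \<theta>) \<partial>angle) \<longlonglongrightarrow> (\<integral>\<theta>. poisson (g 0) (cis \<theta>) * indicator ?S (bv \<theta>) \<partial>angle)"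
      using b01 intP poisson_nonneg[OF g0]
      by (intro integral_dominated_convergence[where w = "\<lambda>\<theta>. poisson (g 0) (cis \<theta>)"])
        (auto intro!: tendsto_mult lim AE_I2 mult_left_le simp: abs_mult)
    ultimately have 1: "(\<integral>\<theta>. indicator ?S (T (bv \<theta>)) \<partial>angle) = (\<integral>\<theta>. poisson (g 0) (cis \<theta>) * indicator ?S (bv \<theta>) \<partial>angle)"
      unfolding eqb using LIMSEQ_unique by blast
    have "emeasure ?N1 ?S = (\<integral>\<^sup>+\<theta>. indicator ?S (T (bv \<theta>)) \<partial>angle)"
    proof -
      have "emeasure ?N1 ?S = emeasure angle {\<theta>. T (bv \<theta>) \<in> ?S}"
        by (subst emeasure_distr) (auto simp: vimage_def)
      also have "\<dots> = (\<integral>\<^sup>+\<theta>. indicator {\<theta>. T (bv \<theta>) \<in> ?S} \<theta> \<partial>angle)"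
        by (rule nn_integral_indicator[symmetric]) simp
      finally show ?thesis by (simp add: indicator_def)
    qed
    also have "\<dots> = ennreal (\<integral>\<theta>. indicator ?S (T (bv \<theta>)) \<partial>angle)"
      by (subst nn_integral_eq_integral[symmetric])
        (auto intro!: integrable_angle_bounded[of _ 1] simp: ennreal_indicator)
    also have "\<dots> = (\<integral>\<^sup>+\<theta>. ennreal (poisson (g 0) (cis \<theta>) * indicator ?S (bv \<theta>)) \<partial>angle)"
      unfolding 1 using poisson_nonneg[OF g0] integrable_poisson[OF _ _ g0, of "\<lambda>\<theta>. indicator ?S (bv \<theta>) :: real" 1]
      by (subst nn_integral_eq_integral[symmetric]) auto
    also have "\<dots> = (\<integral>\<^sup>+\<theta>. ennreal (poisson (g 0) (cis \<theta>)) * indicator (bv -` ?S) \<theta> \<partial>angle)"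
      by (intro nn_integral_cong) (simp add: indicator_def)
    also have "\<dots> = emeasure (density angle (\<lambda>\<theta>. ennreal (poisson (g 0) (cis \<theta>)))) (bv -` ?S)"
      using measurable_sets[OF bv_measurable, of ?S] by (intro emeasure_density[symmetric]) simp_all
    also have "\<dots> = emeasure ?N2 ?S"
      by (subst emeasure_distr) simp_all
    finally show ?thesis .
  qed
  show ?thesis
  proof (rule measure_eqI_generator_eq)
    let ?E = "range (\<lambda>(a, b). box a b :: complex set)"
    show "Int_stable ?E" by (auto simp: Int_stable_def box_Int_box)
    show "?E \<subseteq> Pow UNIV" by simp
    show "emeasure ?N1 X = emeasure ?N2 X" if "X \<in> ?E" for X using that eq by auto
    show "sets ?N1 = sigma_sets UNIV ?E" "sets ?N2 = sigma_sets UNIV ?E"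
      by (simp_all add: borel_eq_box sets_measure_of)
    let ?A = "\<lambda>n::nat. box (- (real n *\<^sub>R One)) (real n *\<^sub>R One) :: complex set"
    show "range ?A \<subseteq> ?E" "(\<Union>i. ?A i) = UNIV"
      unfolding UN_box_eq_UNIV by auto
    show "emeasure ?N1 (?A i) \<noteq> \<infinity>" for i
      by (subst emeasure_distr) auto
  qed
qed

lemma harmonic_measure_Harnack:
  assumes S: "S \<in> sets borel"
  shows "ennreal ((1 - norm (g 0)) / (1 + norm (g 0))) * emeasure angle {\<theta>. bv \<theta> \<in> S}
     \<le> emeasure angle {\<theta>. T (bv \<theta>) \<in> S}"
proof -
  let ?e = "(1 - norm (g 0)) / (1 + norm (g 0))"
  have g0: "norm (g 0) < 1" using g_norm[of 0] by simp
  have [measurable]: "S \<in> sets borel" by fact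
  have "ennreal ?e * emeasure angle {\<theta>. bv \<theta> \<in> S} = (\<integral>\<^sup>+\<theta>. ennreal ?e * indicator {\<theta>. bv \<theta> \<in> S} \<theta> \<partial>angle)"
    by (subst nn_integral_cmult_indicator) auto
  also have "\<dots> \<le> (\<integral>\<^sup>+\<theta>. ennreal (poisson (g 0) (cis \<theta>)) * indicator {\<theta>. bv \<theta> \<in> S} \<theta> \<partial>angle)"
    using Harnack_lower[OF _ g0] by (intro nn_integral_mono mult_right_mono ennreal_leI) auto
  also have "\<dots> = emeasure (density angle (\<lambda>\<theta>. ennreal (poisson (g 0) (cis \<theta>)))) {\<theta>. bv \<theta> \<in> S}"
    by (subst emeasure_density) auto
  also have "\<dots> = emeasure (distr (density angle (\<lambda>\<theta>. ennreal (poisson (g 0) (cis \<theta>)))) borel bv) S"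
    by (subst emeasure_distr) (auto simp: vimage_def)
  also have "\<dots> = emeasure (distr angle borel (\<lambda>\<theta>. T (bv \<theta>))) S"
    by (simp add: distr_T_bv)
  also have "\<dots> = emeasure angle {\<theta>. T (bv \<theta>) \<in> S}"
    by (subst emeasure_distr) (auto simp: vimage_def)
  finally show ?thesis .
qed

lemma omega_eq:
  assumes S: "S \<in> sets borel" "S \<subseteq> frontier U"
  shows "emeasure (omega U \<phi>) S = emeasure angle {\<theta>. bv \<theta> \<in> S}"
proof -
  have [measurable]: "S \<in> sets borel" by fact
  have rd: "radial_domain \<phi> \<in> sets borel" by (rule radial_domain_borel[OF \<phi>_continuous])
  have sets_c: "sets circle_measure = sets borel" by (simp add: circle_measure_def)
  have m: "radial_ext \<phi> \<in> measurable (restrict_space circle_measure (radial_domain \<phi>)) (restrict_space borel (frontier U))"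
  proof (rule measurable_restrict_space2)
    show "radial_ext \<phi> \<in> space (restrict_space circle_measure (radial_domain \<phi>)) \<rightarrow> frontier U"
      using radial_ext_frontier[OF \<phi>] by (auto simp: space_restrict_space)
    show "radial_ext \<phi> \<in> borel_measurable (restrict_space circle_measure (radial_domain \<phi>))"
      using radial_ext_measurable[OF \<phi>_continuous]
      by (simp add: measurable_cong_sets[OF sets_restrict_space_cong[OF sets_c] refl])
  qed
  have "{\<theta>. bv \<theta> \<in> S} \<in> sets borel" by simp
  have "emeasure (omega U \<phi>) S = emeasure (restrict_space circle_measure (radial_domain \<phi>))
      (radial_ext \<phi> -` S \<inter> space (restrict_space circle_measure (radial_domain \<phi>)))"
    unfolding omega_def using S by (intro emeasure_distr m) (auto simp: sets_restrict_space)
  also have "\<dots> = emeasure circle_measure (radial_ext \<phi> -` S \<inter> space (restrict_space circle_measure (radial_domain \<phi>)))"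
    using rd sets_c by (intro emeasure_restrict_space) (auto simp: space_restrict_space)
  also have "space (restrict_space circle_measure (radial_domain \<phi>)) = radial_domain \<phi>"
    by (simp add: space_restrict_space circle_measure_def)
  also have "emeasure circle_measure (radial_ext \<phi> -` S \<inter> radial_domain \<phi>)
      = emeasure angle (cis -` (radial_ext \<phi> -` S \<inter> radial_domain \<phi>))"
  proof -
    have "radial_ext \<phi> -` S \<inter> radial_domain \<phi> \<in> sets borel"
      using measurable_sets[OF radial_ext_measurable[OF \<phi>_continuous] S(1)] rd
      by (auto simp: space_restrict_space sets_restrict_space_iff)
    then show ?thesis unfolding circle_measure_def angle_def by (subst emeasure_distr) auto
  qed
  also have "\<dots> = emeasure angle {\<theta>. bv \<theta> \<in> S}"
  proof (rule emeasure_eq_AE)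
    show "AE \<theta> in angle. (\<theta> \<in> cis -` (radial_ext \<phi> -` S \<inter> radial_domain \<phi>)) = (\<theta> \<in> {\<theta>. bv \<theta> \<in> S})"
      using AE_in_radial_domain by eventually_elim (auto simp: boundary_value_def)
    have "radial_ext \<phi> -` S \<inter> radial_domain \<phi> \<in> sets borel"
      using measurable_sets[OF radial_ext_measurable[OF \<phi>_continuous] S(1)] rd
      by (auto simp: space_restrict_space sets_restrict_space_iff)
    from measurable_sets[OF cis_measurable this] 
    show "cis -` (radial_ext \<phi> -` S \<inter> radial_domain \<phi>) \<in> sets angle" by simp
    show "{\<theta>. bv \<theta> \<in> S} \<in> sets angle" by simp
  qed
  finally show ?thesis .
qed

lemma omega_Harnack:
  assumes S: "S \<in> sets borel" "S \<subseteq> frontier U"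
  shows "ennreal ((1 - norm (g 0)) / (1 + norm (g 0))) * emeasure (omega U \<phi>) S
     \<le> emeasure (omega U \<phi>) {x \<in> frontier U. T x \<in> S}"
proof -
  have "closed (frontier U)" by simp
  then have "{x \<in> frontier U. T x \<in> S} \<in> sets borel"
    using measurable_sets[OF T_measurable S(1)] by (auto simp: Collect_conj_eq vimage_def intro!: sets.Int)
  then have "emeasure (omega U \<phi>) {x \<in> frontier U. T x \<in> S} = emeasure angle {\<theta>. bv \<theta> \<in> {x \<in> frontier U. T x \<in> S}}"
    by (intro omega_eq) auto
  also have "{\<theta>. bv \<theta> \<in> {x \<in> frontier U. T x \<in> S}} = {\<theta>. T (bv \<theta>) \<in> S}" using bv_frontier by auto
  finally show ?thesis using harmonic_measure_Harnack[OF S(1)] omega_eq[OF S] by simp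
qed

end

section \<open>Frequency of visits\<close>

text \<open>Abstract form of the boundary dynamics: \<open>\<mu>\<close> is invariant and may be
  infinite, \<open>\<nu>\<close> is finite but only quasi-invariant from below with constants
  \<open>\<epsilon> k\<close>. The quantitative growth of their sums, beyond mere divergence, is
  what yields a rate.\<close>

locale swept_system =
  fixes \<mu> \<nu> :: "'a measure" and T :: "'a \<Rightarrow> 'a" and \<epsilon> :: "nat \<Rightarrow> real" and A :: "'a set" and \<delta> c :: real
  assumes T [measurable]: "T \<in> measurable \<mu> \<mu>"
    and inv: "\<And>S. S \<in> sets \<mu> \<Longrightarrow> emeasure \<mu> (T -` S \<inter> space \<mu>) = emeasure \<mu> S"
    and sets_\<nu> [measurable_cong]: "sets \<nu> = sets \<mu>"
    and fin: "emeasure \<nu> (space \<nu>) \<le> 1"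
    and sweep: "\<And>S k. S \<in> sets \<mu> \<Longrightarrow> ennreal (\<epsilon> k) * emeasure \<nu> S \<le> emeasure \<nu> ((T ^^ k) -` S \<inter> space \<mu>)"
    and A [measurable]: "A \<in> sets \<mu>"
    and \<delta>: "0 < \<delta>" "\<And>S. \<lbrakk>S \<in> sets \<mu>; S \<subseteq> A\<rbrakk> \<Longrightarrow> ennreal \<delta> * emeasure \<mu> S \<le> emeasure \<nu> S"
    and \<epsilon>: "\<And>k. 0 \<le> \<epsilon> k" "0 < c" "\<And>n. c * sqrt (real n) \<le> (\<Sum>k\<le>n. \<epsilon> k)"
begin

definition visits :: "nat set \<Rightarrow> 'a \<Rightarrow> real" where
  "visits I y = (\<Sum>j\<in>I. indicator A ((T ^^ j) y))"

lemma space_\<nu>: "space \<nu> = space \<mu>" using sets_\<nu> by (rule sets_eq_imp_space_eq)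

lemma T_power [measurable]: "(T ^^ k) \<in> measurable \<mu> \<mu>"
proof (induction k)
  case (Suc k)
  then show ?case unfolding funpow.simps by (rule measurable_comp) (rule T)
qed simp

lemma visits_measurable [measurable]: "visits I \<in> borel_measurable \<mu>"
  unfolding visits_def by measurable

lemma visits_card: "finite I \<Longrightarrow> visits I y = real (card {j\<in>I. (T ^^ j) y \<in> A})"
  unfolding visits_def by (simp add: indicator_def sum.If_cases Int_def)

lemma visits_nonneg: "0 \<le> visits I y"
  unfolding visits_def by (intro sum_nonneg) auto

lemma emeasure_A_finite: "emeasure \<mu> A < \<infinity>"
proof -
  have "ennreal \<delta> * emeasure \<mu> A \<le> 1"
    using \<delta>(2)[OF A order_refl] fin emeasure_space[of \<nu> A] by (meson order_trans)
  then show ?thesis using \<delta>(1)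
    by (cases "emeasure \<mu> A = top") (auto simp: ennreal_mult_top top_unique less_top)
qed

text \<open>Along an orbit piece of length \<^term>\<open>n\<close>, only the last \<^term>\<open>m\<close> visits to \<^term>\<open>A\<close>
  can be followed by fewer than \<^term>\<open>m\<close> visits within time \<^term>\<open>n\<close>.\<close>

lemma few_forward_visits:
  "emeasure \<mu> {y \<in> A. visits {1..n} y < real m} * ennreal (\<delta> * (\<Sum>k\<le>n. \<epsilon> k)) \<le> ennreal (real m)"
proof -
  define B where "B = {y \<in> A. visits {1..n} y < real m}"
  have "B = {y \<in> space \<mu>. y \<in> A \<and> visits {1..n} y < real m}"
    using sets.sets_into_space[OF A] by (auto simp: B_def)
  then have B [measurable]: "B \<in> sets \<mu>" by simp
  have BA: "B \<subseteq> A" by (auto simp: B_def)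
  have pw: "(\<Sum>k\<le>n. indicator B ((T ^^ k) y)) \<le> real m" for y
  proof (rule ccontr)
    define K where "K = {k\<in>{..n}. (T ^^ k) y \<in> B}"
    have "(\<Sum>k\<le>n. indicator B ((T ^^ k) y)) = real (card K)"
      unfolding K_def by (simp add: indicator_def sum.If_cases Int_def)
    moreover assume "\<not> (\<Sum>k\<le>n. indicator B ((T ^^ k) y)) \<le> real m"
    ultimately have card: "m < card K" by simp
    have finK: "finite K" by (simp add: K_def)
    have "K \<noteq> {}" using card by auto
    \<comment> \<open>Counted from the earliest index of \<open>K\<close>, all other indices are
      later visits within time \<open>n\<close>; having more than \<open>m\<close> indices
      contradicts membership in \<open>B\<close>.\<close>
    define k where "k = Min K"
    have k: "k \<in> K" unfolding k_def using finK \<open>K \<noteq> {}\<close> by (rule Min_in)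
    have kle: "k \<le> i" if "i \<in> K" for i unfolding k_def using finK that by (rule Min_le)
    have "(\<lambda>i. i - k) ` (K - {k}) \<subseteq> {j\<in>{1..n}. (T ^^ j) ((T ^^ k) y) \<in> A}"
    proof (intro image_subsetI)
      fix i assume i: "i \<in> K - {k}"
      then have "k < i" using kle[of i] by auto
      then have "(T ^^ (i - k)) ((T ^^ k) y) = (T ^^ i) y"
        by (metis add_diff_inverse_nat add.commute funpow_add less_imp_le_nat not_less o_apply)
      then show "i - k \<in> {j\<in>{1..n}. (T ^^ j) ((T ^^ k) y) \<in> A}"
        using i \<open>k < i\<close> BA by (auto simp: K_def)
    qed
    then have "card ((\<lambda>i. i - k) ` (K - {k})) \<le> card {j\<in>{1..n}. (T ^^ j) ((T ^^ k) y) \<in> A}"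
      by (intro card_mono) auto
    moreover have "inj_on (\<lambda>i. i - k) (K - {k})"
      using kle by (intro inj_on_diff_nat) auto
    then have "card ((\<lambda>i. i - k) ` (K - {k})) = card K - 1"
      using finK k by (simp add: card_image)
    ultimately have "real m \<le> visits {1..n} ((T ^^ k) y)"
      using card by (simp add: visits_card)
    moreover have "(T ^^ k) y \<in> B" using k by (simp add: K_def)
    ultimately show False by (simp add: B_def)
  qed
  have "emeasure \<mu> B * ennreal (\<delta> * (\<Sum>k\<le>n. \<epsilon> k)) = (\<Sum>k\<le>n. ennreal (\<epsilon> k) * (ennreal \<delta> * emeasure \<mu> B))"
    using \<epsilon>(1) \<delta>(1) by (simp add: sum_distrib_left[symmetric] sum_distrib_right[symmetric] sum_ennreal[symmetric] ennreal_mult sum_nonneg mult_ac del: sum_ennreal)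
  also have "\<dots> \<le> (\<Sum>k\<le>n. ennreal (\<epsilon> k) * emeasure \<nu> B)"
    by (intro sum_mono mult_left_mono \<delta>(2) B BA) auto
  also have "\<dots> \<le> (\<Sum>k\<le>n. emeasure \<nu> ((T ^^ k) -` B \<inter> space \<mu>))"
    by (intro sum_mono sweep B)
  also have "\<dots> = (\<Sum>k\<le>n. \<integral>\<^sup>+y. ennreal (indicator B ((T ^^ k) y)) \<partial>\<nu>)"
  proof (intro sum.cong refl)
    fix k
    have m: "(T ^^ k) -` B \<inter> space \<mu> \<in> sets \<nu>" using measurable_sets[OF T_power B] by (simp add: sets_\<nu>)
    have "emeasure \<nu> ((T ^^ k) -` B \<inter> space \<mu>) = (\<integral>\<^sup>+y. indicator ((T ^^ k) -` B \<inter> space \<mu>) y \<partial>\<nu>)"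
      using m by simp
    also have "\<dots> = (\<integral>\<^sup>+y. ennreal (indicator B ((T ^^ k) y)) \<partial>\<nu>)"
      by (intro nn_integral_cong) (auto simp: indicator_def space_\<nu>)
    finally show "emeasure \<nu> ((T ^^ k) -` B \<inter> space \<mu>) = (\<integral>\<^sup>+y. ennreal (indicator B ((T ^^ k) y)) \<partial>\<nu>)" .
  qed
  also have "\<dots> = (\<integral>\<^sup>+y. ennreal (\<Sum>k\<le>n. indicator B ((T ^^ k) y)) \<partial>\<nu>)"
    by (subst nn_integral_sum[symmetric]) (auto simp: sum_ennreal)
  also have "\<dots> \<le> (\<integral>\<^sup>+y. ennreal (real m) \<partial>\<nu>)"
    using pw by (intro nn_integral_mono ennreal_leI) auto
  also have "\<dots> \<le> ennreal (real m)"
    using mult_left_mono[OF fin, of "ennreal (real m)"] by simp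
  finally show ?thesis by (simp add: B_def)
qed

lemma nn_integral_visits_shift: 
  "(\<integral>\<^sup>+y. ennreal (min (real m) (visits {1..n} y)) \<partial>\<mu>) = (\<integral>\<^sup>+y. ennreal (min (real m) (visits {..<n} y)) \<partial>\<mu>)"
proof -
  have distr: "distr \<mu> \<mu> T = \<mu>"
    by (rule measure_eqI) (auto simp: emeasure_distr inv)
  have "visits {1..n} y = visits {..<n} (T y)" for y
  proof -
    have "visits {..<n} (T y) = (\<Sum>j<n. indicator A ((T ^^ Suc j) y))"
      by (simp add: visits_def funpow_swap1)
    also have "\<dots> = visits {1..n} y"
      unfolding visits_def by (subst sum.atLeast1_atMost_eq[symmetric]) simp
    finally show ?thesis by simp
  qed
  then have "(\<integral>\<^sup>+y. ennreal (min (real m) (visits {1..n} y)) \<partial>\<mu>) = (\<integral>\<^sup>+y. ennreal (min (real m) (visits {..<n} (T y))) \<partial>\<mu>)"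
    by simp
  also have "\<dots> = (\<integral>\<^sup>+y. ennreal (min (real m) (visits {..<n} y)) \<partial>distr \<mu> \<mu> T)"
    by (subst nn_integral_distr) auto
  finally show ?thesis by (simp add: distr)
qed

text \<open>Finiteness is needed to cancel this integral in \<open>backward_eq_forward\<close>; it
  holds because \<open>A\<close> has finite measure and the measure is invariant.\<close>

lemma nn_integral_visits_finite: "(\<integral>\<^sup>+y. ennreal (min (real m) (visits {..<n} y)) \<partial>\<mu>) < \<infinity>"
proof -
  have pre: "emeasure \<mu> ((T ^^ k) -` A \<inter> space \<mu>) = emeasure \<mu> A" for k
  proof (induction k)
    case 0
    then show ?case using sets.sets_into_space[OF A] by (simp add: Int_absorb2)
  next
    case (Suc k)
    have "(T ^^ Suc k) -` A \<inter> space \<mu> = T -` ((T ^^ k) -` A \<inter> space \<mu>) \<inter> space \<mu>"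
      using measurable_space[OF T] by (auto simp: funpow_swap1)
    then show ?case by (simp only: inv[OF measurable_sets[OF T_power A]] Suc)
  qed
  have "(\<integral>\<^sup>+y. ennreal (min (real m) (visits {..<n} y)) \<partial>\<mu>) \<le> (\<integral>\<^sup>+y. (\<Sum>k<n. indicator ((T ^^ k) -` A \<inter> space \<mu>) y) \<partial>\<mu>)"
  proof (intro nn_integral_mono)
    fix y assume "y \<in> space \<mu>"
    have "ennreal (min (real m) (visits {..<n} y)) \<le> ennreal (visits {..<n} y)" by (intro ennreal_leI) auto
    also have "\<dots> = (\<Sum>k<n. indicator ((T ^^ k) -` A \<inter> space \<mu>) y)"
      using \<open>y \<in> space \<mu>\<close> unfolding visits_def
      by (subst sum_ennreal[symmetric]) (auto intro!: sum.cong simp: indicator_def ennreal_of_nat_eq_real_of_nat)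
    finally show "ennreal (min (real m) (visits {..<n} y)) \<le> (\<Sum>k<n. indicator ((T ^^ k) -` A \<inter> space \<mu>) y)" .
  qed
  also have "\<dots> = (\<Sum>k<n. emeasure \<mu> A)"
    using measurable_sets[OF T_power A] by (subst nn_integral_sum) (auto simp: pre)
  also have "\<dots> < \<infinity>" using emeasure_A_finite by (simp add: ennreal_mult_less_top of_nat_less_top)
  finally show ?thesis .
qed

text \<open>Both sides are the increment of the integral of the truncated number of visits when the
  window \<open>{1..n}\<close>, respectively \<open>{0..<n}\<close>, is enlarged to \<open>{0..n}\<close>.\<close>

lemma backward_eq_forward:
  "emeasure \<mu> {y \<in> space \<mu>. (T ^^ n) y \<in> A \<and> visits {..<n} y < real m} = emeasure \<mu> {y \<in> A. visits {1..n} y < real m}"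
proof -
  define I where "I S = (\<integral>\<^sup>+y. ennreal (min (real m) (visits S y)) \<partial>\<mu>)" for S
  have step: "I (insert i S) = I S + emeasure \<mu> {y \<in> space \<mu>. (T ^^ i) y \<in> A \<and> visits S y < real m}"
    if "finite S" "i \<notin> S" for i S
  proof -
    let ?C = "{y \<in> space \<mu>. (T ^^ i) y \<in> A \<and> visits S y < real m}"
    have C: "?C \<in> sets \<mu>" by measurable
    have "ennreal (min (real m) (visits (insert i S) y)) = ennreal (min (real m) (visits S y)) + indicator ?C y"
      if y: "y \<in> space \<mu>" for y
    proof -
      have 1: "visits (insert i S) y = indicator A ((T ^^ i) y) + visits S y"
        using \<open>finite S\<close> \<open>i \<notin> S\<close> by (simp add: visits_def)
      \<comment> \<open>Integrality: from a value below \<open>m\<close>, one more visit still does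
        not exceed \<open>m\<close>, so the truncation cannot cut off a part of the
        increment.\<close>
      have "visits S y \<in> \<nat>" using visits_card[OF \<open>finite S\<close>] by simp
      then have "visits S y < real m \<Longrightarrow> visits S y + 1 \<le> real m"
        by (auto elim!: Nats_cases)
      then have "min (real m) (visits (insert i S) y) = min (real m) (visits S y) + indicator ?C y"
        using y by (auto simp: 1 indicator_def)
      then show ?thesis using visits_nonneg[of S y] by (simp add: ennreal_indicator)
    qed
    then have "I (insert i S) = (\<integral>\<^sup>+y. ennreal (min (real m) (visits S y)) + indicator ?C y \<partial>\<mu>)"
      unfolding I_def by (intro nn_integral_cong) auto
    also have "\<dots> = I S + emeasure \<mu> ?C"
      unfolding I_def using C by (subst nn_integral_add) auto
    finally show ?thesis .
  qed
  have "insert n {..<n} = insert 0 {1..n}" by auto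
  then have "I {..<n} + emeasure \<mu> {y \<in> space \<mu>. (T ^^ n) y \<in> A \<and> visits {..<n} y < real m}
     = I {1..n} + emeasure \<mu> {y \<in> space \<mu>. (T ^^ 0) y \<in> A \<and> visits {1..n} y < real m}"
    using step[of "{..<n}" n] step[of "{1..n}" 0] by simp
  moreover have "I {1..n} = I {..<n}" unfolding I_def by (rule nn_integral_visits_shift)
  moreover have "I {..<n} < \<infinity>" unfolding I_def by (rule nn_integral_visits_finite)
  moreover have "{y \<in> space \<mu>. (T ^^ 0) y \<in> A \<and> visits {1..n} y < real m} = {y \<in> A. visits {1..n} y < real m}"
    using sets.sets_into_space[OF A] by auto
  ultimately show ?thesis by (auto simp: ennreal_add_left_cancel simp del: One_nat_def)
qed

lemma few_backward_visits:
  assumes "0 < n"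
  shows "emeasure \<mu> {y \<in> space \<mu>. (T ^^ n) y \<in> A \<and> visits {..<n} y < real m} \<le> ennreal (real m / (\<delta> * c * sqrt (real n)))"
proof -
  let ?e = "emeasure \<mu> {y \<in> space \<mu>. (T ^^ n) y \<in> A \<and> visits {..<n} y < real m}"
  have pos: "0 < \<delta> * c * sqrt (real n)" using \<delta>(1) \<epsilon>(2) assms by simp
  have "?e * ennreal (\<delta> * c * sqrt (real n)) \<le> ?e * ennreal (\<delta> * (\<Sum>k\<le>n. \<epsilon> k))"
    using \<epsilon>(3)[of n] \<delta>(1) by (intro mult_left_mono ennreal_leI) (auto simp: mult.assoc)
  also have "\<dots> \<le> ennreal (real m)" unfolding backward_eq_forward by (rule few_forward_visits)
  finally have "?e * ennreal (\<delta> * c * sqrt (real n)) \<le> ennreal (real m)" .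
  then show ?thesis
  proof (cases ?e rule: ennreal_cases)
    case (real e)
    then have "e * (\<delta> * c * sqrt (real n)) \<le> real m"
      using \<open>?e * ennreal (\<delta> * c * sqrt (real n)) \<le> ennreal (real m)\<close> pos
      by (simp add: ennreal_mult[symmetric] ennreal_le_iff)
    then show ?thesis using real pos by (simp add: pos_le_divide_eq ennreal_leI)
  next
    case top
    then show ?thesis
      using \<open>?e * ennreal (\<delta> * c * sqrt (real n)) \<le> ennreal (real m)\<close> \<delta>(1) \<epsilon>(2) assms
      by (simp add: ennreal_top_mult top_unique)
  qed
qed

text \<open>The coordinate \<open>x n\<close> determines \<open>x 0\<close>, ..., \<open>x n\<close>
  through the iterates of \<open>T\<close>, and the visit at index \<open>k\<close> is the visit of
  \<open>x n\<close> at time \<open>n - k\<close>. Having few visits is therefore an event in one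
  coordinate, and the marginals of \<open>M\<close> suffice to measure it.\<close>

theorem AE_backward_visits:
  fixes M :: "(nat \<Rightarrow> 'a) measure"
  assumes orbit: "\<And>x n. x \<in> space M \<Longrightarrow> x n \<in> space \<mu> \<and> T (x (Suc n)) = x n"
    and M: "\<And>j S. S \<in> sets \<mu> \<Longrightarrow> {x \<in> space M. x j \<in> S} \<in> sets M \<and> emeasure M {x \<in> space M. x j \<in> S} = emeasure \<mu> S"
  shows "AE x in M. x 0 \<in> A \<longrightarrow> (\<forall>\<^sub>F n in sequentially. 1 / 2 * root 3 (real n) \<le> real (card {k\<in>{1..n}. x k \<in> A}))"
proof -
  define N where "N x n = card {k\<in>{1..n}. x k \<in> A}" for x :: "nat \<Rightarrow> 'a" and n
  define E where "E j = {x \<in> space M. x 0 \<in> A \<and> N x (8 ^ j) < 2 ^ j}" for j :: nat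
  define D where "D n m = {y \<in> space \<mu>. (T ^^ n) y \<in> A \<and> visits {..<n} y < real m}" for n m
  have D: "D n m \<in> sets \<mu>" for n m unfolding D_def by measurable
  have iter: "(T ^^ i) (x (i + k)) = x k" if "x \<in> space M" for x i k
    by (induction i) (use orbit[OF that] in \<open>auto simp: funpow_swap1\<close>)
  have ED: "E j = {x \<in> space M. x (8 ^ j) \<in> D (8 ^ j) (2 ^ j)}" for j
  proof -
    have v: "visits {..<n} (x n) = real (N x n)" if x: "x \<in> space M" for x n
    proof -
      have "bij_betw (\<lambda>k. n - k) {k\<in>{1..n}. x k \<in> A} {i\<in>{..<n}. (T ^^ i) (x n) \<in> A}"
      proof (rule bij_betwI[where g = "\<lambda>k. n - k"])
        show "(\<lambda>k. n - k) \<in> {k\<in>{1..n}. x k \<in> A} \<rightarrow> {i\<in>{..<n}. (T ^^ i) (x n) \<in> A}"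
        proof
          fix k assume "k \<in> {k\<in>{1..n}. x k \<in> A}"
          then show "n - k \<in> {i\<in>{..<n}. (T ^^ i) (x n) \<in> A}" using iter[OF x, of "n - k" k] by auto
        qed
        show "(\<lambda>k. n - k) \<in> {i\<in>{..<n}. (T ^^ i) (x n) \<in> A} \<rightarrow> {k\<in>{1..n}. x k \<in> A}"
        proof
          fix i assume "i \<in> {i\<in>{..<n}. (T ^^ i) (x n) \<in> A}"
          then show "n - i \<in> {k\<in>{1..n}. x k \<in> A}" using iter[OF x, of i "n - i"] by auto
        qed
      qed auto
      then show ?thesis unfolding N_def visits_card[OF finite_lessThan] by (simp add: bij_betw_same_card)
    qed
    have "x 0 \<in> A \<and> N x (8 ^ j) < 2 ^ j \<longleftrightarrow> x (8 ^ j) \<in> D (8 ^ j) (2 ^ j)" if x: "x \<in> space M" for x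
    proof -
      have "(T ^^ (8 ^ j)) (x (8 ^ j)) = x 0" using iter[OF x, of "8 ^ j" 0] by simp
      moreover have "visits {..<8 ^ j} (x (8 ^ j)) < real (2 ^ j) \<longleftrightarrow> N x (8 ^ j) < 2 ^ j"
        unfolding v[OF x] by (rule of_nat_less_iff)
      ultimately show ?thesis using orbit[OF x] by (simp add: D_def del: of_nat_power)
    qed
    then show ?thesis unfolding E_def by blast
  qed
  have E: "E j \<in> sets M" "emeasure M (E j) \<le> ennreal (1 / (\<delta> * c) * (1 / sqrt 2) ^ j)" for j
  proof -
    show "E j \<in> sets M" unfolding ED using M[OF D] by blast
    have "emeasure M (E j) = emeasure \<mu> (D (8 ^ j) (2 ^ j))" unfolding ED using M[OF D] by blast
    also have "\<dots> \<le> ennreal (real (2 ^ j) / (\<delta> * c * sqrt (real (8 ^ j))))"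
      unfolding D_def by (rule few_backward_visits) simp
    \<comment> \<open>The choice of scales turns the estimate into a geometric series with ratio
      \<open>1 / sqrt 2\<close>.\<close>
    also have "real (2 ^ j) / (\<delta> * c * sqrt (real (8 ^ j))) = 1 / (\<delta> * c) * (2 / sqrt 8) ^ j"
      by (simp add: real_sqrt_power power_divide)
    also have "2 / sqrt 8 = 1 / sqrt (2::real)"
    proof -
      have "sqrt 8 = sqrt (4 * 2)" by simp
      also have "\<dots> = 2 * sqrt 2" unfolding real_sqrt_mult by simp
      finally show ?thesis by simp
    qed
    finally show "emeasure M (E j) \<le> ennreal (1 / (\<delta> * c) * (1 / sqrt 2) ^ j)" .
  qed
  have "AE x in M. \<forall>\<^sub>F j in sequentially. x \<in> space M - E j"
  proof (rule borel_cantelli_AE1[OF E(1)])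
    show "emeasure M (E j) < \<infinity>" for j using E(2)[of j] by (rule le_less_trans) simp
    have pos: "0 \<le> 1 / (\<delta> * c) * (1 / sqrt 2) ^ j" for j using \<delta>(1) \<epsilon>(2) by simp
    show "summable (\<lambda>j. measure M (E j))"
    proof (rule summable_comparison_test)
      show "\<exists>N. \<forall>n\<ge>N. norm (measure M (E n)) \<le> 1 / (\<delta> * c) * (1 / sqrt 2) ^ n"
        using E(2) pos by (auto simp: measure_def intro!: enn2real_leI)
      show "summable (\<lambda>n. 1 / (\<delta> * c) * (1 / sqrt 2) ^ n)"
        by (intro summable_mult summable_geometric) simp
    qed
  qed
  then show ?thesis
  proof (eventually_elim, intro impI)
    fix x assume x: "\<forall>\<^sub>F j in sequentially. x \<in> space M - E j" and x0: "x 0 \<in> A"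
    obtain j0 where "\<And>j. j0 \<le> j \<Longrightarrow> x \<in> space M - E j" using x by (auto simp: eventually_sequentially)
    then have j0: "2 ^ j \<le> N x (8 ^ j)" if "j0 \<le> j" for j
      using that x0 by (force simp: E_def)
    show "\<forall>\<^sub>F n in sequentially. 1 / 2 * root 3 (real n) \<le> real (card {k\<in>{1..n}. x k \<in> A})"
    proof (rule eventually_sequentiallyI)
      fix n :: nat assume n: "8 ^ j0 \<le> n"
      then have "1 \<le> n" by (meson one_le_numeral one_le_power order_trans)
      then obtain j where j: "8 ^ j \<le> n" "n < 8 ^ (j + 1)" using ex_power_ivl1[of 8 n] by auto
      then have "(8::nat) ^ j0 < 8 ^ (j + 1)" using n by linarith
      then have "j0 < j + 1" by (rule power_less_imp_less_exp[rotated]) simp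
      then have "j0 \<le> j" by simp
      have "N x (8 ^ j) \<le> N x n" unfolding N_def using j(1) by (intro card_mono) auto
      then have Nn: "2 ^ j \<le> N x n" using j0[OF \<open>j0 \<le> j\<close>] by linarith
      \<comment> \<open>Between \<open>8 ^ j\<close> and \<open>8 ^ (j + 1)\<close> only
        monotonicity of the count is available, while the cube root can reach
        \<open>2 ^ (j + 1)\<close>; this is the origin of the factor 1/2.\<close>
      have "root 3 (real n) \<le> root 3 ((2 ^ (j + 1)) ^ 3)"
      proof (rule real_root_le_mono)
        have "real n \<le> real (8 ^ (j + 1))" using j(2) by (simp only: of_nat_le_iff)
        also have "real (8 ^ (j + 1)) = (2 ^ 3) ^ (j + 1)" by simp
        also have "(2 ^ 3) ^ (j + 1) = ((2 ^ (j + 1)) ^ 3 :: real)"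
          unfolding power_mult[symmetric] by (simp add: mult.commute)
        finally show "real n \<le> (2 ^ (j + 1)) ^ 3" .
      qed simp
      also have "\<dots> = 2 ^ (j + 1)" by (rule real_root_power_cancel) auto
      finally have "1 / 2 * root 3 (real n) \<le> 2 ^ j" by simp
      also have "\<dots> \<le> real (N x n)" using Nn by (metis of_nat_le_iff of_nat_numeral of_nat_power)
      finally show "1 / 2 * root 3 (real n) \<le> real (card {k\<in>{1..n}. x k \<in> A})" by (simp add: N_def)
    qed
  qed
qed

end

section \<open>Orbits near a parabolic boundary point\<close>

lemma Schwarz_Pick:
  assumes g: "g holomorphic_on ball 0 1" "g ` ball 0 1 \<subseteq> ball 0 1" and z: "norm z < 1" and a: "norm a < 1"
  shows "norm (g z - g a) / norm (1 - cnj (g a) * g z) \<le> norm (z - a) / norm (1 - cnj a * z)"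
proof -
  have ga: "norm (g a) < 1" and gz: "norm (g z) < 1" using g(2) z a by (auto simp: image_subset_iff)
  have moeb: "Moebius_function 0 p ` ball 0 1 \<subseteq> ball 0 1" if "norm p < 1" for p
    using Moebius_function_norm_lt_1[OF that] by auto
  define F where "F = Moebius_function 0 (g a) \<circ> g \<circ> Moebius_function 0 (- a)"
  have "F holomorphic_on ball 0 1"
    unfolding F_def using g moeb[of "- a"] a ga
    by (intro holomorphic_on_compose_gen[where t = "ball 0 1"] Moebius_function_holomorphic) auto
  moreover have "F 0 = 0" by (simp add: F_def Moebius_function_def)
  moreover have "norm (F \<xi>) < 1" if "norm \<xi> < 1" for \<xi>
    unfolding F_def using that g(2) Moebius_function_norm_lt_1[of "- a" \<xi> 0] Moebius_function_norm_lt_1[OF ga] a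
    by (auto simp: image_subset_iff)
  ultimately have F: "norm (F \<xi>) \<le> norm \<xi>" if "norm \<xi> < 1" for \<xi>
    using Schwarz_Lemma(1)[of F \<xi>] that by blast
  define \<xi> where "\<xi> = Moebius_function 0 a z"
  have \<xi>: "norm \<xi> < 1" unfolding \<xi>_def using z a by (intro Moebius_function_norm_lt_1)
  have "Moebius_function 0 (- a) \<xi> = z"
    unfolding \<xi>_def using Moebius_function_compose[of "- a" a z] z a by simp
  then have "F \<xi> = Moebius_function 0 (g a) (g z)" by (simp add: F_def)
  then show ?thesis using F[OF \<xi>] by (simp add: \<xi>_def Moebius_function_def norm_divide)
qed

lemma pseudohyperbolic_complement:
  assumes "norm z < 1" "norm a < 1"
  shows "1 - (norm (z - a) / norm (1 - cnj a * z))\<^sup>2 = (1 - (norm z)\<^sup>2) * (1 - (norm a)\<^sup>2) / (norm (1 - cnj a * z))\<^sup>2"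
proof -
  have "norm (cnj a * z) < 1"
    using assms mult_strict_mono'[of "norm a" 1 "norm z" 1] by (simp add: norm_mult)
  then have "1 - cnj a * z \<noteq> 0" by auto
  moreover have "(norm (1 - cnj a * z))\<^sup>2 - (norm (z - a))\<^sup>2 = (1 - (norm z)\<^sup>2) * (1 - (norm a)\<^sup>2)"
    by (simp only: cmod_power2) (simp add: power2_eq_square algebra_simps)
  ultimately show ?thesis by (simp add: power_divide field_simps)
qed

text \<open>In this form the factors \<open>1 - (norm a)\<^sup>2\<close> and
  \<open>1 - (norm (g a))\<^sup>2\<close>, which degenerate at the boundary, stand apart from the
  terms that have limits there.\<close>

lemma Schwarz_Pick_complement:
  assumes g: "g holomorphic_on ball 0 1" "g ` ball 0 1 \<subseteq> ball 0 1" and z: "norm z < 1" and a: "norm a < 1"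
  shows "(1 - (norm z)\<^sup>2) * (1 - (norm a)\<^sup>2) / (norm (1 - cnj a * z))\<^sup>2
     \<le> (1 - (norm (g z))\<^sup>2) * (1 - (norm (g a))\<^sup>2) / (norm (1 - cnj (g a) * g z))\<^sup>2"
proof -
  have gn: "norm (g z) < 1" "norm (g a) < 1" using g(2) z a by (auto simp: image_subset_iff)
  have "(norm (g z - g a) / norm (1 - cnj (g a) * g z))\<^sup>2 \<le> (norm (z - a) / norm (1 - cnj a * z))\<^sup>2"
    by (intro power_mono Schwarz_Pick[OF g z a]) simp
  then show ?thesis
    unfolding pseudohyperbolic_complement[OF z a, symmetric] pseudohyperbolic_complement[OF gn, symmetric] by simp
qed

text \<open>The map \<open>1 / (1 - z)\<close> takes the disc to the half-plane with real part above
  1/2; the right-hand side is half the Poisson kernel at 1.\<close>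

lemma Re_inverse_one_minus:
  assumes "z \<noteq> 1"
  shows "Re (1 / (1 - z)) - 1 / 2 = (1 - (norm z)\<^sup>2) / (2 * (norm (1 - z))\<^sup>2)"
proof -
  have "norm (1 - z) \<noteq> 0" using assms by simp
  then have "(norm (1 - z))\<^sup>2 \<noteq> 0" by simp
  moreover have "2 * Re (1 - z) - (norm (1 - z))\<^sup>2 = 1 - (norm z)\<^sup>2"
    by (simp only: cmod_power2) (simp add: power2_eq_square algebra_simps)
  moreover have "Re (1 / (1 - z)) = Re (1 - z) / (norm (1 - z))\<^sup>2"
    by (simp add: Re_divide cmod_power2)
  ultimately show ?thesis by (simp add: field_simps)
qed

lemma divided_difference:
  assumes "F holomorphic_on ball 0 d" "0 < d"
  obtains F1 where "F1 holomorphic_on ball 0 d" "F1 0 = deriv F 0" "\<And>u. F u = F 0 + u * F1 u"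
proof
  show "(\<lambda>u. if u = 0 then deriv F 0 else (F u - F 0) / (u - 0)) holomorphic_on ball 0 d"
    using assms by (intro pole_lemma) auto
qed auto

text \<open>Dividing out the simple zero leaves \<open>1 / f1\<close>, holomorphic near 0; three
  divided differences give its Taylor expansion, with a remainder bounded on a compact half disc. In
  the coordinate \<open>1 / u\<close> a fixed point of multiplier 1 thus becomes a translation with
  a correction \<open>c * u\<close>.\<close>

lemma reciprocal_expansion:
  assumes f: "f holomorphic_on ball 0 e" "0 < e" "f 0 = 0" "deriv f 0 = 1"
  obtains b c C d where "0 < d" "d \<le> e" "0 \<le> C"
    "\<And>u. \<lbrakk>u \<noteq> 0; norm u < d\<rbrakk> \<Longrightarrow> f u \<noteq> 0 \<and> norm (1 / f u - (1 / u + b + c * u)) \<le> C * (norm u)\<^sup>2"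
proof -
  obtain f1 where f1: "f1 holomorphic_on ball 0 e" "f1 0 = 1" "\<And>u. f u = u * f1 u"
    using divided_difference[OF f(1,2)] f(3,4) by (metis add_0)
  have "isCont f1 0"
    using f1(1) f(2) by (intro continuous_on_interior[of "ball 0 e"] holomorphic_on_imp_continuous_on) auto
  then have "\<forall>\<^sub>F u in nhds 0. f1 u \<noteq> 0"
    using f1(2) by (intro tendsto_imp_eventually_ne[of f1 1]) (simp_all add: isCont_def tendsto_nhds_iff)
  then obtain d1 where d1: "0 < d1" "\<And>u::complex. norm u < d1 \<Longrightarrow> f1 u \<noteq> 0"
    unfolding eventually_nhds_metric by (auto simp: dist_norm)
  define d2 where "d2 = min d1 e"
  have d2: "0 < d2" "d2 \<le> e" "\<And>u::complex. norm u < d2 \<Longrightarrow> f1 u \<noteq> 0" using d1 f(2) by (auto simp: d2_def)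
  have "(\<lambda>u. 1 / f1 u) holomorphic_on ball 0 d2"
    using d2 by (intro holomorphic_intros holomorphic_on_subset[OF f1(1)]) auto
  then obtain q1 where q1: "q1 holomorphic_on ball 0 d2" "\<And>u. 1 / f1 u = 1 / f1 0 + u * q1 u"
    using divided_difference[OF _ d2(1)] by metis
  obtain q2 where q2: "q2 holomorphic_on ball 0 d2" "\<And>u. q1 u = q1 0 + u * q2 u"
    using divided_difference[OF q1(1) d2(1)] by metis
  obtain q3 where q3: "q3 holomorphic_on ball 0 d2" "\<And>u. q2 u = q2 0 + u * q3 u"
    using divided_difference[OF q2(1) d2(1)] by metis
  have "continuous_on (cball 0 (d2 / 2)) q3"
    by (rule holomorphic_on_imp_continuous_on[OF holomorphic_on_subset[OF q3(1)]]) (use d2 in auto)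
  then have "bounded (q3 ` cball 0 (d2 / 2))"
    by (intro compact_imp_bounded compact_continuous_image) auto
  then obtain C where C: "0 < C" "\<And>u. norm u \<le> d2 / 2 \<Longrightarrow> norm (q3 u) \<le> C"
    unfolding bounded_pos by auto
  show thesis
  proof
    show "0 < d2 / 2" "d2 / 2 \<le> e" "0 \<le> C" using d2 C by auto
    fix u :: complex assume u: "u \<noteq> 0" "norm u < d2 / 2"
    then have ne: "f1 u \<noteq> 0" using d2(1) by (intro d2(3)) auto
    then have "1 / f u = 1 / u * (1 / f1 u)" by (simp add: f1(3))
    also have "1 / f1 u = 1 + u * (q1 0 + u * (q2 0 + u * q3 u))"
      using q1(2)[of u] q2(2)[of u] q3(2)[of u] f1(2) by simp
    also have "1 / u * \<dots> - (1 / u + q1 0 + q2 0 * u) = u\<^sup>2 * q3 u"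
      using u(1) by (simp add: field_simps power2_eq_square)
    finally have "norm (1 / f u - (1 / u + q1 0 + q2 0 * u)) = (norm u)\<^sup>2 * norm (q3 u)"
      by (simp add: norm_mult norm_power)
    also have "\<dots> \<le> C * (norm u)\<^sup>2" using mult_right_mono[OF C(2)[of u], of "(norm u)\<^sup>2"] u(2) by (simp add: mult.commute)
    finally show "f u \<noteq> 0 \<and> norm (1 / f u - (1 / u + q1 0 + q2 0 * u)) \<le> C * (norm u)\<^sup>2"
      using ne u(1) by (simp add: f1(3))
  qed
qed

text \<open>The dilates are continuous up to the circle, so \<open>Harnack_lower\<close> can be
  integrated against their nonnegative real parts before the radii tend to 1.\<close>

lemma Harnack_Re:
  assumes k: "k holomorphic_on ball 0 1" and pos: "\<And>z. norm z < 1 \<Longrightarrow> 0 \<le> Re (k z)" and w: "norm w < 1"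
  shows "(1 - norm w) / (1 + norm w) * Re (k 0) \<le> Re (k w)"
proof -
  let ?e = "(1 - norm w) / (1 + norm w)"
  have le: "?e * Re (k 0) \<le> Re (k (of_real (rad n) * w))" for n
  proof -
    have cont: "continuous_on (cball 0 1) (\<lambda>z. k (of_real (rad n) * z))"
      by (rule continuous_on_compose2[OF holomorphic_on_imp_continuous_on[OF k]])
        (auto intro!: continuous_intros rad_circle)
    have "(k \<circ> (\<lambda>z. of_real (rad n) * z)) holomorphic_on ball 0 1"
    proof (rule holomorphic_on_compose_gen[OF _ k])
      show "(*) (of_real (rad n)) ` ball 0 1 \<subseteq> ball (0::complex) 1"
        using rad_circle[of _ n] by force
    qed (intro holomorphic_intros)
    then have hol: "(\<lambda>z. k (of_real (rad n) * z)) holomorphic_on ball 0 1" by (simp add: o_def)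
    have int: "integrable angle (\<lambda>\<theta>. k (of_real (rad n) * cis \<theta>))" by (rule integrable_circle[OF k rad])
    have intP: "integrable angle (\<lambda>\<theta>. poisson w (cis \<theta>) *\<^sub>R k (of_real (rad n) * cis \<theta>))"
    proof -
      have "compact ((\<lambda>z. k (of_real (rad n) * z)) ` cball 0 1)" using cont by (intro compact_continuous_image) auto
      then obtain B where B: "\<And>z. z \<in> cball 0 1 \<Longrightarrow> norm (k (of_real (rad n) * z)) \<le> B"
        using compact_imp_bounded[THEN bounded_iff[THEN iffD1]] by (metis imageI)
      show ?thesis
        by (rule integrable_poisson[OF _ _ w, of _ B])
          (auto intro!: B borel_measurable_continuous_onI continuous_on_circle[OF k rad] simp del: mem_cball_0 simp: mem_cball)
    qed
    have "?e * Re (k 0) = ?e * (\<integral>\<theta>. Re (k (of_real (rad n) * cis \<theta>)) \<partial>angle)"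
      using integral_Re[OF int] mean_value_angle[OF k rad] by simp
    also have "\<dots> = (\<integral>\<theta>. ?e * Re (k (of_real (rad n) * cis \<theta>)) \<partial>angle)" by simp
    also have "\<dots> \<le> (\<integral>\<theta>. Re (poisson w (cis \<theta>) *\<^sub>R k (of_real (rad n) * cis \<theta>)) \<partial>angle)"
    proof (rule integral_mono)
      show "integrable angle (\<lambda>\<theta>. ?e * Re (k (of_real (rad n) * cis \<theta>)))"
        using integrable_Re[OF int] by simp
      show "integrable angle (\<lambda>\<theta>. Re (poisson w (cis \<theta>) *\<^sub>R k (of_real (rad n) * cis \<theta>)))"
        using intP by (rule integrable_Re)
      show "?e * Re (k (of_real (rad n) * cis \<theta>)) \<le> Re (poisson w (cis \<theta>) *\<^sub>R k (of_real (rad n) * cis \<theta>))" for \<theta>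
        using mult_right_mono[OF Harnack_lower[OF _ w, of "cis \<theta>"] pos[OF rad_circle, of "cis \<theta>" n]] by simp
    qed
    also have "\<dots> = Re (k (of_real (rad n) * w))"
      using integral_Re[OF intP] Poisson_formula[OF cont hol w] by simp
    finally show ?thesis .
  qed
  have "isCont k w" using w k by (intro continuous_on_interior[of "ball 0 1"] holomorphic_on_imp_continuous_on) auto
  moreover have "(\<lambda>n. of_real (rad n) * w) \<longlonglongrightarrow> w"
    using tendsto_mult[OF tendsto_of_real[OF rad_tendsto] tendsto_const[of w]] by simp
  ultimately have "(\<lambda>n. k (of_real (rad n) * w)) \<longlonglongrightarrow> k w" by (rule isCont_tendsto_compose)
  then have "(\<lambda>n. Re (k (of_real (rad n) * w))) \<longlonglongrightarrow> Re (k w)" by (rule tendsto_Re)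
  then show ?thesis by (rule LIMSEQ_le_const) (use le in blast)
qed

text \<open>The product of the factors \<open>1 + D / j\<^sup>2\<close> converges; the explicit
  exponential bound comes from telescoping
  \<open>1 / j\<^sup>2 \<le> 1 / (j - 1) - 1 / j\<close>.\<close>

lemma bounded_if_summable_growth:
  fixes a :: "nat \<Rightarrow> real"
  assumes J: "2 \<le> J" and D: "0 \<le> D" and pos: "\<And>j. 0 < a j"
    and step: "\<And>j. J \<le> j \<Longrightarrow> a (Suc j) \<le> a j * (1 + D / (real j)\<^sup>2)"
  shows "\<exists>B. \<forall>j\<ge>J. a j \<le> B"
proof -
  have "a j \<le> a J * exp (D / (real J - 1) - D / (real j - 1))" if "J \<le> j" for j
    using that
  proof (induction j rule: dec_induct)
    case (step j)
    have j: "2 \<le> real j" using step.hyps J by linarith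
    have "D * (1 / (real j)\<^sup>2) \<le> D * (1 / (real j - 1) - 1 / real j)"
      using j D by (intro mult_left_mono) (auto simp: field_simps power2_eq_square)
    then have le: "D / (real j)\<^sup>2 \<le> D / (real j - 1) - D / real j" by (simp add: right_diff_distrib)
    have "a (Suc j) \<le> a j * (1 + D / (real j)\<^sup>2)" using assms(4) step.hyps by blast
    also have "\<dots> \<le> a j * exp (D / (real j - 1) - D / real j)"
    proof (rule mult_left_mono)
      have "1 + D / (real j)\<^sup>2 \<le> exp (D / (real j)\<^sup>2)" by (rule exp_ge_add_one_self)
      also have "\<dots> \<le> exp (D / (real j - 1) - D / real j)" using le by simp
      finally show "1 + D / (real j)\<^sup>2 \<le> exp (D / (real j - 1) - D / real j)" .
    qed (use pos[of j] in simp)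
    also have "\<dots> \<le> a J * exp (D / (real J - 1) - D / (real j - 1)) * exp (D / (real j - 1) - D / real j)"
      using step.IH by (intro mult_right_mono) auto
    also have "\<dots> = a J * exp (D / (real J - 1) - D / (real (Suc j) - 1))"
      by (simp add: mult.assoc exp_add[symmetric])
    finally show ?case .
  qed simp
  moreover have "a J * exp (D / (real J - 1) - D / (real j - 1)) \<le> a J * exp (D / (real J - 1))" if "J \<le> j" for j
    using pos[of J] D J that by (intro mult_left_mono) auto
  ultimately show ?thesis by (meson order_trans)
qed

section \<open>Local expansion at the Denjoy-Wolff point\<close>

text \<open>The assumption \<open>arc\<close> is the trace that being inner leaves on the extension
  \<open>h\<close>, and \<open>step\<close> is the vanishing hyperbolic step in pseudohyperbolic
  form.\<close>

locale parabolic_orbit =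
  fixes g h :: "complex \<Rightarrow> complex" and e :: real
  assumes g: "g holomorphic_on ball 0 1" "g ` ball 0 1 \<subseteq> ball 0 1"
    and orbit: "(\<lambda>n. (g ^^ n) 0) \<longlonglongrightarrow> 1"
    and h: "h holomorphic_on ball 1 e" "0 < e" "\<And>z. z \<in> ball 1 e \<inter> ball 0 1 \<Longrightarrow> h z = g z"
    and arc: "\<And>d. 0 < d \<Longrightarrow> \<exists>\<zeta>. norm \<zeta> = 1 \<and> \<zeta> \<noteq> 1 \<and> norm (1 - \<zeta>) < d \<and> norm (h \<zeta>) = 1"
    and step: "(\<lambda>n. norm ((g ^^ n) 0 - (g ^^ Suc n) 0) / norm (1 - cnj ((g ^^ Suc n) 0) * (g ^^ n) 0)) \<longlonglongrightarrow> 0"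
begin

definition w :: "nat \<Rightarrow> complex" where "w n = (g ^^ n) 0"

lemma w_0 [simp]: "w 0 = 0" and w_Suc: "w (Suc n) = g (w n)"
  by (simp_all add: w_def)

lemma g_norm: "norm z < 1 \<Longrightarrow> norm (g z) < 1"
  using g(2) by (auto simp: image_subset_iff)

lemma w_norm: "norm (w n) < 1"
  by (induction n) (simp_all add: w_Suc g_norm)

lemma w_ne: "1 - w n \<noteq> 0" using w_norm[of n] by auto

lemma w_tendsto: "w \<longlonglongrightarrow> 1" using orbit by (simp add: w_def[abs_def])

lemma w_ball: "\<forall>\<^sub>F n in sequentially. w n \<in> ball 1 e"
  using tendstoD[OF w_tendsto h(2)] by (simp add: dist_commute)

definition \<rho> :: "nat \<Rightarrow> real" where "\<rho> n = norm (w n - w (Suc n)) / norm (1 - cnj (w (Suc n)) * w n)"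

lemma \<rho>: "\<rho> \<longlonglongrightarrow> 0" using step by (simp add: \<rho>_def[abs_def] w_def)

lemma \<rho>_nonneg: "0 \<le> \<rho> n" by (simp add: \<rho>_def)

lemma w_diff: "norm (w n - w (Suc n)) = \<rho> n * norm (1 - cnj (w (Suc n)) * w n)"
proof -
  have "norm (cnj (w (Suc n)) * w n) < 1"
    using w_norm[of n] w_norm[of "Suc n"] mult_strict_mono'[of "norm (w (Suc n))" 1 "norm (w n)" 1] by (simp add: norm_mult)
  then have "1 - cnj (w (Suc n)) * w n \<noteq> 0" by auto
  then show ?thesis by (simp add: \<rho>_def)
qed

text \<open>Wolff's lemma: infinitely often the orbit moves closer to the circle, and along such times
  the Schwarz-Pick inequality passes to the limit.\<close>

lemma Julia_Wolff:
  assumes z: "norm z < 1"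
  shows "Re (1 / (1 - z)) \<le> Re (1 / (1 - g z))"
proof -
  have gz: "norm (g z) < 1" by (rule g_norm[OF z])
  have ne: "z \<noteq> 1" "g z \<noteq> 1" using z gz by auto
  define l where "l k = (1 - (norm z)\<^sup>2) / (norm (1 - cnj (w k) * z))\<^sup>2" for k
  define r where "r k = (1 - (norm (g z))\<^sup>2) / (norm (1 - cnj (w (Suc k)) * g z))\<^sup>2" for k
  have l: "l \<longlonglongrightarrow> (1 - (norm z)\<^sup>2) / (norm (1 - z))\<^sup>2"
  proof -
    have "l \<longlonglongrightarrow> (1 - (norm z)\<^sup>2) / (norm (1 - cnj 1 * z))\<^sup>2"
      unfolding l_def using ne by (intro tendsto_intros w_tendsto) auto
    then show ?thesis by simp
  qed
  have r: "r \<longlonglongrightarrow> (1 - (norm (g z))\<^sup>2) / (norm (1 - g z))\<^sup>2"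
  proof -
    have "r \<longlonglongrightarrow> (1 - (norm (g z))\<^sup>2) / (norm (1 - cnj 1 * g z))\<^sup>2"
      unfolding r_def using ne by (intro tendsto_intros LIMSEQ_Suc[OF w_tendsto]) auto
    then show ?thesis by simp
  qed
  have "(1 - (norm z)\<^sup>2) / (norm (1 - z))\<^sup>2 \<le> (1 - (norm (g z))\<^sup>2) / (norm (1 - g z))\<^sup>2" (is "?L \<le> ?R")
  proof (rule ccontr)
    assume "\<not> ?L \<le> ?R"
    then obtain m where m: "?R < m" "m < ?L" using dense not_le by metis
    \<comment> \<open>If the limit inequality failed, the Schwarz-Pick inequality would make the
      moduli of the orbit eventually decrease, although they tend to 1.\<close>
    have "\<forall>\<^sub>F k in sequentially. norm (w (Suc k)) < norm (w k)"
      using order_tendstoD(2)[OF r m(1)] order_tendstoD(1)[OF l m(2)]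
    proof eventually_elim
      case (elim k)
      then have lt: "r k < l k" by simp
      have sq: "0 < 1 - (norm u)\<^sup>2" if "norm u < 1" for u :: complex
        using that by (simp add: abs_square_less_1)
      have r0: "0 \<le> r k" unfolding r_def using sq[OF gz] by simp
      have "l k * (1 - (norm (w k))\<^sup>2) \<le> r k * (1 - (norm (w (Suc k)))\<^sup>2)"
        using Schwarz_Pick_complement[OF g z w_norm[of k]] by (simp add: l_def r_def w_Suc)
      also have "\<dots> < l k * (1 - (norm (w (Suc k)))\<^sup>2)"
        using lt sq[OF w_norm[of "Suc k"]] by (rule mult_strict_right_mono)
      finally have "(norm (w (Suc k)))\<^sup>2 < (norm (w k))\<^sup>2" using lt r0 by simp
      then show ?case by (rule power2_less_imp_less) simp
    qed
    then obtain N where N: "\<And>k. N \<le> k \<Longrightarrow> norm (w (Suc k)) < norm (w k)" by (auto simp: eventually_sequentially)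
    have "norm (w k) \<le> norm (w N)" if "N \<le> k" for k
      using that by (induction k rule: dec_induct) (use N in \<open>auto intro: order_trans less_imp_le\<close>)
    then have "norm (1::complex) \<le> norm (w N)"
      by (intro LIMSEQ_le_const2[OF tendsto_norm[OF w_tendsto]]) auto
    then show False using w_norm[of N] by simp
  qed
  then show ?thesis using Re_inverse_one_minus[OF ne(1)] Re_inverse_one_minus[OF ne(2)] by simp
qed

lemma h_1: "h 1 = 1"
proof -
  have "isCont h 1"
    using h by (intro continuous_on_interior[of "ball 1 e"] holomorphic_on_imp_continuous_on) auto
  then have 1: "(\<lambda>n. h (w n)) \<longlonglongrightarrow> h 1" using w_tendsto by (rule isCont_tendsto_compose)
  have "\<forall>\<^sub>F n in sequentially. h (w n) = w (Suc n)"
    using w_ball by eventually_elim (use h(3) w_norm in \<open>auto simp: w_Suc\<close>)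
  then have "(\<lambda>n. w (Suc n)) \<longlonglongrightarrow> h 1" using 1 by (rule Lim_transform_eventually[rotated])
  then show ?thesis using LIMSEQ_unique[OF LIMSEQ_Suc[OF w_tendsto]] by simp
qed

text \<open>The derivative is the limit of the quotients \<open>r n\<close>. The denominator of the
  pseudohyperbolic step is at most the sum of the distances of both points to 1, so the vanishing
  step forces these quotients to 1.\<close>

lemma multiplier: "deriv h 1 = 1"
proof -
  define r where "r n = (1 - w (Suc n)) / (1 - w n)" for n
  have "(h has_field_derivative deriv h 1) (at 1)" using h by (intro holomorphic_derivI) auto
  then have "((\<lambda>y. (h y - h 1) / (y - 1)) \<longlongrightarrow> deriv h 1) (at 1)"
    by (simp add: has_field_derivative_iff)
  moreover have "filterlim w (at 1) sequentially"
    using w_tendsto w_ne by (auto simp: filterlim_at intro!: always_eventually)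
  ultimately have 1: "(\<lambda>n. (h (w n) - h 1) / (w n - 1)) \<longlonglongrightarrow> deriv h 1"
    by (rule filterlim_compose)
  have "\<forall>\<^sub>F n in sequentially. (h (w n) - h 1) / (w n - 1) = r n"
    using w_ball
  proof eventually_elim
    case (elim n)
    then have "h (w n) = w (Suc n)" using h(3) w_norm by (auto simp: w_Suc)
    then show ?case unfolding r_def h_1 by (metis minus_diff_eq minus_divide_divide)
  qed
  then have r: "r \<longlonglongrightarrow> deriv h 1" using 1 by (rule Lim_transform_eventually[rotated])
  have "norm (1 - r n) \<le> \<rho> n * (1 + norm (r n))" for n
  proof -
    have "1 - cnj (w (Suc n)) * w n = (1 - cnj (w (Suc n))) + cnj (w (Suc n)) * (1 - w n)" by (simp add: algebra_simps)
    then have "norm (1 - cnj (w (Suc n)) * w n) \<le> norm (1 - cnj (w (Suc n))) + norm (cnj (w (Suc n)) * (1 - w n))"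
      by (metis norm_triangle_ineq)
    also have "norm (1 - cnj (w (Suc n))) = norm (1 - w (Suc n))"
      by (metis complex_cnj_diff complex_cnj_one complex_mod_cnj)
    also have "norm (cnj (w (Suc n)) * (1 - w n)) \<le> 1 * norm (1 - w n)"
      unfolding norm_mult complex_mod_cnj using w_norm[of "Suc n"] by (intro mult_right_mono) auto
    finally have "norm (1 - cnj (w (Suc n)) * w n) \<le> norm (1 - w (Suc n)) + norm (1 - w n)" by simp
    then have "norm (w n - w (Suc n)) \<le> \<rho> n * (norm (1 - w (Suc n)) + norm (1 - w n))"
      unfolding w_diff by (intro mult_left_mono \<rho>_nonneg)
    then have "norm (w n - w (Suc n)) / norm (1 - w n) \<le> \<rho> n * (norm (1 - w (Suc n)) + norm (1 - w n)) / norm (1 - w n)"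
      by (intro divide_right_mono) auto
    also have "\<dots> = \<rho> n * (1 + norm (r n))"
      using w_ne[of n] by (simp add: r_def norm_divide add_divide_distrib[symmetric] field_simps)
    also have "norm (w n - w (Suc n)) / norm (1 - w n) = norm (1 - r n)"
    proof -
      have "1 - r n = (w (Suc n) - w n) / (1 - w n)" using w_ne[of n] by (simp add: r_def field_simps)
      then show ?thesis by (simp add: norm_divide norm_minus_commute)
    qed
    finally show ?thesis .
  qed
  moreover have "(\<lambda>n. norm (1 - r n)) \<longlonglongrightarrow> norm (1 - deriv h 1)" by (intro tendsto_intros r)
  moreover have "(\<lambda>n. \<rho> n * (1 + norm (r n))) \<longlonglongrightarrow> 0 * (1 + norm (deriv h 1))" by (intro tendsto_intros r \<rho>)
  ultimately have "norm (1 - deriv h 1) \<le> 0 * (1 + norm (deriv h 1))" by (intro LIMSEQ_le) auto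
  then show ?thesis by simp
qed

lemma expansion:
  obtains b c C d where "0 < d" "d \<le> e" "0 \<le> C"
    "\<And>z. \<lbrakk>z \<noteq> 1; norm (1 - z) < d\<rbrakk> \<Longrightarrow> h z \<noteq> 1 \<and>
       norm (1 / (1 - h z) - (1 / (1 - z) + b + c * (1 - z))) \<le> C * (norm (1 - z))\<^sup>2"
proof -
  define f where "f u = 1 - h (1 - u)" for u
  have im: "(\<lambda>u. 1 - u) ` ball 0 e \<subseteq> ball (1::complex) e" by (auto simp: dist_norm)
  have hol: "f holomorphic_on ball 0 e"
    unfolding f_def[abs_def]
    by (intro holomorphic_on_diff holomorphic_on_const holomorphic_on_compose_gen[OF _ h(1) im, unfolded o_def] holomorphic_intros)
  have "(h has_field_derivative 1) (at (1 - 0))" using h multiplier holomorphic_derivI[OF h(1), of 1] by simp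
  then have "(f has_field_derivative 1) (at 0)"
    unfolding f_def[abs_def] by (auto intro!: derivative_eq_intros DERIV_chain2[of h])
  then have "deriv f 0 = 1" by (rule DERIV_imp_deriv)
  moreover have "f 0 = 0" by (simp add: f_def h_1)
  ultimately obtain b c C d where *: "0 < d" "d \<le> e" "0 \<le> C"
    "\<And>u. \<lbrakk>u \<noteq> 0; norm u < d\<rbrakk> \<Longrightarrow> f u \<noteq> 0 \<and> norm (1 / f u - (1 / u + b + c * u)) \<le> C * (norm u)\<^sup>2"
    using reciprocal_expansion[OF hol h(2)] by metis
  show thesis
  proof
    fix z :: complex assume "z \<noteq> 1" "norm (1 - z) < d"
    then show "h z \<noteq> 1 \<and> norm (1 / (1 - h z) - (1 / (1 - z) + b + c * (1 - z))) \<le> C * (norm (1 - z))\<^sup>2"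
      using *(4)[of "1 - z"] by (simp add: f_def)
  qed (use * in auto)
qed

end

locale parabolic_expansion = parabolic_orbit +
  fixes b c :: complex and C d :: real
  assumes d: "0 < d" "d \<le> e" and C: "0 \<le> C"
    and expand: "\<And>z. \<lbrakk>z \<noteq> 1; norm (1 - z) < d\<rbrakk> \<Longrightarrow> h z \<noteq> 1 \<and>
       norm (1 / (1 - h z) - (1 / (1 - z) + b + c * (1 - z))) \<le> C * (norm (1 - z))\<^sup>2"
begin

text \<open>On the unit circle \<open>1 / (1 - z)\<close> has real part 1/2. At the points of
  \<open>arc\<close> this holds both for the point and for its image, so the real part of the
  expansion leaves \<open>Re b\<close> of the order of the distance to 1.\<close>

lemma Re_b: "Re b = 0"
proof (rule ccontr)
  assume b: "Re b \<noteq> 0"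
  \<comment> \<open>The second bound keeps the error \<open>(norm c + C) * s\<close> below
    \<open>\<bar>Re b\<bar>\<close>; the summand 1 makes the denominator positive.\<close>
  define \<delta> where "\<delta> = min (min d 1) (\<bar>Re b\<bar> / (2 * (norm c + C + 1)))"
  have den: "0 < norm c + C + 1" using C by (simp add: add_nonneg_pos)
  have "0 < \<delta>" using d b den by (simp add: \<delta>_def)
  then obtain \<zeta> where \<zeta>: "norm \<zeta> = 1" "\<zeta> \<noteq> 1" "norm (1 - \<zeta>) < \<delta>" "norm (h \<zeta>) = 1" using arc by blast
  define s where "s = norm (1 - \<zeta>)"
  have s: "0 \<le> s" "s < d" "s < 1" "s * (2 * (norm c + C + 1)) < \<bar>Re b\<bar>"
    using \<zeta>(3) den by (auto simp: s_def \<delta>_def pos_less_divide_eq)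
  have hz: "h \<zeta> \<noteq> 1" and r: "norm (1 / (1 - h \<zeta>) - (1 / (1 - \<zeta>) + b + c * (1 - \<zeta>))) \<le> C * s\<^sup>2"
    using expand[of \<zeta>] \<zeta>(2) s by (auto simp: s_def)
  have "Re (1 / (1 - h \<zeta>)) = 1 / 2" "Re (1 / (1 - \<zeta>)) = 1 / 2"
    using Re_inverse_one_minus[OF hz] Re_inverse_one_minus[OF \<zeta>(2)] \<zeta>(1,4) by simp_all
  then have "Re (1 / (1 - h \<zeta>) - (1 / (1 - \<zeta>) + b + c * (1 - \<zeta>))) = - Re b - Re (c * (1 - \<zeta>))"
    by (simp only: minus_complex.sel plus_complex.sel)
  then have "\<bar>Re b + Re (c * (1 - \<zeta>))\<bar> \<le> C * s\<^sup>2"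
    using abs_Re_le_cmod[of "1 / (1 - h \<zeta>) - (1 / (1 - \<zeta>) + b + c * (1 - \<zeta>))"] r by linarith
  moreover have "\<bar>Re (c * (1 - \<zeta>))\<bar> \<le> norm c * s"
    using abs_Re_le_cmod[of "c * (1 - \<zeta>)"] by (simp add: norm_mult s_def)
  moreover have "C * s\<^sup>2 \<le> C * s" using C s by (intro mult_left_mono) (auto simp: power2_eq_square mult_left_le)
  ultimately have "\<bar>Re b\<bar> \<le> (norm c + C) * s" by (simp add: distrib_right)
  also have "\<dots> \<le> s * (2 * (norm c + C + 1))"
  proof -
    have "s * (norm c + C) \<le> s * (2 * (norm c + C + 1))" using s(1) C by (intro mult_left_mono) auto
    then show ?thesis by (simp add: mult.commute)
  qed
  also have "\<dots> < \<bar>Re b\<bar>" by (rule s(4))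
  finally show False by simp
qed

text \<open>For large \<open>n\<close> the point \<open>1 - v / n\<close> lies in the disc, where
  \<open>Julia_Wolff\<close> makes the real increment nonnegative. As \<open>Re b = 0\<close>, this
  increment is \<open>Re (c * v) / n\<close> up to order \<open>1 / n\<^sup>2\<close>.\<close>

lemma Re_c_direction:
  assumes v: "0 < Re v"
  shows "0 \<le> Re (c * v)"
proof -
  have v0: "v \<noteq> 0" using v by auto
  have ev: "\<forall>\<^sub>F n in sequentially. - (C * (norm v)\<^sup>2) / real n \<le> Re (c * v)"
  proof -
    have lim: "(\<lambda>n. v / of_nat n) \<longlonglongrightarrow> 0" by (rule lim_const_over_n)
    have "\<forall>\<^sub>F n in sequentially. norm (v / of_nat n) < d"
      using tendstoD[OF lim d(1)] by simp
    moreover have "\<forall>\<^sub>F n in sequentially. (norm v)\<^sup>2 / Re v < real n"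
      using filterlim_real_sequentially filterlim_at_top_dense by blast
    moreover have "\<forall>\<^sub>F n in sequentially. 0 < n" by (rule eventually_gt_at_top)
    ultimately show ?thesis
    proof eventually_elim
      case (elim n)
      define u where "u = v / of_nat n"
      have u0: "u \<noteq> 0" using v0 elim by (simp add: u_def)
      define z where "z = 1 - u"
      have z1: "z \<noteq> 1" using u0 by (simp add: z_def)
      have "Re (1 / u) = real n * Re v / (norm v)\<^sup>2"
        unfolding u_def by (simp add: Re_divide cmod_power2)
      moreover have "(norm v)\<^sup>2 < real n * Re v" using elim(2) v by (simp add: pos_divide_less_eq)
      then have "1 < real n * Re v / (norm v)\<^sup>2" using v0 by (simp add: pos_less_divide_eq)
      ultimately have "1 / 2 < Re (1 / u)" by linarith
      then have "0 < (1 - (norm z)\<^sup>2) / (2 * (norm (1 - z))\<^sup>2)"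
        using Re_inverse_one_minus[OF z1] by (simp add: z_def)
      then have "(norm z)\<^sup>2 < 1" using z1 by (simp add: zero_less_divide_iff)
      then have zn: "norm z < 1" by (simp add: abs_square_less_1)
      have nu: "norm (1 - z) < d" using elim(1) by (simp add: z_def u_def)
      then have "h z = g z" using d(2) zn by (intro h(3)) (auto simp: dist_norm)
      then have "0 \<le> Re (1 / (1 - h z)) - Re (1 / (1 - z))" using Julia_Wolff[OF zn] by simp
      moreover have "Re (1 / (1 - h z) - (1 / (1 - z) + b + c * (1 - z))) \<le> C * (norm (1 - z))\<^sup>2"
        using expand[OF z1 nu] complex_Re_le_cmod order_trans by blast
      then have "Re (1 / (1 - h z)) - (Re (1 / (1 - z)) + Re b + Re (c * u)) \<le> C * (norm u)\<^sup>2"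
        by (simp add: z_def)
      ultimately have "- (C * (norm u)\<^sup>2) \<le> Re (c * u)" using Re_b by linarith
      then have "real n * - (C * (norm u)\<^sup>2) \<le> real n * Re (c * u)" by (intro mult_left_mono) auto
      moreover have "real n * - (C * (norm u)\<^sup>2) = - (C * (norm v)\<^sup>2) / real n"
        using elim(3) by (simp add: u_def norm_divide power2_eq_square)
      moreover have "real n * Re (c * u) = Re (c * v)"
        using elim(3) by (simp add: u_def Re_divide power2_eq_square field_simps)
      ultimately show ?case by simp
    qed
  qed
  have "(\<lambda>n. - (C * (norm v)\<^sup>2) / real n) \<longlonglongrightarrow> 0" by (rule lim_const_over_n)
  then show ?thesis using ev by (rule tendsto_upperbound) simp
qed

lemma Im_c: "Im c = 0"
proof (rule ccontr)
  assume "Im c \<noteq> 0"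
  \<comment> \<open>This direction is chosen so that \<open>Re (c * v) = -1\<close>.\<close>
  moreover have "0 \<le> Re (c * Complex 1 ((Re c + 1) / Im c))" by (rule Re_c_direction) simp
  ultimately show False by simp
qed

section \<open>The orbit in the half-plane coordinate\<close>

definition W :: "nat \<Rightarrow> complex" where "W n = 1 / (1 - w n)"

lemma W_ne: "W n \<noteq> 0" using w_ne[of n] by (simp add: W_def)

lemma w_eq: "1 - w n = 1 / W n" by (simp add: W_def)

lemma Re_W: "1 / 2 < Re (W n)" "Re (W n) - 1 / 2 = (1 - (norm (w n))\<^sup>2) * (norm (W n))\<^sup>2 / 2"
proof -
  show eq: "Re (W n) - 1 / 2 = (1 - (norm (w n))\<^sup>2) * (norm (W n))\<^sup>2 / 2"
    using Re_inverse_one_minus[of "w n"] w_ne[of n] unfolding W_def by (simp add: norm_divide power_divide)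
  have "0 < 1 - (norm (w n))\<^sup>2" using w_norm[of n] by (simp add: abs_square_less_1)
  then have "0 < (1 - (norm (w n))\<^sup>2) * (norm (W n))\<^sup>2 / 2" using W_ne by simp
  then show "1 / 2 < Re (W n)" using eq by linarith
qed

definition R :: "nat \<Rightarrow> complex" where "R n = W (Suc n) - (W n + b + c / W n)"

lemma R_bound: "\<forall>\<^sub>F n in sequentially. norm (R n) \<le> C / (norm (W n))\<^sup>2"
proof -
  have "\<forall>\<^sub>F n in sequentially. norm (1 - w n) < d"
    using tendstoD[OF w_tendsto d(1)] by (simp add: dist_norm norm_minus_commute)
  then show ?thesis
  proof eventually_elim
    case (elim n)
    have ne: "w n \<noteq> 1" using w_ne[of n] by simp
    have "h (w n) = w (Suc n)" using elim d(2) w_norm[of n] h(3)[of "w n"] by (simp add: w_Suc dist_norm)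
    then have "norm (1 / (1 - w (Suc n)) - (1 / (1 - w n) + b + c * (1 - w n))) \<le> C * (norm (1 - w n))\<^sup>2"
      using expand[OF ne elim] by simp
    then show ?case by (simp add: R_def W_def norm_divide power_divide)
  qed
qed

lemma W_inverse_tendsto: "(\<lambda>n. 1 / W n) \<longlonglongrightarrow> 0"
proof -
  have "(\<lambda>n. 1 - w n) \<longlonglongrightarrow> 1 - 1" by (intro tendsto_intros w_tendsto)
  then show ?thesis by (simp add: w_eq)
qed

lemma R_tendsto: "(\<lambda>n. W n * R n) \<longlonglongrightarrow> 0" "R \<longlonglongrightarrow> 0"
proof -
  have i: "(\<lambda>n. norm (1 / W n)) \<longlonglongrightarrow> 0" using W_inverse_tendsto by (rule tendsto_norm_zero)
  have lim: "(\<lambda>n. C * norm (1 / W n)) \<longlonglongrightarrow> 0" using tendsto_mult_left[OF i, of C] by simp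
  have le: "\<forall>\<^sub>F n in sequentially. norm (W n * R n) \<le> C * norm (1 / W n)"
    using R_bound
  proof eventually_elim
    case (elim n)
    have "norm (W n * R n) \<le> norm (W n) * (C / (norm (W n))\<^sup>2)"
      unfolding norm_mult using elim by (rule mult_left_mono) simp
    then show ?case using W_ne[of n] by (simp add: power2_eq_square norm_divide)
  qed
  show *: "(\<lambda>n. W n * R n) \<longlonglongrightarrow> 0" by (rule Lim_null_comparison[OF le lim])
  have "(\<lambda>n. 1 / W n * (W n * R n)) \<longlonglongrightarrow> 0 * 0" by (rule tendsto_mult[OF W_inverse_tendsto *])
  then show "R \<longlonglongrightarrow> 0" using W_ne by simp
qed

lemma W_step: "(\<lambda>n. W (Suc n) - W n) \<longlonglongrightarrow> b"
proof -
  have "(\<lambda>n. b + c * (1 / W n) + R n) \<longlonglongrightarrow> b + c * 0 + 0"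
    by (intro tendsto_intros W_inverse_tendsto R_tendsto)
  then show ?thesis by (simp add: R_def algebra_simps)
qed

lemma linear_growth:
  fixes x :: "nat \<Rightarrow> complex"
  assumes "\<And>n. N \<le> n \<Longrightarrow> norm (x (Suc n) - x n - a) \<le> \<eta>"
  shows "norm (x (N + j) - x N - of_nat j * a) \<le> real j * \<eta>"
proof (induction j)
  case (Suc j)
  have "x (N + Suc j) - x N - of_nat (Suc j) * a = (x (N + j) - x N - of_nat j * a) + (x (Suc (N + j)) - x (N + j) - a)"
    by (simp add: algebra_simps)
  then have "norm (x (N + Suc j) - x N - of_nat (Suc j) * a) \<le> real j * \<eta> + \<eta>"
    using Suc assms[of "N + j"] norm_triangle_mono by (metis le_add1)
  then show ?case by (simp add: algebra_simps)
qed simp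

text \<open>If the orbit moved horizontally like \<open>n b\<close>, its height would stay bounded, and steps of
  length \<open>b\<close> at bounded height have hyperbolic length bounded below.\<close>

lemma b_0: "b = 0"
proof (rule ccontr)
  assume b: "b \<noteq> 0"
  have "\<exists>B. \<forall>n. Re (W n) \<le> B"
  proof -
    have "\<forall>\<^sub>F n in sequentially. dist (W (Suc n) - W n) b < norm b / 2"
      using W_step b by (intro tendstoD) auto
    with R_bound have "\<forall>\<^sub>F n in sequentially. norm (R n) \<le> C / (norm (W n))\<^sup>2 \<and> dist (W (Suc n) - W n) b < norm b / 2"
      by (rule eventually_conj)
    then obtain N where N: "\<And>n. N \<le> n \<Longrightarrow> norm (R n) \<le> C / (norm (W n))\<^sup>2"
        "\<And>n. N \<le> n \<Longrightarrow> norm (W (Suc n) - W n - b) \<le> norm b / 2"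
      unfolding eventually_sequentially dist_norm by (meson less_imp_le)
    obtain J0 :: nat where J0: "norm (W N) / (norm b / 4) \<le> real J0" using real_arch_simple by blast
    define J where "J = max 2 J0"
    have J: "norm (W N) \<le> real j * (norm b / 4)" if "J \<le> j" for j
    proof -
      have "norm (W N) \<le> real J0 * (norm b / 4)" using J0 b by (simp add: pos_divide_le_eq)
      also have "\<dots> \<le> real j * (norm b / 4)" using that by (intro mult_right_mono) (auto simp: J_def)
      finally show ?thesis .
    qed
    have low: "real j * (norm b / 4) \<le> norm (W (N + j))" if "J \<le> j" for j
    proof -
      have "norm (of_nat j * b) \<le> norm (W (N + j) - W N - of_nat j * b) + norm (W (N + j) - W N)"
        by (metis norm_minus_commute norm_triangle_sub add.commute)
      moreover have "norm (W (N + j) - W N) \<le> norm (W (N + j)) + norm (W N)" by (rule norm_triangle_ineq4)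
      moreover have "norm (W (N + j) - W N - of_nat j * b) \<le> real j * (norm b / 2)" by (rule linear_growth) (rule N(2))
      moreover have "norm (of_nat j * b) = real j * norm b" by (simp add: norm_mult)
      ultimately show ?thesis using J[OF that] by (simp add: field_simps)
    qed
    \<comment> \<open>The lower bound \<open>j * norm b / 4\<close> of
      \<open>norm (W (N + j))\<close> enters squared, which gives the 16.\<close>
    define D where "D = (norm c + 2 * C) * (16 / (norm b)\<^sup>2)"
    have D0: "0 \<le> D" unfolding D_def using C by simp
    have "\<exists>B. \<forall>j\<ge>J. Re (W (N + j)) \<le> B"
    proof (rule bounded_if_summable_growth[OF _ D0])
      show "2 \<le> J" by (simp add: J_def)
      show "0 < Re (W (N + j))" for j using Re_W(1)[of "N + j"] by linarith
      fix j assume j: "J \<le> j"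
      let ?X = "Re (W (N + j))" and ?n = "norm (W (N + j))"
      have X: "1 / 2 < ?X" by (rule Re_W(1))
      have jpos: "0 < real j" using j by (simp add: J_def)
      have "Re (c / W (N + j)) = Re c * ?X / ?n\<^sup>2" using Im_c by (simp add: Re_divide cmod_power2)
      also have "\<dots> \<le> norm c * ?X / ?n\<^sup>2"
        using X complex_Re_le_cmod[of c] by (intro divide_right_mono mult_right_mono) auto
      finally have 1: "Re (c / W (N + j)) \<le> norm c * ?X / ?n\<^sup>2" .
      \<comment> \<open>Because the real part exceeds 1/2, the additive error can be charged to it;
        only relative growth remains, as \<open>bounded_if_summable_growth\<close> asks.\<close>
      have "Re (R (N + j)) \<le> C / ?n\<^sup>2" using N(1)[of "N + j"] complex_Re_le_cmod[of "R (N + j)"] by simp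
      also have "\<dots> \<le> 2 * C * ?X / ?n\<^sup>2" using X C mult_left_mono[of 1 "2 * ?X" C] by (intro divide_right_mono) auto
      finally have 2: "Re (R (N + j)) \<le> 2 * C * ?X / ?n\<^sup>2" .
      have "W (N + Suc j) = W (N + j) + b + c / W (N + j) + R (N + j)" by (simp add: R_def)
      then have "Re (W (N + Suc j)) = ?X + Re (c / W (N + j)) + Re (R (N + j))" using Re_b by simp
      also have "\<dots> \<le> ?X + (norm c + 2 * C) * ?X / ?n\<^sup>2" using 1 2 by (simp add: add_divide_distrib distrib_right)
      also have "(norm c + 2 * C) * ?X / ?n\<^sup>2 \<le> (norm c + 2 * C) * ?X / (real j * (norm b / 4))\<^sup>2"
        using low[OF j] X C b jpos by (intro divide_left_mono power_mono mult_pos_pos mult_nonneg_nonneg) (auto simp: W_ne)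
      also have "?X + (norm c + 2 * C) * ?X / (real j * (norm b / 4))\<^sup>2 = ?X * (1 + D / (real j)\<^sup>2)"
        by (simp add: D_def power_mult_distrib power_divide algebra_simps add_divide_distrib)
      finally show "Re (W (N + Suc j)) \<le> ?X * (1 + D / (real j)\<^sup>2)" by simp
    qed
    then obtain B where B: "\<And>j. J \<le> j \<Longrightarrow> Re (W (N + j)) \<le> B" by blast
    define B' where "B' = max B (Max ((\<lambda>n. Re (W n)) ` {..N + J}))"
    have "Re (W n) \<le> B'" for n
    proof (cases "N + J \<le> n")
      case True
      then have "J \<le> n - N" "N + (n - N) = n" by simp_all
      then show ?thesis using B[of "n - N"] by (simp add: B'_def)
    next
      case False
      then have "Re (W n) \<le> Max ((\<lambda>n. Re (W n)) ` {..N + J})" by (intro Max_ge) auto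
      then show ?thesis by (simp add: B'_def)
    qed
    then show ?thesis by blast
  qed
  then obtain B where B: "\<And>n. Re (W n) \<le> B" by blast
  \<comment> \<open>In this coordinate the pseudohyperbolic distance of \<open>V\<close> and
    \<open>V'\<close> is \<open>norm (V - V') / norm (V + cnj V' - 1)\<close>; bounded real parts
    bound the denominator by the step plus a constant.\<close>
  have "norm (W n - W (Suc n)) \<le> \<rho> n * (norm (W n - W (Suc n)) + 2 * B)" for n
  proof -
    let ?V = "W n" and ?V' = "W (Suc n)"
    have w1: "w n = 1 - 1 / ?V" "w (Suc n) = 1 - 1 / ?V'" using w_eq[of n] w_eq[of "Suc n"] by (simp_all add: algebra_simps)
    have ne: "?V \<noteq> 0" "?V' \<noteq> 0" "cnj ?V' \<noteq> 0" using W_ne by auto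
    have "w n - w (Suc n) = (?V - ?V') / (?V * ?V')" unfolding w1 using ne by (simp add: field_simps)
    then have 1: "norm (w n - w (Suc n)) = norm (?V - ?V') / (norm ?V * norm ?V')" by (simp add: norm_divide norm_mult)
    have "1 - cnj (w (Suc n)) * w n = (?V + cnj ?V' - 1) / (?V * cnj ?V')" unfolding w1 using ne by (simp add: field_simps)
    then have 2: "norm (1 - cnj (w (Suc n)) * w n) = norm (?V + cnj ?V' - 1) / (norm ?V * norm ?V')" by (simp add: norm_divide norm_mult)
    have "norm (?V - ?V') = \<rho> n * norm (?V + cnj ?V' - 1)"
      using w_diff[of n] ne unfolding 1 2 by (simp add: field_simps)
    also have "?V + cnj ?V' - 1 = (?V - ?V') + of_real (2 * Re ?V' - 1)" by (simp add: complex_eq_iff)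
    also have "norm ((?V - ?V') + of_real (2 * Re ?V' - 1)) \<le> norm (?V - ?V') + 2 * B"
    proof (intro norm_triangle_mono order_refl)
      show "norm (complex_of_real (2 * Re ?V' - 1)) \<le> 2 * B"
        using B[of "Suc n"] Re_W(1)[of "Suc n"] unfolding norm_of_real by linarith
    qed
    finally show ?thesis using \<rho>_nonneg[of n] by (simp add: mult_left_mono)
  qed
  moreover have "(\<lambda>n. norm (W n - W (Suc n))) \<longlonglongrightarrow> norm b"
    using tendsto_norm[OF W_step] by (simp add: norm_minus_commute)
  moreover from this have "(\<lambda>n. \<rho> n * (norm (W n - W (Suc n)) + 2 * B)) \<longlonglongrightarrow> 0 * (norm b + 2 * B)"
    by (intro tendsto_mult[OF \<rho>] tendsto_add tendsto_const)
  ultimately have "norm b \<le> 0 * (norm b + 2 * B)" by (intro LIMSEQ_le) auto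
  then show False using b by simp
qed

text \<open>The increment \<open>k\<close> has nonnegative real part, so by Harnack's inequality it
  decays at most linearly along the radius to 1, while \<open>b = 0\<close> makes it
  \<open>c * (1 - x)\<close> to first order. The case \<open>Re (k 0) = 0\<close> would make
  \<open>k\<close> constant by the open mapping theorem, hence 0, and then 0 would be a fixed point
  of \<open>g\<close>, against the convergence of the orbit to 1.\<close>

lemma Re_c_pos: "0 < Re c"
proof -
  define k where "k z = 1 / (1 - g z) - 1 / (1 - z)" for z
  have hol: "k holomorphic_on ball 0 1"
    unfolding k_def[abs_def] using g_norm by (intro holomorphic_intros g) force+
  have pos: "0 \<le> Re (k z)" if "norm z < 1" for z using Julia_Wolff[OF that] by (simp add: k_def)
  have small: "norm (k (of_real x)) \<le> norm c * (1 - x) + C * (1 - x)\<^sup>2" "Re (k (of_real x)) \<le> Re c * (1 - x) + C * (1 - x)\<^sup>2"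
    if x: "0 < x" "x < 1" "1 - x < d" for x :: real
  proof -
    have n1: "norm (1 - complex_of_real x) = 1 - x"
      using x by (metis abs_of_pos diff_gt_0_iff_gt norm_of_real of_real_1 of_real_diff)
    have "h (of_real x) = g (of_real x)" using x d(2) n1 by (intro h(3)) (auto simp: dist_norm)
    then have "norm (k (of_real x) - c * (1 - of_real x)) \<le> C * (1 - x)\<^sup>2"
      using expand[of "of_real x"] x b_0 n1 by (simp add: k_def algebra_simps)
    moreover have "norm (c * (1 - of_real x)) = norm c * (1 - x)" by (simp add: norm_mult n1)
    ultimately show "norm (k (of_real x)) \<le> norm c * (1 - x) + C * (1 - x)\<^sup>2"
      using norm_triangle_sub[of "k (of_real x)" "c * (1 - of_real x)"] by linarith
    have "Re (k (of_real x) - c * (1 - of_real x)) \<le> C * (1 - x)\<^sup>2"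
      using \<open>norm (k (of_real x) - c * (1 - of_real x)) \<le> C * (1 - x)\<^sup>2\<close> complex_Re_le_cmod order_trans by blast
    then show "Re (k (of_real x)) \<le> Re c * (1 - x) + C * (1 - x)\<^sup>2" by simp
  qed
  define x where "x n = 1 - 1 / real (n + 2)" for n
  have x: "0 < x n" "x n < 1" for n by (auto simp: x_def field_simps)
  have x1: "(\<lambda>n. 1 - x n) \<longlonglongrightarrow> 0"
    unfolding x_def using LIMSEQ_ignore_initial_segment[OF lim_1_over_n, of 2] by simp
  have xd: "\<forall>\<^sub>F n in sequentially. 1 - x n < d" using order_tendstoD(2)[OF x1 d(1)] .
  have k0: "Re (k 0) \<noteq> 0"
  proof
    assume 0: "Re (k 0) = 0"
    have "k constant_on ball 0 1"
    proof (rule ccontr)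
      assume "\<not> k constant_on ball 0 1"
      then have "open (k ` ball 0 1)"
        by (intro open_mapping_thm[OF hol open_ball connected_ball open_ball order_refl])
      moreover have "k 0 \<in> k ` ball 0 1" by simp
      ultimately obtain \<eta> where \<eta>: "0 < \<eta>" "ball (k 0) \<eta> \<subseteq> k ` ball 0 1" by (meson openE)
      have "k 0 - of_real (\<eta> / 2) \<in> ball (k 0) \<eta>" using \<eta>(1) by (simp add: dist_norm)
      then have "k 0 - of_real (\<eta> / 2) \<in> k ` ball 0 1" using \<eta>(2) by blast
      then obtain z where z2: "k 0 - of_real (\<eta> / 2) = k z" and "z \<in> ball 0 1" by (rule imageE)
      then have z: "norm z < 1" by simp
      have "Re (k z) = - (\<eta> / 2)" unfolding z2[symmetric] using 0 by simp
      then show False using pos[OF z] \<eta>(1) by simp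
    qed
    then obtain k1 where k1: "\<And>z. norm z < 1 \<Longrightarrow> k z = k1" by (auto simp: constant_on_def)
    have "\<forall>\<^sub>F n in sequentially. norm k1 \<le> norm c * (1 - x n) + C * (1 - x n)\<^sup>2"
      using xd by eventually_elim (use small(1) x k1 in \<open>force simp: norm_of_real\<close>)
    moreover have "(\<lambda>n. norm c * (1 - x n) + C * (1 - x n)\<^sup>2) \<longlonglongrightarrow> norm c * 0 + C * 0\<^sup>2"
      by (intro tendsto_intros x1)
    ultimately have "norm k1 \<le> norm c * 0 + C * 0\<^sup>2" by (intro tendsto_lowerbound[of _ _ sequentially]) auto
    then have "k 0 = 0" using k1[of 0] by simp
    then have "1 / (1 - g 0) = 1" by (simp add: k_def)
    then have "g 0 = 0" by (simp add: divide_eq_1_iff)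
    then have "w n = 0" for n by (induction n) (simp_all add: w_Suc)
    then have "w \<longlonglongrightarrow> 0" by (simp add: tendsto_eventually)
    then show False using LIMSEQ_unique[OF w_tendsto] by fastforce
  qed
  then have k0: "0 < Re (k 0)" using pos[of 0] by simp
  have "\<forall>\<^sub>F n in sequentially. Re (k 0) / 2 \<le> Re c + C * (1 - x n)"
    using xd
  proof eventually_elim
    case (elim n)
    have n: "norm (complex_of_real (x n)) = x n" using x[of n] by simp
    have "(1 - x n) * (Re (k 0) / 2) \<le> (1 - x n) / (1 + x n) * Re (k 0)"
    proof -
      have "(1 - x n) / 2 \<le> (1 - x n) / (1 + x n)" using x[of n] by (intro divide_left_mono) auto
      from mult_right_mono[OF this, of "Re (k 0)"] k0 show ?thesis by simp
    qed
    also have "\<dots> \<le> Re (k (of_real (x n)))" using Harnack_Re[OF hol pos, of "of_real (x n)"] x[of n] n by simp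
    also have "\<dots> \<le> (1 - x n) * (Re c + C * (1 - x n))"
      using small(2)[of "x n"] x[of n] elim by (simp add: algebra_simps power2_eq_square)
    finally show ?case using x[of n] by simp
  qed
  moreover have "(\<lambda>n. Re c + C * (1 - x n)) \<longlonglongrightarrow> Re c + C * 0" by (intro tendsto_intros x1)
  ultimately have "Re (k 0) / 2 \<le> Re c + C * 0" by (intro tendsto_lowerbound[of _ _ sequentially]) auto
  then show ?thesis using k0 by simp
qed

text \<open>Squaring removes the dependence of the step on position: \<open>W\<close> moves by about
  \<open>c / W\<close>, and the cross term in the square is \<open>2 * c\<close>.\<close>

lemma W_square_step: "(\<lambda>n. (W (Suc n))\<^sup>2 - (W n)\<^sup>2) \<longlonglongrightarrow> 2 * c"
proof -
  have "(W (Suc n))\<^sup>2 - (W n)\<^sup>2 = 2 * c + 2 * (W n * R n) + (c * (1 / W n) + R n)\<^sup>2" for n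
  proof -
    have "W (Suc n) = W n + (c * (1 / W n) + R n)" unfolding R_def by (simp add: b_0)
    moreover have "W n * (c * (1 / W n)) = c" using W_ne by simp
    ultimately show ?thesis by (simp add: power2_eq_square algebra_simps)
  qed
  moreover have "(\<lambda>n. 2 * c + 2 * (W n * R n) + (c * (1 / W n) + R n)\<^sup>2) \<longlonglongrightarrow> 2 * c + 2 * 0 + (c * 0 + 0)\<^sup>2"
    by (intro tendsto_intros R_tendsto W_inverse_tendsto)
  ultimately show ?thesis by simp
qed

text \<open>As \<open>(W n)\<^sup>2\<close> stays close to \<open>2 * c * n\<close> with
  \<open>c\<close> positive, \<open>W n\<close> remains in the sector where its modulus is at most
  \<open>sqrt 2\<close> times its real part, and the modulus is at most of order
  \<open>sqrt n\<close>. This bounds \<open>1 - (norm (w n))\<^sup>2\<close>, that is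
  \<open>(2 * Re (W n) - 1) / (norm (W n))\<^sup>2\<close>, from below.\<close>

lemma eventually_lower_bound:
  obtains \<gamma> :: real where "0 < \<gamma>" "\<forall>\<^sub>F n in sequentially. \<gamma> / sqrt (real n + 1) \<le> (1 - norm (w n)) / (1 + norm (w n))"
proof -
  define r where "r = Re c"
  have r: "0 < r" "c = of_real r" using Re_c_pos Im_c by (auto simp: r_def complex_eq_iff)
  have "\<forall>\<^sub>F n in sequentially. dist ((W (Suc n))\<^sup>2 - (W n)\<^sup>2) (2 * c) < r / 2"
    using W_square_step r by (intro tendstoD) auto
  then obtain N where N: "\<And>n. N \<le> n \<Longrightarrow> norm ((W (Suc n))\<^sup>2 - (W n)\<^sup>2 - 2 * c) \<le> r / 2"
    unfolding eventually_sequentially dist_norm by (meson less_imp_le)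
  have near: "norm ((W (N + j))\<^sup>2 - (W N)\<^sup>2 - of_nat j * (2 * c)) \<le> real j * (r / 2)" for j
    by (rule linear_growth[of N "\<lambda>n. (W n)\<^sup>2"]) (rule N)
  obtain J :: nat where J: "2 * (norm (W N))\<^sup>2 / r \<le> real J" using real_arch_simple by blast
  \<comment> \<open>The factor \<open>sqrt (3 * r)\<close> comes from the growth of the modulus,
    \<open>sqrt 2\<close> from the sector, and 4 from
    \<open>(1 - t\<^sup>2) / 4 \<le> (1 - t) / (1 + t)\<close>.\<close>
  have main: "1 / (4 * sqrt 2 * sqrt (3 * r)) / sqrt (real (N + j) + 1) \<le> (1 - norm (w (N + j))) / (1 + norm (w (N + j)))"
    if j: "max J 1 \<le> j" "1 / r \<le> real j" for j
  proof -
    let ?V = "W (N + j)"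
    have WN: "(norm (W N))\<^sup>2 \<le> real j * (r / 2)"
    proof -
      have "2 * (norm (W N))\<^sup>2 \<le> real J * r" using J r by (simp add: pos_divide_le_eq)
      also have "\<dots> \<le> real j * r" using j r by (intro mult_right_mono) auto
      finally show ?thesis by simp
    qed
    define E where "E = ?V\<^sup>2 - (W N)\<^sup>2 - of_nat j * (2 * c)"
    have E: "norm E \<le> real j * (r / 2)" unfolding E_def by (rule near)
    have V2: "?V\<^sup>2 = (W N)\<^sup>2 + of_nat j * (2 * c) + E" by (simp add: E_def)
    have "\<bar>Re ((W N)\<^sup>2)\<bar> \<le> (norm (W N))\<^sup>2" using abs_Re_le_cmod[of "(W N)\<^sup>2"] by (simp add: norm_power)
    moreover have "\<bar>Re E\<bar> \<le> norm E" by (rule abs_Re_le_cmod)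
    moreover have "Re (?V\<^sup>2) = Re ((W N)\<^sup>2) + real j * (2 * r) + Re E" unfolding V2 r(2) by simp
    ultimately have low: "real j * r \<le> Re (?V\<^sup>2)" using WN E by linarith
    have up: "(norm ?V)\<^sup>2 \<le> real j * (3 * r)"
    proof -
      have "norm (?V\<^sup>2) \<le> norm ((W N)\<^sup>2) + norm (of_nat j * (2 * c)) + norm E"
        unfolding V2 by (intro norm_triangle_le add_mono norm_triangle_ineq order_refl)
      moreover have "norm (of_nat j * (2 * c)) = real j * (2 * r)" using r by (simp add: norm_mult)
      ultimately show ?thesis using WN E by (simp add: norm_power algebra_simps)
    qed
    have Re2: "Re (?V\<^sup>2) = (Re ?V)\<^sup>2 - (Im ?V)\<^sup>2" by (simp add: power2_eq_square)
    have "1 \<le> real j * r" using j r by (simp add: pos_divide_le_eq)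
    then have "1 \<le> (Re ?V)\<^sup>2" using low Re2 zero_le_power2[of "Im ?V"] by linarith
    then have X1: "1 \<le> Re ?V" using Re_W(1)[of "N + j"] power2_le_imp_le[of 1 "Re ?V"] by simp
    have Vn: "0 < norm ?V" using W_ne by simp
    have "(norm ?V)\<^sup>2 \<le> 2 * (Re ?V)\<^sup>2" using low Re2 \<open>1 \<le> real j * r\<close> unfolding cmod_power2 by linarith
    then have "norm ?V \<le> sqrt (2 * (Re ?V)\<^sup>2)" by (rule real_le_rsqrt)
    then have Vle: "norm ?V \<le> sqrt 2 * Re ?V" using X1 by (simp add: real_sqrt_mult)
    have "norm ?V \<le> sqrt (real j * (3 * r))" using up by (rule real_le_rsqrt)
    also have "\<dots> \<le> sqrt ((real (N + j) + 1) * (3 * r))" using r by (intro real_sqrt_le_mono mult_right_mono) auto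
    finally have Vj: "norm ?V \<le> sqrt (3 * r) * sqrt (real (N + j) + 1)" by (simp add: real_sqrt_mult mult.commute)
    have "1 / (4 * sqrt 2 * sqrt (3 * r)) / sqrt (real (N + j) + 1) = 1 / (4 * sqrt 2) * (1 / (sqrt (3 * r) * sqrt (real (N + j) + 1)))"
      by simp
    also have "\<dots> \<le> 1 / (4 * sqrt 2) * (1 / norm ?V)"
      using Vj Vn r by (intro mult_left_mono divide_left_mono mult_pos_pos) auto
    also have "\<dots> = norm ?V / sqrt 2 / (4 * (norm ?V)\<^sup>2)" by (simp add: power2_eq_square)
    also have "\<dots> \<le> Re ?V / (4 * (norm ?V)\<^sup>2)"
      using Vle by (intro divide_right_mono) (auto simp: pos_divide_le_eq mult.commute)
    also have "\<dots> \<le> (2 * Re ?V - 1) / (4 * (norm ?V)\<^sup>2)" using X1 by (intro divide_right_mono) auto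
    also have "\<dots> = (1 - (norm (w (N + j)))\<^sup>2) / 4"
      using Re_W(2)[of "N + j"] Vn by (simp add: field_simps)
    also have "\<dots> \<le> (1 - norm (w (N + j))) / (1 + norm (w (N + j)))"
    proof -
      have "(1 - t\<^sup>2) / 4 \<le> (1 - t) / (1 + t)" if t: "0 \<le> t" "t < 1" for t :: real
      proof -
        have "(1 + t)\<^sup>2 \<le> 2\<^sup>2" using t by (intro power_mono) auto
        then have "(1 - t) * (1 + t)\<^sup>2 \<le> (1 - t) * 4" using t by (intro mult_left_mono) auto
        then have "(1 - t) * (1 + t)\<^sup>2 / 4 \<le> 1 - t" by simp
        moreover have "(1 - t\<^sup>2) / 4 * (1 + t) = (1 - t) * (1 + t)\<^sup>2 / 4"
          by (simp add: power2_eq_square algebra_simps)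
        ultimately have "(1 - t\<^sup>2) / 4 * (1 + t) \<le> 1 - t" by (simp only:)
        then show ?thesis using t by (subst pos_le_divide_eq) auto
      qed
      then show ?thesis using w_norm by simp
    qed
    finally show ?thesis .
  qed
  obtain J1 :: nat where J1: "1 / r \<le> real J1" using real_arch_simple by blast
  show thesis
  proof
    show "0 < 1 / (4 * sqrt 2 * sqrt (3 * r))" using r by simp
    show "\<forall>\<^sub>F n in sequentially. 1 / (4 * sqrt 2 * sqrt (3 * r)) / sqrt (real n + 1) \<le> (1 - norm (w n)) / (1 + norm (w n))"
    proof (rule eventually_sequentiallyI)
      fix n assume n: "N + (max J 1 + J1) \<le> n"
      then show "1 / (4 * sqrt 2 * sqrt (3 * r)) / sqrt (real n + 1) \<le> (1 - norm (w n)) / (1 + norm (w n))"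
      proof -
        have le: "max J 1 \<le> n - N" "J1 \<le> n - N" "N + (n - N) = n" using n by linarith+
        then have "1 / r \<le> real (n - N)" using J1 by linarith
        then show ?thesis using main[OF le(1)] unfolding le(3) by blast
      qed
    qed
  qed
qed

end

theorem (in parabolic_orbit) Harnack_sum_lower_bound:
  obtains \<gamma> :: real where "0 < \<gamma>"
    "\<And>n. \<gamma> * sqrt (real n) \<le> (\<Sum>k\<le>n. (1 - norm ((g ^^ k) 0)) / (1 + norm ((g ^^ k) 0)))"
proof -
  define \<epsilon> where "\<epsilon> k = (1 - norm (w k)) / (1 + norm (w k))" for k
  have pos: "0 < \<epsilon> k" for k unfolding \<epsilon>_def using w_norm[of k] by (intro divide_pos_pos) (auto intro: add_pos_nonneg)
  obtain b c C d where "0 < d" "d \<le> e" "0 \<le> C"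
    "\<And>z. \<lbrakk>z \<noteq> 1; norm (1 - z) < d\<rbrakk> \<Longrightarrow> h z \<noteq> 1 \<and>
       norm (1 / (1 - h z) - (1 / (1 - z) + b + c * (1 - z))) \<le> C * (norm (1 - z))\<^sup>2"
    by (rule expansion) (rule that)
  then interpret parabolic_expansion g h e b c C d by unfold_locales auto
  obtain \<gamma> where \<gamma>: "0 < \<gamma>" "\<forall>\<^sub>F n in sequentially. \<gamma> / sqrt (real n + 1) \<le> \<epsilon> n"
    by (rule eventually_lower_bound[folded \<epsilon>_def]) (rule that)
  then obtain N where N: "\<And>n. N \<le> n \<Longrightarrow> \<gamma> / sqrt (real n + 1) \<le> \<epsilon> n" by (auto simp: eventually_sequentially)
  \<comment> \<open>The finitely many terms before \<open>N\<close> are positive, so a smaller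
    constant covers all indices.\<close>
  define \<gamma>' where "\<gamma>' = min \<gamma> (Min (\<epsilon> ` {..N}))"
  have "0 < Min (\<epsilon> ` {..N})" using pos by (subst Min_gr_iff) auto
  then have \<gamma>': "0 < \<gamma>'" using \<gamma>(1) by (simp add: \<gamma>'_def)
  have low: "\<gamma>' / sqrt (real n + 1) \<le> \<epsilon> n" for n
  proof (cases "N \<le> n")
    case True
    have "\<gamma>' / sqrt (real n + 1) \<le> \<gamma> / sqrt (real n + 1)" by (intro divide_right_mono) (auto simp: \<gamma>'_def)
    then show ?thesis using N[OF True] by linarith
  next
    case False
    have "\<gamma>' / sqrt (real n + 1) \<le> \<gamma>' / 1" using \<gamma>' by (intro divide_left_mono) auto
    also have "\<dots> \<le> Min (\<epsilon> ` {..N})" by (simp add: \<gamma>'_def)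
    also have "\<dots> \<le> \<epsilon> n" using False by (intro Min_le) auto
    finally show ?thesis .
  qed
  show thesis
  proof (rule that[OF \<gamma>'])
    fix n
    have "\<gamma>' * sqrt (real n) \<le> \<gamma>' * sqrt (real n + 1)" using \<gamma>' by (intro mult_left_mono) auto
    also have "\<dots> = \<gamma>' * ((real n + 1) / sqrt (real n + 1))" by (subst real_div_sqrt) auto
    also have "\<dots> = (real n + 1) * (\<gamma>' / sqrt (real n + 1))" by simp
    also have "\<dots> = (\<Sum>k\<le>n. \<gamma>' / sqrt (real n + 1))" by simp
    also have "\<dots> \<le> (\<Sum>k\<le>n. \<epsilon> k)"
    proof (rule sum_mono)
      fix k assume "k \<in> {..n}"
      then have "\<gamma>' / sqrt (real n + 1) \<le> \<gamma>' / sqrt (real k + 1)" using \<gamma>' by (intro divide_left_mono) auto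
      then show "\<gamma>' / sqrt (real n + 1) \<le> \<epsilon> k" using low[of k] by linarith
    qed
    finally show "\<gamma>' * sqrt (real n) \<le> (\<Sum>k\<le>n. (1 - norm ((g ^^ k) 0)) / (1 + norm ((g ^^ k) 0)))"
      by (simp add: \<epsilon>_def w_def)
  qed
qed

section \<open>The natural extension\<close>

lemma space_mu_tilde [simp]: "space (mu_tilde f U \<psi>) = backward_orbits f U"
  unfolding mu_tilde_def by (rule space_extend_measure) auto

lemma mu_tilde_cylinder:
  assumes "S \<in> sets (mu U \<psi>)"
  shows "{x \<in> backward_orbits f U. x j \<in> S} \<in> sets (mu_tilde f U \<psi>)"
proof -
  have "S \<in> sets (restrict_space borel (frontier U))" using assms by (simp add: mu_def)
  then show ?thesis
    unfolding mu_tilde_def by (subst sets_extend_measure) (auto intro!: sigma_sets.Basic)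
qed

text \<open>When no measure has the prescribed values, \<open>extend_measure\<close> falls back to
  the zero measure, which is the first alternative.\<close>

lemma emeasure_mu_tilde_cases:
  "emeasure (mu_tilde f U \<psi>) (backward_orbits f U) = 0 \<or>
   (\<forall>j. \<forall>S\<in>sets (mu U \<psi>). emeasure (mu_tilde f U \<psi>) {x \<in> backward_orbits f U. x j \<in> S} = emeasure (mu U \<psi>) S)"
proof -
  define \<Omega> where "\<Omega> = backward_orbits f U"
  define I where "I = (UNIV :: nat set) \<times> sets (restrict_space borel (frontier U))"
  define G where "G = (\<lambda>(j :: nat, A). {x \<in> \<Omega>. x j \<in> A})" 
  define m where "m = (\<lambda>(j :: nat, A). emeasure (mu U \<psi>) A)"
  have M: "mu_tilde f U \<psi> = extend_measure \<Omega> I G m"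
    by (simp add: mu_tilde_def \<Omega>_def I_def G_def m_def)
  have G: "G ` I \<subseteq> Pow \<Omega>" by (auto simp: G_def)
  show ?thesis
  proof (cases "\<exists>\<mu>'. (\<forall>i\<in>I. \<mu>' (G i) = m i) \<and> measure_space \<Omega> (sigma_sets \<Omega> (G ` I)) \<mu>'")
    case True
    then obtain \<mu>' where \<mu>': "\<And>i. i \<in> I \<Longrightarrow> \<mu>' (G i) = m i" "measure_space \<Omega> (sigma_sets \<Omega> (G ` I)) \<mu>'"
      by blast
    have "emeasure (mu_tilde f U \<psi>) (G i) = m i" if "i \<in> I" for i
      using \<mu>'(2) by (intro emeasure_extend_measure[OF M \<mu>'(1) G _ _ that])
        (auto simp: M sets_extend_measure[OF G] measure_space_def)
    then have "emeasure (mu_tilde f U \<psi>) {x \<in> \<Omega>. x j \<in> S} = emeasure (mu U \<psi>) S" if "S \<in> sets (mu U \<psi>)" for j S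
      using that by (force simp: I_def G_def m_def mu_def)
    then show ?thesis by (simp add: \<Omega>_def)
  next
    case False
    then have "mu_tilde f U \<psi> = sigma \<Omega> (G ` I)"
      unfolding M extend_measure_def by auto
    then show ?thesis by (simp add: emeasure_sigma)
  qed
qed

lemma sets_mu [simp]: "sets (mu U \<psi>) = sets (restrict_space borel (frontier U))"
  and space_mu [simp]: "space (mu U \<psi>) = frontier U"
  by (simp_all add: mu_def space_restrict_space)

lemma sets_omega: "sets (omega U \<phi>) = sets (mu U \<psi>)"
  by (simp add: omega_def)

lemma sets_mu_iff: "S \<in> sets (mu U \<psi>) \<longleftrightarrow> S \<in> sets borel \<and> S \<subseteq> frontier U"
  by (auto simp: sets_restrict_space_iff)

text \<open>The measure \<^const>\<open>mu_tilde\<close> is zero when no extension exists, and \<^const>\<open>RN_deriv\<close> is zero when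
  no density exists; in both cases the claim is trivial.  Otherwise the set where the density is
  positive is a countable union of sets \<open>A\<close> as in the assumption.\<close>

lemma AE_omega_tilde:
  assumes "\<And>A \<delta> R. \<lbrakk>0 < \<delta>; A \<in> sets (mu U \<psi>); \<And>x. x \<in> A \<Longrightarrow> norm x \<le> R;
      density (mu U \<psi>) (RN_deriv (mu U \<psi>) (omega U \<phi>)) = omega U \<phi>;
      \<And>S. \<lbrakk>S \<in> sets (mu U \<psi>); S \<subseteq> A\<rbrakk> \<Longrightarrow> ennreal \<delta> * emeasure (mu U \<psi>) S \<le> emeasure (omega U \<phi>) S;
      \<And>j S. S \<in> sets (mu U \<psi>) \<Longrightarrow> emeasure (mu_tilde f U \<psi>) {x \<in> backward_orbits f U. x j \<in> S} = emeasure (mu U \<psi>) S\<rbrakk>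
     \<Longrightarrow> AE x in mu_tilde f U \<psi>. x 0 \<in> A \<longrightarrow> P x"
  shows "AE x in omega_tilde f U \<phi> \<psi>. P x"
proof -
  let ?\<mu> = "mu U \<psi>" and ?\<nu> = "omega U \<phi>" and ?M = "mu_tilde f U \<psi>"
  define \<rho> where "\<rho> = RN_deriv ?\<mu> ?\<nu>"
  have \<rho>_meas [measurable]: "\<rho> \<in> borel_measurable ?\<mu>" by (simp add: \<rho>_def)
  have x0: "(\<lambda>x. x 0) \<in> measurable ?M ?\<mu>"
  proof (rule measurableI)
    show "x 0 \<in> space ?\<mu>" if "x \<in> space ?M" for x using that by (simp add: backward_orbits_def)
    show "(\<lambda>x. x 0) -` S \<inter> space ?M \<in> sets ?M" if "S \<in> sets ?\<mu>" for S
      using mu_tilde_cylinder[OF that, of f 0] by (simp add: vimage_def Int_def conj_commute)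
  qed
  have AE_iff: "(AE x in omega_tilde f U \<phi> \<psi>. P x) \<longleftrightarrow> (AE x in ?M. 0 < \<rho> (x 0) \<longrightarrow> P x)"
    unfolding omega_tilde_def \<rho>_def by (intro AE_density measurable_compose[OF x0] borel_measurable_RN_deriv)
  consider "emeasure ?M (space ?M) = 0" | "\<rho> = (\<lambda>_. 0)" |
    "\<And>j S. S \<in> sets ?\<mu> \<Longrightarrow> emeasure ?M {x \<in> backward_orbits f U. x j \<in> S} = emeasure ?\<mu> S" "density ?\<mu> \<rho> = ?\<nu>"
  proof (cases "\<exists>q. q \<in> borel_measurable ?\<mu> \<and> density ?\<mu> q = ?\<nu>")
    case True
    then obtain q where q: "q \<in> borel_measurable ?\<mu>" "density ?\<mu> q = ?\<nu>" by blast
    have "density ?\<mu> \<rho> = ?\<nu>" unfolding \<rho>_def by (rule RN_derivI[OF q])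
    then show ?thesis using that emeasure_mu_tilde_cases[of f U \<psi>] by auto
  next
    case False
    then have "\<rho> = (\<lambda>_. 0)" unfolding \<rho>_def RN_deriv_def by auto
    then show ?thesis using that by blast
  qed
  then show ?thesis
  proof cases
    case 1
    then have "AE x in ?M. 0 < \<rho> (x 0) \<longrightarrow> P x" by (intro AE_I[of _ _ "space ?M"] sets.top) auto
    then show ?thesis by (simp only: AE_iff)
  next
    case 2
    then show ?thesis unfolding AE_iff by simp
  next
    case 3
    \<comment> \<open>One index serves both cut-offs, so these sets exhaust the points where the
      density is positive; boundedness is for the compactness argument on the derivative.\<close>
    define A where "A j = {x \<in> space ?\<mu>. 1 / (real j + 1) \<le> \<rho> x \<and> norm x \<le> real j}" for j :: nat
    have id_meas: "(\<lambda>x. x) \<in> borel_measurable ?\<mu>"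
      unfolding measurable_cong_sets[OF sets_mu refl] by (intro measurable_restrict_space1) simp
    have "AE x in ?M. x 0 \<in> A j \<longrightarrow> P x" for j
    proof (rule assms)
      show A: "A j \<in> sets ?\<mu>" unfolding A_def using id_meas by measurable
      show "0 < 1 / (real j + 1)" by simp
      show "norm x \<le> real j" if "x \<in> A j" for x using that by (simp add: A_def)
      show "density ?\<mu> (RN_deriv ?\<mu> ?\<nu>) = ?\<nu>" using 3(2) by (simp add: \<rho>_def)
      show "ennreal (1 / (real j + 1)) * emeasure ?\<mu> S \<le> emeasure ?\<nu> S" if S: "S \<in> sets ?\<mu>" "S \<subseteq> A j" for S
      proof -
        have "ennreal (1 / (real j + 1)) * emeasure ?\<mu> S = (\<integral>\<^sup>+x. ennreal (1 / (real j + 1)) * indicator S x \<partial>?\<mu>)"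
          using S(1) by (rule nn_integral_cmult_indicator[symmetric])
        also have "\<dots> \<le> (\<integral>\<^sup>+x. \<rho> x * indicator S x \<partial>?\<mu>)"
          using S(2) by (intro nn_integral_mono) (auto simp: indicator_def A_def)
        also have "\<dots> = emeasure (density ?\<mu> \<rho>) S" using S(1) by (intro emeasure_density[symmetric]) auto
        finally show ?thesis using 3(2) by simp
      qed
      show "emeasure ?M {x \<in> backward_orbits f U. x i \<in> S} = emeasure ?\<mu> S" if "S \<in> sets ?\<mu>" for i S
        by (rule 3(1)[OF that])
    qed
    then have "AE x in ?M. \<forall>j. x 0 \<in> A j \<longrightarrow> P x" unfolding AE_all_countable by blast
    moreover have "AE x in ?M. x \<in> space ?M" by (rule AE_space)
    ultimately have "AE x in ?M. 0 < \<rho> (x 0) \<longrightarrow> P x"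
    proof eventually_elim
      case (elim x)
      show ?case
      proof
        assume pos: "0 < \<rho> (x 0)"
        have "\<exists>j0 :: nat. 1 / (real j0 + 1) \<le> \<rho> (x 0)"
        proof (cases "\<rho> (x 0)" rule: ennreal_cases)
          case (real q)
          then have "0 < q" using pos by simp
          then obtain j0 where "inverse (real (Suc j0)) < q" using reals_Archimedean by blast
          then have "ennreal (1 / (real j0 + 1)) \<le> ennreal q"
            by (intro ennreal_leI) (simp add: inverse_eq_divide add.commute)
          then show ?thesis using real by auto
        qed auto
        then obtain j0 :: nat where j0: "ennreal (1 / (real j0 + 1)) \<le> \<rho> (x 0)" by blast
        obtain j1 :: nat where j1: "norm (x 0) \<le> real j1" using real_arch_simple by blast
        define j where "j = max j0 j1"
        have "ennreal (1 / (real j + 1)) \<le> ennreal (1 / (real j0 + 1))"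
          by (intro ennreal_leI divide_left_mono) (auto simp: j_def)
        then have "ennreal (1 / (real j + 1)) \<le> \<rho> (x 0)" using j0 by (rule order_trans)
        moreover have "norm (x 0) \<le> real j" using j1 by (simp add: j_def)
        ultimately have "x 0 \<in> A j" using elim(2) by (simp add: A_def backward_orbits_def)
        then show "P x" using elim(1) by blast
      qed
    qed
    then show ?thesis by (simp only: AE_iff)
  qed
qed

section \<open>From frequent visits to contraction\<close>

text \<open>The gap \<open>r0 < r\<close> leaves room for closed balls; their union over the bounded
  part of \<open>X\<close> is compact as a sum of compact sets, so the minimum of the derivative on
  it still exceeds 1.\<close>

lemma uniform_expansion_near_bounded_set:
  assumes f: "f holomorphic_on UNIV" and X: "closed X" and r0: "0 < r0" "r0 < r"
    and exp: "\<And>x z. \<lbrakk>x \<in> X; z \<in> ball x r\<rbrakk> \<Longrightarrow> 1 < norm (deriv f z)"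
  obtains \<kappa> :: real where "1 < \<kappa>" "\<And>x z. \<lbrakk>x \<in> X; norm x \<le> R; z \<in> ball x r0\<rbrakk> \<Longrightarrow> \<kappa> \<le> norm (deriv f z)"
proof -
  define S where "S = (\<lambda>(x, u). x + u) ` ((X \<inter> cball 0 R) \<times> cball 0 r0)"
  have S_exp: "1 < norm (deriv f z)" if "z \<in> S" for z
  proof -
    obtain x u where "x \<in> X" "norm u \<le> r0" "z = x + u" using \<open>z \<in> S\<close> by (auto simp: S_def)
    then show ?thesis using r0 by (intro exp[of x]) (auto simp: dist_norm)
  qed
  have mem: "z \<in> S" if "x \<in> X" "norm x \<le> R" "z \<in> ball x r0" for x z
    unfolding S_def using that
    by (intro image_eqI[of _ _ "(x, z - x)"]) (auto simp: dist_norm norm_minus_commute)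
  have "compact S" unfolding S_def
    using X by (intro compact_continuous_image compact_Times closed_Int_compact)
      (auto intro!: continuous_intros simp: case_prod_unfold)
  moreover have "continuous_on S (\<lambda>z. norm (deriv f z))"
    using holomorphic_on_imp_continuous_on[OF holomorphic_deriv[OF f open_UNIV]] continuous_on_subset
    by (intro continuous_intros) blast
  ultimately show thesis
  proof (cases "S = {}")
    case True
    then show thesis using mem by (intro that[of 2]) auto
  next
    case False
    obtain z0 where "z0 \<in> S" "\<And>z. z \<in> S \<Longrightarrow> norm (deriv f z0) \<le> norm (deriv f z)"
      using continuous_attains_inf[OF \<open>compact S\<close> False \<open>continuous_on S _\<close>] by blast
    then show thesis using S_exp mem by (intro that[of "norm (deriv f z0)"]) blast+
  qed
qed

lemma contraction_along_frequent_orbit: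
  assumes f: "f holomorphic_on UNIV" and r: "0 < r" and X: "closed X"
    and branch: "\<And>x y. \<lbrakk>x \<in> X; y \<in> X; f y = x\<rbrakk> \<Longrightarrow> \<exists>F. inverse_branch_on f (ball x r) F \<and> F x = y"
    and exp: "\<And>x z. \<lbrakk>x \<in> X; z \<in> ball x r\<rbrakk> \<Longrightarrow> 1 < norm (deriv f z)"
    and x: "\<And>n. x n \<in> X" "\<And>n. f (x (Suc n)) = x n"
    and A: "\<And>z. z \<in> A \<Longrightarrow> norm z \<le> R"
    and freq: "\<forall>\<^sub>F n in sequentially. 1 / 2 * root 3 (real n) \<le> real (card {k\<in>{1..n}. x k \<in> A})"
  shows "\<exists>F :: nat \<Rightarrow> complex \<Rightarrow> complex.
             (\<forall>n. inverse_branch_on (f ^^ n) (ball (x 0) r) (F n) \<and> F n (x 0) = x n) \<and>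
             (\<forall>r0. 0 < r0 \<and> r0 < r \<longrightarrow>
                (\<exists>n0. \<exists>K>1. \<forall>n\<ge>n0.
                   F n ` ball (x 0) r0 \<subseteq> ball (x n) (K powr (- root 3 (real n)) * r0)))"
proof -
  have "\<forall>n. \<exists>F. inverse_branch_on f (ball (x n) r) F \<and> F (x n) = x (Suc n)"
    using branch x by blast
  then obtain G where G: "\<And>n. inverse_branch_on f (ball (x n) r) (G n)" "\<And>n. G n (x n) = x (Suc n)"
    by metis
  obtain F :: "nat \<Rightarrow> complex \<Rightarrow> complex" where F: "\<And>n. inverse_branch_on (f ^^ n) (ball (x 0) r) (F n)" "\<And>n. F n (x 0) = x n"
    "\<And>r0 \<kappa> A n z. \<lbrakk>r0 \<le> r; 1 \<le> \<kappa>; \<forall>k. x k \<in> A \<longrightarrow> (\<forall>z\<in>ball (x k) r0. \<kappa> \<le> norm (deriv f z));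
        z \<in> ball (x 0) r0\<rbrakk> \<Longrightarrow> dist (x n) (F n z) \<le> dist (x 0) z / \<kappa> ^ card {k\<in>{1..n}. x k \<in> A}"
  proof (rule inverse_branches_along_orbit[where f = f and r = r and x = x and G = G, OF f r G])
    show "1 < norm (deriv f z)" if "z \<in> ball (x n) r" for n z using exp[OF x(1) that] .
  qed (rule that)
  have "\<exists>n0. \<exists>K>1. \<forall>n\<ge>n0. F n ` ball (x 0) r0 \<subseteq> ball (x n) (K powr (- root 3 (real n)) * r0)"
    if r0: "0 < r0" "r0 < r" for r0
  proof -
    obtain \<kappa> :: real where \<kappa>: "1 < \<kappa>" "\<And>x z. \<lbrakk>x \<in> X; norm x \<le> R; z \<in> ball x r0\<rbrakk> \<Longrightarrow> \<kappa> \<le> norm (deriv f z)"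
    proof (rule uniform_expansion_near_bounded_set[OF f X r0, where R = R])
      show "1 < norm (deriv f z)" if "x \<in> X" "z \<in> ball x r" for x z using exp[OF that] .
    qed (rule that)
    obtain n0 where n0: "\<And>n. n0 \<le> n \<Longrightarrow> 1 / 2 * root 3 (real n) \<le> real (card {k\<in>{1..n}. x k \<in> A})"
      using freq by (auto simp: eventually_sequentially)
    \<comment> \<open>The factor 1/2 in the number of visits becomes the exponent 1/2 in
      \<open>K\<close>.\<close>
    have "F n ` ball (x 0) r0 \<subseteq> ball (x n) ((\<kappa> powr (1 / 2)) powr (- root 3 (real n)) * r0)" if n: "n0 \<le> n" for n
    proof (rule image_subsetI)
      fix z assume z: "z \<in> ball (x 0) r0"
      let ?N = "card {k\<in>{1..n}. x k \<in> A}"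
      have "dist (x n) (F n z) \<le> dist (x 0) z / \<kappa> ^ ?N"
      proof (rule F(3)[OF _ _ _ z])
        show "\<forall>k. x k \<in> A \<longrightarrow> (\<forall>z\<in>ball (x k) r0. \<kappa> \<le> norm (deriv f z))"
          using \<kappa>(2)[OF x(1) A] by blast
      qed (use r0 \<kappa>(1) in auto)
      also have "\<dots> < r0 / \<kappa> ^ ?N" using z \<kappa>(1) by (intro divide_strict_right_mono) auto
      also have "\<dots> = \<kappa> powr (- real ?N) * r0" using \<kappa>(1) by (simp add: powr_minus powr_realpow divide_inverse mult.commute)
      also have "\<dots> \<le> \<kappa> powr (1 / 2 * (- root 3 (real n))) * r0"
        using n0[OF n] \<kappa>(1) r0 by (intro mult_right_mono powr_mono) auto
      also have "\<dots> = (\<kappa> powr (1 / 2)) powr (- root 3 (real n)) * r0" by (simp only: powr_powr)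
      finally show "F n z \<in> ball (x n) ((\<kappa> powr (1 / 2)) powr (- root 3 (real n)) * r0)" by simp
    qed
    moreover have "1 < \<kappa> powr (1 / 2)" using \<kappa>(1) by simp
    ultimately show ?thesis by blast
  qed
  then show ?thesis using F(1,2) by blast
qed

lemma frequently_near_zero_angle:
  assumes "AE \<theta> in angle. Q \<theta>" "0 < t"
  obtains \<theta> where "0 < \<theta>" "\<theta> < t" "\<theta> < 2 * pi" "Q \<theta>"
proof -
  have "\<exists>\<theta>. 0 < \<theta> \<and> \<theta> < min t (2 * pi) \<and> Q \<theta>"
  proof (rule ccontr)
    assume *: "\<not> ?thesis"
    have "AE \<theta> in lborel. \<theta> \<notin> {0<..<min t (2 * pi)}"
      using assms(1) unfolding AE_angle_iff by eventually_elim (use * in auto)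
    then have "emeasure lborel {0<..<min t (2 * pi)} = 0"
      by (subst (asm) AE_iff_measurable[of "{0<..<min t (2 * pi)}"]) auto
    then show False using assms(2) by (simp add: min_def split: if_splits)
  qed
  then show thesis using that by auto
qed

section \<open>Hyperbolic distance and the inner function of the domain\<close>

lemma tanh_artanh_real:
  fixes x :: real
  assumes "0 \<le> x" "x < 1"
  shows "tanh (artanh x) = x"
proof -
  define q where "q = (1 + x) / (1 - x)"
  have q: "0 < q" using assms by (simp add: q_def)
  have "artanh x = ln (sqrt q)" using q by (simp add: artanh_def q_def ln_sqrt)
  then have "tanh (artanh x) = (q - 1) / (q + 1)" using q by (simp add: tanh_ln_real)
  also have "\<dots> = x"
  proof -
    have "q * (1 - x) = 1 + x" using assms by (simp add: q_def)
    then show ?thesis using q by (simp add: divide_eq_eq algebra_simps)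
  qed
  finally show ?thesis .
qed

lemma pseudohyperbolic_less_1:
  assumes "norm z < 1" "norm a < 1"
  shows "norm (z - a) / norm (1 - cnj a * z) < 1"
proof -
  have "norm (cnj a * z) < 1"
    using assms mult_strict_mono'[of "norm a" 1 "norm z" 1] by (simp add: norm_mult)
  then have "0 < norm (1 - cnj a * z)" by auto
  then have "0 < (1 - (norm z)\<^sup>2) * (1 - (norm a)\<^sup>2) / (norm (1 - cnj a * z))\<^sup>2"
    using assms by (intro divide_pos_pos mult_pos_pos) (auto simp: abs_square_less_1)
  then have "(norm (z - a) / norm (1 - cnj a * z))\<^sup>2 < 1\<^sup>2"
    unfolding pseudohyperbolic_complement[OF assms, symmetric] by simp
  then show ?thesis by (rule power2_less_imp_less) simp
qed

text \<open>The hyperbolic distance is defined by some chosen Riemann map \<open>h\<close>.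
  Schwarz-Pick for the inverse of \<open>\<phi>\<close> after \<open>h\<close> gives the one
  inequality that carries a vanishing distance in \<open>U\<close> over to the disc.\<close>

lemma tanh_hyperbolic_dist_ge:
  assumes \<phi>: "conformal_map (ball 0 1) U \<phi>" and z: "norm z < 1" and a: "norm a < 1"
  shows "norm (z - a) / norm (1 - cnj a * z) \<le> tanh (hyperbolic_dist U (\<phi> z) (\<phi> a) / 2)"
proof -
  define h where "h = (SOME h. conformal_map (ball 0 1) U h)"
  have h: "conformal_map (ball 0 1) U h" 
    using someI[where P = "conformal_map (ball 0 1) U", OF \<phi>] by (simp add: h_def)
  have hol: "\<phi> holomorphic_on ball 0 1" "h holomorphic_on ball 0 1"
    and inj: "inj_on \<phi> (ball 0 1)" "inj_on h (ball 0 1)" and im: "\<phi> ` ball 0 1 = U" "h ` ball 0 1 = U"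
    using \<phi> h by (auto simp: conformal_map_def bij_betw_def)
  obtain k where k: "k holomorphic_on \<phi> ` ball 0 1" "\<And>z. z \<in> ball 0 1 \<Longrightarrow> k (\<phi> z) = z"
    using holomorphic_has_inverse[OF hol(1) open_ball inj(1)] by metis
  define m where "m = k \<circ> h"
  have "m holomorphic_on ball 0 1"
    unfolding m_def by (rule holomorphic_on_compose_gen[OF hol(2) k(1)]) (simp add: im)
  moreover have "m ` ball 0 1 \<subseteq> ball 0 1"
  proof
    fix u assume "u \<in> m ` ball 0 1"
    then obtain v where "v \<in> ball 0 1" "u = k (h v)" by (auto simp: m_def)
    then obtain v' where "v' \<in> ball 0 1" "h v = \<phi> v'" using im by (metis imageE imageI)
    then show "u \<in> ball 0 1" using k(2) \<open>u = k (h v)\<close> by simp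
  qed
  moreover define z' where "z' = inv_into (ball 0 1) h (\<phi> z)"
  moreover define a' where "a' = inv_into (ball 0 1) h (\<phi> a)"
  have mem: "\<phi> z \<in> h ` ball 0 1" "\<phi> a \<in> h ` ball 0 1" using z a im by auto
  then have "norm z' < 1" "norm a' < 1" "h z' = \<phi> z" "h a' = \<phi> a"
    using inv_into_into[OF mem(1)] inv_into_into[OF mem(2)] f_inv_into_f[OF mem(1)] f_inv_into_f[OF mem(2)]
    by (simp_all add: z'_def a'_def)
  moreover from this have "m z' = z" "m a' = a" using k(2) z a by (simp_all add: m_def)
  ultimately have "norm (z - a) / norm (1 - cnj a * z) \<le> norm (z' - a') / norm (1 - cnj a' * z')"
    using Schwarz_Pick[of m z' a'] by simp
  also have "\<dots> = tanh (artanh (norm (z' - a') / norm (1 - cnj a' * z')))"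
    using pseudohyperbolic_less_1[OF \<open>norm z' < 1\<close> \<open>norm a' < 1\<close>] by (subst tanh_artanh_real) auto
  also have "\<dots> = tanh (hyperbolic_dist U (\<phi> z) (\<phi> a) / 2)"
    by (simp add: hyperbolic_dist_def disc_dist_def Let_def z'_def a'_def h_def)
  finally show ?thesis .
qed

locale invariant_domain =
  fixes f \<phi> g :: "complex \<Rightarrow> complex" and U :: "complex set" and y :: complex
  assumes f: "f holomorphic_on UNIV" and \<phi>: "conformal_map (ball 0 1) U \<phi>" and fU: "f ` U \<subseteq> U"
    and front: "f ` frontier U \<subseteq> frontier U" and y: "y \<in> frontier U"
    and g_eq: "g = conjugate_by (ball 0 1) \<phi> f"
begin

lemma \<phi>_props: "\<phi> holomorphic_on ball 0 1" "inj_on \<phi> (ball 0 1)" "\<phi> ` ball 0 1 = U"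
  using \<phi> by (auto simp: conformal_map_def bij_betw_def)

lemma f_cont: "continuous_on UNIV f"
  using f by (rule holomorphic_on_imp_continuous_on)

lemma U_open: "open U"
  using open_mapping_thm3[OF \<phi>_props(1) open_ball \<phi>_props(2)] \<phi>_props(3) by simp

lemma g_mem: "z \<in> ball 0 1 \<Longrightarrow> g z \<in> ball 0 1" and g_conj: "z \<in> ball 0 1 \<Longrightarrow> \<phi> (g z) = f (\<phi> z)"
proof -
  assume z: "z \<in> ball 0 1"
  have "f (\<phi> z) \<in> \<phi> ` ball 0 1" using z \<phi>_props(3) fU by blast
  from inv_into_into[OF this] f_inv_into_f[OF this]
  show "g z \<in> ball 0 1" "\<phi> (g z) = f (\<phi> z)" by (simp_all add: g_eq conjugate_by_def)
qed

lemma g_hol: "g holomorphic_on ball 0 1"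
proof -
  obtain k where k: "k holomorphic_on \<phi> ` ball 0 1" "\<And>z. z \<in> ball 0 1 \<Longrightarrow> k (\<phi> z) = z"
    using holomorphic_has_inverse[OF \<phi>_props(1) open_ball \<phi>_props(2)] by metis
  have "(f \<circ> \<phi>) holomorphic_on ball 0 1"
    by (rule holomorphic_on_compose_gen[OF \<phi>_props(1) f]) simp
  then have "(k \<circ> (f \<circ> \<phi>)) holomorphic_on ball 0 1"
    by (rule holomorphic_on_compose_gen[OF _ k(1)]) (use \<phi>_props(3) fU in auto)
  then show ?thesis
  proof (rule holomorphic_transform)
    show "(k \<circ> (f \<circ> \<phi>)) z = g z" if "z \<in> ball 0 1" for z
      using k(2)[OF g_mem[OF that]] g_conj[OF that] by simp
  qed
qed

lemma iterate_mem: "z \<in> ball 0 1 \<Longrightarrow> (g ^^ k) z \<in> ball 0 1"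
  by (induction k) (simp_all add: g_mem del: mem_ball mem_ball_0)

lemma iterate_conj: "z \<in> ball 0 1 \<Longrightarrow> \<phi> ((g ^^ k) z) = (f ^^ k) (\<phi> z)"
  by (induction k) (simp_all add: g_conj iterate_mem del: mem_ball mem_ball_0)

lemma iterate_hol: "(g ^^ k) holomorphic_on ball 0 1"
proof (induction k)
  case (Suc k)
  then show ?case unfolding funpow.simps
    by (rule holomorphic_on_compose_gen[OF _ g_hol]) (use iterate_mem in blast)
qed (simp add: id_def)

lemma f_iterate_cont: "continuous_on UNIV (f ^^ k)"
proof (induction k)
  case (Suc k)
  then show ?case unfolding funpow.simps
    by (rule continuous_on_compose) (rule continuous_on_subset[OF f_cont], simp)
qed (simp add: id_def)

lemma f_iterate_frontier: "x \<in> frontier U \<Longrightarrow> (f ^^ k) x \<in> frontier U"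
  by (induction k) (use front in auto)

lemma semiconjugacy_iterate: "semiconjugacy U \<phi> (g ^^ k) (f ^^ k) y"
proof
  show "conformal_map (ball 0 1) U \<phi>" "y \<in> frontier U" by (fact \<phi> y)+
  show "(g ^^ k) holomorphic_on ball 0 1" "continuous_on UNIV (f ^^ k)" by (fact iterate_hol f_iterate_cont)+
  show "(g ^^ k) ` ball 0 1 \<subseteq> ball 0 1" using iterate_mem by blast
  show "(f ^^ k) x \<notin> U" if "x \<in> frontier U" for x
    using f_iterate_frontier[OF that, of k] U_open by (simp add: frontier_def interior_open)
  show "(f ^^ k) (\<phi> z) = \<phi> ((g ^^ k) z)" if "norm z < 1" for z using iterate_conj[of z k] that by simp
qed

text \<open>At almost every angle \<open>norm g\<close> has radial limit 1, and near 1 the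
  continuous extension \<open>h\<close> inherits this limit. A nonzero small angle of this kind
  gives a point close to, but different from, 1.\<close>

lemma arc_of_unimodular_values:
  assumes h: "h holomorphic_on ball 1 e" "0 < e" "\<And>z. z \<in> ball 1 e \<inter> ball 0 1 \<Longrightarrow> h z = g z" and d: "0 < d"
  shows "\<exists>\<zeta>. norm \<zeta> = 1 \<and> \<zeta> \<noteq> 1 \<and> norm (1 - \<zeta>) < d \<and> norm (h \<zeta>) = 1"
proof -
  interpret semiconjugacy U \<phi> g f y using semiconjugacy_iterate[of 1] by simp
  have "continuous_on UNIV cis" by (intro continuous_intros)
  then have "isCont cis 0" by (simp add: continuous_on_eq_continuous_at)
  then have "cis \<midarrow>0\<rightarrow> 1" by (simp add: isCont_def)
  then obtain t where t: "0 < t" "\<And>\<theta>. \<theta> \<noteq> 0 \<Longrightarrow> norm \<theta> < t \<Longrightarrow> dist (cis \<theta>) 1 < min d e"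
    using d h(2) unfolding LIM_def by (metis dist_0_norm dist_commute min_less_iff_conj)
  obtain \<theta> where \<theta>: "0 < \<theta>" "\<theta> < t" "\<theta> < 2 * pi" "cis \<theta> \<in> radial_domain \<phi>"
    by (rule frequently_near_zero_angle[OF AE_in_radial_domain t(1)]) (rule that)
  have near: "dist (cis \<theta>) 1 < min d e" using t(2)[of \<theta>] \<theta> by simp
  have ne: "cis \<theta> \<noteq> 1"
  proof
    assume "cis \<theta> = 1"
    then have "Arg2pi (cis \<theta>) = 0" using Arg2pi_unique[of 1 0 1] by simp
    moreover have "Arg2pi (cis \<theta>) = \<theta>" using \<theta> by (intro Arg2pi_unique[of 1]) (auto simp: cis_conv_exp)
    ultimately show False using \<theta>(1) by simp
  qed
  have lim: "(\<lambda>n. of_real (rad n) * cis \<theta>) \<longlonglongrightarrow> cis \<theta>"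
    using tendsto_mult[OF tendsto_of_real[OF rad_tendsto] tendsto_const[of "cis \<theta>"]] by simp
  have b: "cis \<theta> \<in> ball 1 e" using near by (simp add: dist_commute)
  have "isCont h (cis \<theta>)"
    using h(1) b by (metis continuous_on_eq_continuous_at holomorphic_on_imp_continuous_on open_ball)
  then have "(\<lambda>n. h (of_real (rad n) * cis \<theta>)) \<longlonglongrightarrow> h (cis \<theta>)" using lim by (rule isCont_tendsto_compose)
  then have 1: "(\<lambda>n. norm (h (of_real (rad n) * cis \<theta>))) \<longlonglongrightarrow> norm (h (cis \<theta>))" by (rule tendsto_norm)
  have "\<forall>\<^sub>F n in sequentially. of_real (rad n) * cis \<theta> \<in> ball 1 e"
    using lim open_ball b by (rule topological_tendstoD)
  then have "\<forall>\<^sub>F n in sequentially. norm (h (of_real (rad n) * cis \<theta>)) = norm (g (of_real (rad n) * cis \<theta>))"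
  proof eventually_elim
    case (elim n)
    then show ?case using h(3)[of "of_real (rad n) * cis \<theta>"] rad_circle[of "cis \<theta>" n] by simp
  qed
  then have "(\<lambda>n. norm (g (of_real (rad n) * cis \<theta>))) \<longlonglongrightarrow> norm (h (cis \<theta>))"
    by (rule Lim_transform_eventually[OF 1])
  then have "norm (h (cis \<theta>)) = 1" using g_inner[OF \<theta>(4)] LIMSEQ_unique by blast
  then show ?thesis using ne near by (intro exI[of _ "cis \<theta>"]) (auto simp: dist_norm norm_minus_commute)
qed

lemma Harnack_sum:
  assumes dw: "denjoy_wolff_point g 1" and ns: "\<not> singularity_of g 1"
    and step: "\<And>z. z \<in> U \<Longrightarrow> (\<lambda>n. hyperbolic_dist U ((f ^^ n) z) ((f ^^ Suc n) z)) \<longlonglongrightarrow> 0"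
  obtains \<gamma> :: real where "0 < \<gamma>"
    "\<And>n. \<gamma> * sqrt (real n) \<le> (\<Sum>k\<le>n. (1 - norm ((g ^^ k) 0)) / (1 + norm ((g ^^ k) 0)))"
proof -
  obtain e h where h: "0 < e" "h holomorphic_on ball 1 e" "\<And>z. z \<in> ball 1 e \<inter> ball 0 1 \<Longrightarrow> h z = g z"
    using ns by (auto simp: singularity_of_def)
  have "parabolic_orbit g h e"
  proof
    show "g holomorphic_on ball 0 1" "h holomorphic_on ball 1 e" "0 < e" by (fact g_hol h)+
    show "g ` ball 0 1 \<subseteq> ball 0 1" using g_mem by blast
    show "(\<lambda>n. (g ^^ n) 0) \<longlonglongrightarrow> 1" using dw by (simp add: denjoy_wolff_point_def)
    show "h z = g z" if "z \<in> ball 1 e \<inter> ball 0 1" for z using h(3) that .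
    show "\<exists>\<zeta>. norm \<zeta> = 1 \<and> \<zeta> \<noteq> 1 \<and> norm (1 - \<zeta>) < d \<and> norm (h \<zeta>) = 1" if "0 < d" for d
      by (rule arc_of_unimodular_values[OF h(2,1,3) that])
    let ?p = "\<lambda>n. norm ((g ^^ n) 0 - (g ^^ Suc n) 0) / norm (1 - cnj ((g ^^ Suc n) 0) * (g ^^ n) 0)"
    let ?t = "\<lambda>n. tanh (hyperbolic_dist U ((f ^^ n) (\<phi> 0)) ((f ^^ Suc n) (\<phi> 0)) / 2)"
    have le: "?p n \<le> ?t n" for n
    proof -
      have m: "norm ((g ^^ n) 0) < 1" "norm ((g ^^ Suc n) 0) < 1"
        using iterate_mem[of 0 n] iterate_mem[of 0 "Suc n"] by simp_all
      show ?thesis using tanh_hyperbolic_dist_ge[OF \<phi> m] iterate_conj[of 0 n] iterate_conj[of 0 "Suc n"] by simp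
    qed
    have "\<phi> 0 \<in> U" using \<phi>_props(3) by auto
    then have lim: "(\<lambda>n. hyperbolic_dist U ((f ^^ n) (\<phi> 0)) ((f ^^ Suc n) (\<phi> 0)) / 2) \<longlonglongrightarrow> 0 / 2"
      by (intro tendsto_divide step tendsto_const) auto
    have "isCont tanh (0 / 2 :: real)" by (intro continuous_intros) auto
    from isCont_tendsto_compose[OF this lim] have t: "?t \<longlonglongrightarrow> 0" by (simp only: div_0 tanh_0)
    show "?p \<longlonglongrightarrow> 0"
      by (rule tendsto_sandwich[OF _ _ tendsto_const t]) (use le in auto)
  qed
  then show thesis by (rule parabolic_orbit.Harnack_sum_lower_bound) (rule that)
qed

end

theorem theorem3:
  fixes f \<phi> \<psi> :: "complex \<Rightarrow> complex" and U :: "complex set" and r :: real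
  assumes "transcendental_entire f"
    and "disc_uniformization f U \<phi>"
    and "half_plane_uniformization f U \<psi>"
    and "expanding_with_radius f U \<phi> \<psi> r"
  shows "AE x in omega_tilde f U \<phi> \<psi>.
           \<exists>F :: nat \<Rightarrow> complex \<Rightarrow> complex.
             (\<forall>n. inverse_branch_on (f ^^ n) (ball (x 0) r) (F n) \<and> F n (x 0) = x n) \<and>
             (\<forall>r0. 0 < r0 \<and> r0 < r \<longrightarrow>
                (\<exists>n0. \<exists>K>1. \<forall>n\<ge>n0.
                   F n ` ball (x 0) r0 \<subseteq> ball (x n) (K powr (- root 3 (real n)) * r0)))"
    (is "AE x in _. ?P x")
proof (cases "frontier U = {}")
  case True
  \<comment> \<open>The main case needs a boundary point as default value; without one there are no
    backward orbits.\<close>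
  then have "space (omega_tilde f U \<phi> \<psi>) = {}"
    by (auto simp: omega_tilde_def backward_orbits_def)
  then show ?thesis by (intro AE_I2) simp
next
  case False
  then obtain y where y: "y \<in> frontier U" by blast
  define g where "g = conjugate_by (ball 0 1) \<phi> f"
  have f: "f holomorphic_on UNIV" using assms(1) by (simp add: transcendental_entire_def)
  have \<phi>: "conformal_map (ball 0 1) U \<phi>" and dw: "denjoy_wolff_point g 1"
    using assms(2) by (auto simp: disc_uniformization_def g_def)
  have r: "0 < r" and dp: "doubly_parabolic_Baker_domain f U"
    and ns: "\<exists>p. denjoy_wolff_point g p \<and> \<not> singularity_of g p"
    and branch: "\<And>x y. \<lbrakk>x \<in> frontier U; y \<in> frontier U; f y = x\<rbrakk> \<Longrightarrow> \<exists>F. inverse_branch_on f (ball x r) F \<and> F x = y"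
    and exp: "\<And>x z. \<lbrakk>x \<in> frontier U; z \<in> ball x r\<rbrakk> \<Longrightarrow> 1 < norm (deriv f z)"
    using assms(4) unfolding expanding_with_radius_def g_def by blast+
  have comp: "U \<in> components (fatou_set f)" and fU: "f ` U \<subseteq> U"
    and step: "\<And>z. z \<in> U \<Longrightarrow> (\<lambda>n. hyperbolic_dist U ((f ^^ n) z) ((f ^^ Suc n) z)) \<longlonglongrightarrow> 0"
    using dp unfolding doubly_parabolic_Baker_domain_def by blast+
  have front: "f ` frontier U \<subseteq> frontier U"
    using f comp fU by (intro fatou_component_frontier_image holomorphic_on_imp_continuous_on)
  interpret invariant_domain f \<phi> g U y
    by unfold_locales (fact f \<phi> fU front y g_def)+
  obtain p where p: "denjoy_wolff_point g p" "\<not> singularity_of g p" using ns by blast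
  have "(\<lambda>n. (g ^^ n) 0) \<longlonglongrightarrow> p" "(\<lambda>n. (g ^^ n) 0) \<longlonglongrightarrow> 1"
    using p(1) dw by (simp_all add: denjoy_wolff_point_def)
  then have "p = 1" by (rule LIMSEQ_unique)
  then have ns1: "\<not> singularity_of g 1" using p(2) by simp
  define \<epsilon> where "\<epsilon> k = (1 - norm ((g ^^ k) 0)) / (1 + norm ((g ^^ k) 0))" for k
  obtain \<gamma> :: real where \<gamma>: "0 < \<gamma>" "\<And>n. \<gamma> * sqrt (real n) \<le> (\<Sum>k\<le>n. \<epsilon> k)"
  proof (rule Harnack_sum[OF dw ns1, folded \<epsilon>_def])
    show "(\<lambda>n. hyperbolic_dist U ((f ^^ n) z) ((f ^^ Suc n) z)) \<longlonglongrightarrow> 0" if "z \<in> U" for z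
      using step[OF that] .
  qed (rule that)
  have \<epsilon>0: "0 \<le> \<epsilon> k" for k
    using iterate_mem[of 0 k] unfolding \<epsilon>_def by (intro divide_nonneg_nonneg) auto
  show ?thesis
  proof (rule AE_omega_tilde)
    fix A \<delta> R
    assume \<delta>: "0 < \<delta>" and A: "A \<in> sets (mu U \<psi>)" and AR: "\<And>x. x \<in> A \<Longrightarrow> norm x \<le> R"
      and low: "\<And>S. \<lbrakk>S \<in> sets (mu U \<psi>); S \<subseteq> A\<rbrakk> \<Longrightarrow> ennreal \<delta> * emeasure (mu U \<psi>) S \<le> emeasure (omega U \<phi>) S"
      and cyl: "\<And>j S. S \<in> sets (mu U \<psi>) \<Longrightarrow>
        emeasure (mu_tilde f U \<psi>) {x \<in> backward_orbits f U. x j \<in> S} = emeasure (mu U \<psi>) S"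
    let ?\<mu> = "mu U \<psi>" and ?\<nu> = "omega U \<phi>" and ?M = "mu_tilde f U \<psi>"
    have pre: "f -` S \<inter> frontier U \<in> sets ?\<mu>" if S: "S \<in> sets ?\<mu>" for S
    proof -
      have "f -` S \<in> sets borel"
        using measurable_sets[OF borel_measurable_continuous_onI[OF f_cont], of S] S[unfolded sets_mu_iff] by simp
      then show ?thesis unfolding sets_mu_iff by auto
    qed
    interpret swept_system ?\<mu> ?\<nu> f \<epsilon> A \<delta> \<gamma>
    proof
      show "f \<in> measurable ?\<mu> ?\<mu>"
        using front pre by (intro measurableI) auto
      show "emeasure ?\<mu> (f -` S \<inter> space ?\<mu>) = emeasure ?\<mu> S" if S: "S \<in> sets ?\<mu>" for S
      proof -
        have "emeasure ?\<mu> (f -` S \<inter> space ?\<mu>) = emeasure ?M {x \<in> backward_orbits f U. x 1 \<in> f -` S \<inter> frontier U}"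
          using cyl[OF pre[OF S], of 1] by simp
        \<comment> \<open>Invariance of \<open>mu\<close> is read off from the natural extension:
          both events have the measure prescribed by their own coordinate.\<close>
        also have "{x \<in> backward_orbits f U. x 1 \<in> f -` S \<inter> frontier U} = {x \<in> backward_orbits f U. x 0 \<in> S}"
          by (auto simp: backward_orbits_def)
        finally show ?thesis using cyl[OF S, of 0] by simp
      qed
      show "sets ?\<nu> = sets ?\<mu>" by (rule sets_omega)
      from sets_eq_imp_space_eq[OF this] have sp: "space ?\<nu> = frontier U" by simp
      interpret c0: semiconjugacy U \<phi> "g ^^ 0" "f ^^ 0" y by (rule semiconjugacy_iterate)
      have "emeasure ?\<nu> (frontier U) = emeasure angle {\<theta>. c0.bv \<theta> \<in> frontier U}"
        by (intro c0.omega_eq) auto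
      also have "\<dots> \<le> emeasure angle UNIV" by (intro emeasure_mono) auto
      finally show "emeasure ?\<nu> (space ?\<nu>) \<le> 1" by (simp add: sp emeasure_angle_UNIV)
      show "ennreal (\<epsilon> k) * emeasure ?\<nu> S \<le> emeasure ?\<nu> ((f ^^ k) -` S \<inter> space ?\<mu>)" if S: "S \<in> sets ?\<mu>" for S k
      proof -
        interpret ck: semiconjugacy U \<phi> "g ^^ k" "f ^^ k" y by (rule semiconjugacy_iterate)
        have "{x \<in> frontier U. (f ^^ k) x \<in> S} = (f ^^ k) -` S \<inter> space ?\<mu>" by auto
        then show ?thesis using ck.omega_Harnack[of S] S unfolding sets_mu_iff \<epsilon>_def by simp
      qed
    qed (fact A \<delta> low \<epsilon>0 \<gamma>)+
    have "AE x in ?M. x 0 \<in> A \<longrightarrow> (\<forall>\<^sub>F n in sequentially. 1 / 2 * root 3 (real n) \<le> real (card {k\<in>{1..n}. x k \<in> A}))"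
    proof (rule AE_backward_visits)
      show "x n \<in> space ?\<mu> \<and> f (x (Suc n)) = x n" if "x \<in> space ?M" for x n
        using that by (simp add: backward_orbits_def)
      show "{x \<in> space ?M. x j \<in> S} \<in> sets ?M \<and> emeasure ?M {x \<in> space ?M. x j \<in> S} = emeasure ?\<mu> S"
        if "S \<in> sets ?\<mu>" for j S
        using mu_tilde_cylinder[OF that] cyl[OF that] by simp
    qed
    moreover have "AE x in ?M. x \<in> space ?M" by (rule AE_space)
    ultimately show "AE x in ?M. x 0 \<in> A \<longrightarrow> ?P x"
    proof (eventually_elim, intro impI)
      fix x assume *: "x 0 \<in> A \<longrightarrow> (\<forall>\<^sub>F n in sequentially. 1 / 2 * root 3 (real n) \<le> real (card {k\<in>{1..n}. x k \<in> A}))"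
        and x: "x \<in> space ?M" and x0: "x 0 \<in> A"
      have orb: "x n \<in> frontier U" "f (x (Suc n)) = x n" for n using x by (simp_all add: backward_orbits_def)
      show "?P x"
      proof (rule contraction_along_frequent_orbit[where X = "frontier U" and A = A and R = R, OF f r])
        show "\<exists>F. inverse_branch_on f (ball x r) F \<and> F x = y" if "x \<in> frontier U" "y \<in> frontier U" "f y = x" for x y
          using branch[OF that] .
        show "1 < norm (deriv f z)" if "x \<in> frontier U" "z \<in> ball x r" for x z using exp[OF that] .
      qed (use * x0 orb AR in auto)
    qed
  qed
qed

end
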